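(* Consider the mixed least squares-total least squares (MTLS) problem $\min_{E_2,f}\|[E_2,f]\|_F$ subject to $A_1x_1+(A_2+E_2)x_2=b+f$, with the data, standing assumptions and notation given in the context, and assume that one of the genericity conditions (G1) or (G2) of the context holds. Let $x^*=x_{\rm M}\in\mathbb{R}^n$ be its unique solution and put $r=Ax^*-b$, $G(x^* )=[x^{*T},\,-1]\otimes I_m$, $P=A^TA-\tilde\sigma_{n_2+1}^2W$, $H_0=I_m-\frac{2rr^T}{\|r\|_2^2}$. Let $[A,b]$ be perturbed to $[\hat A,\hat b]=[A+\Delta A,\,b+\Delta b]$ with $\Delta A\in\mathbb{R}^{m\times n}$, $\Delta b\in\mathbb{R}^m$. If $\|[\Delta A,\Delta b]\|_F$ is sufficiently small, then the perturbed MTLS problem $\min_{\hat E_2,\hat f}\|[\hat E_2,\hat f]\|_F$ subject to $\hat A_1x_1+(\hat A_2+\hat E_2)x_2=\hat b+\hat f$ has a unique MTLS solution $\hat x$. Moreover, $$\hat x=x^*+K\,\mathrm{vec}([\Delta A,\Delta b])+\mathcal{O}\big(\|[\Delta A,\Delta b]\|_F^2\big)\qquad\text{as }\|[\Delta A,\Delta b]\|_F\to0,$$ where $$K=\varphi'(A,b)=-P^{-1}\Big(A^TH_0\,G(x^* )+[\,I_n\otimes r^T,\ O_{n\times m}\,]\Big),$$ $\varphi$ being the map $[A,b]\mapsto x_{\rm M}$ and $\varphi'(A,b)$ its Fréchet derivative at $[A,b]$, represented as an $n\times m(n+1)$ matrix acting on $\mathrm{vec}([\Delta A,\Delta b])$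.
   Context: Data and standing assumptions: $A\in\mathbb{R}^{m\times n}$, $m\ge n$, has full column rank, $b\in\mathbb{R}^m$, and $Ax=b$ is not consistent. $A=[A_1,A_2]$ with $A_1\in\mathbb{R}^{m\times n_1}$ (columns known exactly), $A_2\in\mathbb{R}^{m\times n_2}$, $n_1+n_2=n$; vectors $x=[x_1^T,x_2^T]^T$ and the perturbed matrix $\hat A=[\hat A_1,\hat A_2]$ are partitioned conformally. An MTLS solution is a vector $x=[x_1^T,x_2^T]^T\in\mathbb{R}^n$ satisfying $A_1x_1+(A_2+E_2)x_2=b+f$ for some $E_2\in\mathbb{R}^{m\times n_2}$, $f\in\mathbb{R}^m$ attaining the minimum of $\|[E_2,f]\|_F$ over all triples $(E_2,f,x)$ satisfying the constraint; it is denoted $x_{\rm M}$ when unique. QR factorization: for an orthogonal $Q\in\mathbb{R}^{m\times m}$, $Q^T[A_1,A_2,b]=\begin{bmatrix}R_{11}&R_{12}&R_{1b}\\0&R_{22}&R_{2b}\end{bmatrix}$, upper triangular, with row blocks of sizes $n_1$, $m-n_1$ and column blocks of sizes $n_1,n_2,1$. Put $W=\mathrm{diag}(O_{n_1},I_{n_2})$, $\tilde W=\mathrm{diag}(W,1)$, $\tilde A=[A,b]$, and $\tilde\sigma_{n_2+1}=\sigma_{n_2+1}([R_{22},R_{2b}])$. Genericity conditions: (G1) $\sigma_{n_2}(R_{22})>\sigma_{n_2+1}([R_{22},R_{2b}])>0$; (G2) $\lambda_n(A^TA,W)>\lambda_{n+1}(\tilde A^T\tilde A,\tilde W)$. Here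 $\sigma_i$ is the $i$-th largest singular value (if $n_2=0$, read $\sigma_0=+\infty$), and $\lambda_i(M,N)$ is the $i$-th largest generalized eigenvalue of the pair $(M,N)$, infinite eigenvalues (arising when $N$ is singular) being counted first. One has $\tilde\sigma_{n_2+1}^2=\lambda_{n+1}(\tilde A^T\tilde A,\tilde W)$, and under (G1) or (G2) the MTLS solution is unique and given by $x_{\rm M}=(A^TA-\tilde\sigma_{n_2+1}^2W)^{-1}A^Tb$. Notation: $\mathrm{vec}(\cdot)$ stacks the columns of a matrix; $\otimes$ is the Kronecker product, $A\otimes B=[a_{ij}B]$; $O_{p\times q}$ is the zero matrix. *)

theory Defs
  imports
    "Jordan_Normal_Form.Char_Poly"
    "Jordan_Normal_Form.Gauss_Jordan_Elimination"
    "Jordan_Normal_Form.DL_Rank"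
    "HOL-Library.Extended_Real"
begin

definition append_cols :: "'a::zero mat \<Rightarrow> 'a mat \<Rightarrow> 'a mat" (infixr \<open>@\<^sub>c\<close> 65) where
  "A @\<^sub>c B = four_block_mat A B (0\<^sub>m 0 (dim_col A)) (0\<^sub>m 0 (dim_col B))"

definition left_cols :: "nat \<Rightarrow> 'a mat \<Rightarrow> 'a mat" where
  "left_cols k A = mat_of_cols (dim_row A) (take k (cols A))"

definition right_cols :: "nat \<Rightarrow> 'a mat \<Rightarrow> 'a mat" where
  "right_cols k A = mat_of_cols (dim_row A) (drop k (cols A))"

definition mat_of_col :: "'a vec \<Rightarrow> 'a mat" where
  "mat_of_col v = mat_of_cols (dim_vec v) [v]"

definition vnorm :: "real vec \<Rightarrow> real" where
  "vnorm v = sqrt (v \<bullet> v)"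

definition fnorm :: "real mat \<Rightarrow> real" where
  "fnorm A = sqrt (\<Sum>i<dim_row A. \<Sum>j<dim_col A. (A $$ (i, j))\<^sup>2)"

definition mat_vec :: "'a mat \<Rightarrow> 'a vec" where
  "mat_vec A = vec (dim_row A * dim_col A) (\<lambda>k. A $$ (k mod dim_row A, k div dim_row A))"

definition kron :: "'a::times mat \<Rightarrow> 'a mat \<Rightarrow> 'a mat" where
  "kron A B = mat (dim_row A * dim_row B) (dim_col A * dim_col B)
     (\<lambda>(i, j). A $$ (i div dim_row B, j div dim_col B) * B $$ (i mod dim_row B, j mod dim_col B))"

(* The library's orthogonal_mat only asks for pairwise orthogonal nonzero columns,
   and its upper_triangular reads entries outside a matrix with more rows than columns;
   hence the following two predicates. *)
definition orthonormal_mat :: "real mat \<Rightarrow> bool" where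
  "orthonormal_mat Q \<longleftrightarrow> square_mat Q \<and> inverts_mat Q (transpose_mat Q) \<and> inverts_mat (transpose_mat Q) Q"

definition upper_triangular_rect :: "'a::zero mat \<Rightarrow> bool" where
  "upper_triangular_rect A \<longleftrightarrow> (\<forall>i<dim_row A. \<forall>j<dim_col A. j < i \<longrightarrow> A $$ (i, j) = 0)"

definition singular_values :: "real mat \<Rightarrow> real list" where
  "singular_values M =
     map sqrt (rev (sorted_list_of_multiset (proots (char_poly (transpose_mat M * M)))))"

(* sing_val i M is the i-th largest singular value, counted from 1;
   sing_val_ext adds the convention that the 0-th one is infinite. *)
definition sing_val :: "nat \<Rightarrow> real mat \<Rightarrow> real" where
  "sing_val i M = singular_values M ! (i - 1)"

definition sing_val_ext :: "nat \<Rightarrow> real mat \<Rightarrow> ereal" where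
  "sing_val_ext i M = (if i = 0 then \<infinity> else ereal (sing_val i M))"

(* det (M - t N) as a polynomial in t. *)
definition pencil_poly :: "real mat \<Rightarrow> real mat \<Rightarrow> real poly" where
  "pencil_poly M N = det (map_mat (\<lambda>a. [:a:]) M - [:0, 1:] \<cdot>\<^sub>m map_mat (\<lambda>a. [:a:]) N)"

(* For a regular pencil, the multiplicity of the eigenvalue infinity is the degree
   deficiency of det (M - t N).  Only real finite eigenvalues are listed; for M symmetric
   positive definite and N symmetric positive semidefinite there are no others. *)
definition gen_eigenvalues :: "real mat \<Rightarrow> real mat \<Rightarrow> ereal list" where
  "gen_eigenvalues M N =
     replicate (dim_row M - degree (pencil_poly M N)) \<infinity> @
     map ereal (rev (sorted_list_of_multiset (proots (pencil_poly M N))))"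

definition gen_eigval :: "nat \<Rightarrow> real mat \<Rightarrow> real mat \<Rightarrow> ereal" where
  "gen_eigval i M N = gen_eigenvalues M N ! (i - 1)"

definition mtls_feasible ::
  "nat \<Rightarrow> nat \<Rightarrow> real mat \<Rightarrow> real vec \<Rightarrow> real mat \<Rightarrow> real vec \<Rightarrow> real vec \<Rightarrow> bool" where
  "mtls_feasible n1 n2 A b E f x \<longleftrightarrow>
     E \<in> carrier_mat (dim_row A) n2 \<and> f \<in> carrier_vec (dim_row A) \<and> x \<in> carrier_vec (n1 + n2) \<and>
     left_cols n1 A *\<^sub>v vec_first x n1 + (right_cols n1 A + E) *\<^sub>v vec_last x n2 = b + f"

definition mtls_solution :: "nat \<Rightarrow> nat \<Rightarrow> real mat \<Rightarrow> real vec \<Rightarrow> real vec \<Rightarrow> bool" where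
  "mtls_solution n1 n2 A b x \<longleftrightarrow>
     (\<exists>E f. mtls_feasible n1 n2 A b E f x \<and>
        (\<forall>E' f' x'. mtls_feasible n1 n2 A b E' f' x' \<longrightarrow>
           fnorm (E @\<^sub>c mat_of_col f) \<le> fnorm (E' @\<^sub>c mat_of_col f')))"

(* The map [A, b] |-> x_M, meaningful where the solution is unique. *)
definition mtls_map :: "nat \<Rightarrow> nat \<Rightarrow> real mat \<Rightarrow> real vec" where
  "mtls_map n1 n2 C =
     (THE x. mtls_solution n1 n2 (left_cols (n1 + n2) C) (col C (n1 + n2)) x)"

(* K represents, with respect to mat_vec, the Frechet derivative at C of a vector-valued
   function of a matrix; the types mat and vec carry no norm-class structure, so the
   definition is written out. *)
definition has_frechet_derivative_mat :: "(real mat \<Rightarrow> real vec) \<Rightarrow> real mat \<Rightarrow> real mat \<Rightarrow> bool" where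
  "has_frechet_derivative_mat g K C \<longleftrightarrow>
     K \<in> carrier_mat (dim_vec (g C)) (dim_row C * dim_col C) \<and>
     (\<forall>\<epsilon>>0. \<exists>\<delta>>0. \<forall>D \<in> carrier_mat (dim_row C) (dim_col C). fnorm D < \<delta> \<longrightarrow>
        g (C + D) \<in> carrier_vec (dim_vec (g C)) \<and>
        vnorm (g (C + D) - g C - K *\<^sub>v mat_vec D) \<le> \<epsilon> * fnorm D)"

end

theory Submission
  imports Defs
begin

text \<open>
  Eliminating the correction turns the MTLS problem into the minimization of
  \<open>\<rho>(y) = |A y - b|\<^sup>2 / (1 + y\<^sup>T W y)\<close>: for fixed \<open>y\<close> the smallest \<open>[E, f]\<close> with
  \<open>f - E y\<^sub>2 = A y - b\<close> has squared Frobenius norm \<open>\<rho>(y)\<close>, where \<open>y\<^sub>2\<close> is the second block of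
  \<open>y\<close> (lemmas \<open>mtls_feasible_lower_bound\<close>, \<open>mtls_feasible_attained\<close>).  The quotient
  \<open>\<rho>(y)\<close> is the generalized Rayleigh quotient of the pair \<open>([A, b]\<^sup>T [A, b], diag(W, 1))\<close> at
  \<open>[y, -1]\<close>, so its infimum is the smallest generalized eigenvalue \<open>\<mu>\<close> of that pair.

  Everything is carried by one algebraic identity.  If \<open>[x, -1]\<close> is an eigenvector for \<open>\<mu>\<close>, that is, if
  \<open>A\<^sup>T (A x - b) = \<mu> W x\<close> and \<open>\<mu> = \<rho>(x)\<close>, then completing the square gives
  \<open>|A y - b|\<^sup>2 - \<mu> (1 + y\<^sup>T W y) = (y - x)\<^sup>T P (y - x)\<close> with \<open>P = A\<^sup>T A - \<mu> W\<close>
  (lemma \<open>tls_completing_square\<close>).  Hence, once \<open>P\<close> is positive definite, \<open>x\<close> is the unique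
  minimizer; and positive definiteness of \<open>P\<close> also forces the eigenvector of \<open>\<mu>\<close> to have a nonzero
  last component, so that \<open>x\<close> exists (lemma \<open>tls_eigenpair_exists\<close>).  The QR factorization
  identifies \<open>\<mu>\<close> with \<open>\<sigma>\<^sup>2\<close>, and each genericity condition makes \<open>P\<close> positive definite,
  because the last singular value and the last generalized eigenvalue in sorted order are minima of
  Rayleigh quotients (lemmas \<open>sing_val_last\<close>, \<open>gen_eigval_last\<close>).

  For perturbed data \<open>[A + E, b + e]\<close> of size \<open>\<epsilon>\<close> let \<open>\<nu>\<close> be the smallest eigenvalue.
  Testing its Rayleigh quotient at the old \<open>x\<close> gives \<open>\<nu> \<le> \<mu> + O(\<epsilon>)\<close>, which already keeps
  \<open>(A + E)\<^sup>T (A + E) - \<nu> W\<close> uniformly positive definite; so the perturbed problem has a unique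
  solution \<open>x'\<close>.  With \<open>d = x' - x\<close>, \<open>r = A x - b\<close> and \<open>\<Delta> = E x - e\<close>, subtracting the two
  normal equations yields
  \<open>((A + E)\<^sup>T (A + E) - \<nu> W) d = (\<nu> - \<mu>) W x - E\<^sup>T r - (A + E)\<^sup>T \<Delta>\<close>, whence
  \<open>d = O(\<epsilon>)\<close>.  The completed square at \<open>y = x\<close> for the perturbed data says
  \<open>\<rho>'(x) - \<nu> = O(|d|\<^sup>2)\<close>, where \<open>\<rho>'\<close> is the quotient \<open>\<rho>\<close> of the perturbed data.
  So no derivative of the eigenvalue is needed:
  \<open>\<nu> = \<mu> + 2 r\<^sup>T \<Delta> / (1 + x\<^sup>T W x) + O(\<epsilon>\<^sup>2)\<close>.  Substituting this, and replacing
  \<open>W x\<close> by \<open>A\<^sup>T r / \<mu>\<close> with \<open>\<mu> (1 + x\<^sup>T W x) = |r|\<^sup>2\<close>, gives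
  \<open>P d = - A\<^sup>T H\<^sub>0 \<Delta> - E\<^sup>T r + O(\<epsilon>\<^sup>2)\<close>, and the Kronecker products in \<open>K\<close> merely rewrite
  \<open>\<Delta>\<close> and \<open>E\<^sup>T r\<close> in terms of the vectorized perturbation.
\<close>

section \<open>Linear algebra with explicit dimensions\<close>

text \<open>
  The premises of the following rules equate dimensions, which rewriting can decide; a premise
  \<open>v \<in> carrier_vec n\<close> with a parameter \<open>n\<close> that is absent from the conclusion would have to be guessed.
\<close>

lemma scalar_add_left: "dim_vec u = dim_vec w \<Longrightarrow> dim_vec v = dim_vec w \<Longrightarrow> (u + v) \<bullet> w = u \<bullet> w + v \<bullet> (w :: real vec)"
  by (rule add_scalar_prod_distrib[of _ "dim_vec w"]) (auto intro: carrier_vecI)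
lemma scalar_add_right: "dim_vec u = dim_vec w \<Longrightarrow> dim_vec v = dim_vec w \<Longrightarrow> w \<bullet> (u + v) = w \<bullet> u + w \<bullet> (v :: real vec)"
  by (rule scalar_prod_add_distrib[of _ "dim_vec w"]) (auto intro: carrier_vecI)
lemma scalar_diff_left: "dim_vec u = dim_vec w \<Longrightarrow> dim_vec v = dim_vec w \<Longrightarrow> (u - v) \<bullet> w = u \<bullet> w - v \<bullet> (w :: real vec)"
  by (rule minus_scalar_prod_distrib[of _ "dim_vec w"]) (auto intro: carrier_vecI)
lemma scalar_diff_right: "dim_vec u = dim_vec w \<Longrightarrow> dim_vec v = dim_vec w \<Longrightarrow> w \<bullet> (u - v) = w \<bullet> u - w \<bullet> (v :: real vec)"
  by (rule scalar_prod_minus_distrib[of _ "dim_vec w"]) (auto intro: carrier_vecI)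
lemma scalar_commute: "dim_vec u = dim_vec v \<Longrightarrow> u \<bullet> v = v \<bullet> (u :: real vec)"
  by (rule comm_scalar_prod[of _ "dim_vec u"]) (auto intro: carrier_vecI)
lemma mult_vec_add: "dim_vec u = dim_col A \<Longrightarrow> dim_vec v = dim_col A \<Longrightarrow> (A :: real mat) *\<^sub>v (u + v) = A *\<^sub>v u + A *\<^sub>v v"
  by (rule mult_add_distrib_mat_vec[of _ "dim_row A" "dim_col A"]) (auto intro: carrier_vecI)
lemma mult_vec_diff: "dim_vec u = dim_col A \<Longrightarrow> dim_vec v = dim_col A \<Longrightarrow> (A :: real mat) *\<^sub>v (u - v) = A *\<^sub>v u - A *\<^sub>v v"
  by (rule mult_minus_distrib_mat_vec[of _ "dim_row A" "dim_col A"]) (auto intro: carrier_vecI)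
lemma mult_vec_smult: "dim_vec u = dim_col A \<Longrightarrow> (A :: real mat) *\<^sub>v (c \<cdot>\<^sub>v u) = c \<cdot>\<^sub>v (A *\<^sub>v u)"
  by (rule mult_mat_vec[of _ "dim_row A" "dim_col A"]) (auto intro: carrier_vecI)
lemma add_mult_vec: "dim_row B = dim_row A \<Longrightarrow> dim_col B = dim_col A \<Longrightarrow> dim_vec u = dim_col A \<Longrightarrow> ((A :: real mat) + B) *\<^sub>v u = A *\<^sub>v u + B *\<^sub>v u"
  by (rule add_mult_distrib_mat_vec[of _ "dim_row A" "dim_col A"]) (auto intro: carrier_vecI)
lemma diff_mult_vec: "dim_row B = dim_row A \<Longrightarrow> dim_col B = dim_col A \<Longrightarrow> dim_vec u = dim_col A \<Longrightarrow> ((A :: real mat) - B) *\<^sub>v u = A *\<^sub>v u - B *\<^sub>v u"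
  by (rule minus_mult_distrib_mat_vec[of _ "dim_row A" "dim_col A"]) (auto intro: carrier_vecI)
lemma smult_mult_vec: "dim_vec u = dim_col A \<Longrightarrow> (c \<cdot>\<^sub>m (A :: real mat)) *\<^sub>v u = c \<cdot>\<^sub>v (A *\<^sub>v u)"
  by (intro eq_vecI) (auto intro: carrier_vecI)
lemma mult_mult_vec: "dim_vec u = dim_col B \<Longrightarrow> dim_row B = dim_col A \<Longrightarrow> ((A :: real mat) * B) *\<^sub>v u = A *\<^sub>v (B *\<^sub>v u)"
  by (rule assoc_mult_mat_vec[of _ "dim_row A" "dim_col A" _ "dim_col B"]) (auto intro: carrier_vecI)
lemma scalar_transpose: "dim_vec u = dim_row A \<Longrightarrow> dim_vec v = dim_col A \<Longrightarrow> v \<bullet> (transpose_mat A *\<^sub>v u) = ((A :: real mat) *\<^sub>v v) \<bullet> u"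
  using transpose_vec_mult_scalar[of A "dim_row A" "dim_col A" v u]
  by (metis carrier_matI carrier_vecI dim_mult_mat_vec index_transpose_mat(2) scalar_commute)
lemma transpose_scalar: "dim_vec u = dim_row A \<Longrightarrow> dim_vec v = dim_col A \<Longrightarrow> (transpose_mat A *\<^sub>v u) \<bullet> v = u \<bullet> ((A :: real mat) *\<^sub>v v)"
  by (rule transpose_vec_mult_scalar[of A "dim_row A" "dim_col A" v u]) (auto intro: carrier_vecI)
lemma scalar_smult_right: "dim_vec u = dim_vec v \<Longrightarrow> u \<bullet> (c \<cdot>\<^sub>v v) = c * (u \<bullet> (v :: real vec))"
  by simp
lemma scalar_smult_left: "dim_vec u = dim_vec v \<Longrightarrow> (c \<cdot>\<^sub>v u) \<bullet> v = c * (u \<bullet> (v :: real vec))"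
  by simp

lemmas vec_linear = scalar_add_left scalar_add_right scalar_diff_left scalar_diff_right
  mult_vec_add mult_vec_diff mult_vec_smult add_mult_vec diff_mult_vec smult_mult_vec mult_mult_vec
  scalar_transpose transpose_scalar scalar_smult_right scalar_smult_left

lemma scalar_symmetric:
  assumes "(B :: real mat) \<in> carrier_mat k k" "transpose_mat B = B" "u \<in> carrier_vec k" "v \<in> carrier_vec k"
  shows "u \<bullet> (B *\<^sub>v v) = v \<bullet> (B *\<^sub>v u)"
  using transpose_vec_mult_scalar[of B k k v u] assms comm_scalar_prod[of v k "B *\<^sub>v u"] by (metis mult_mat_vec_carrier)

lemma scalar_self_ge_0: "0 \<le> v \<bullet> (v :: real vec)"
  by (simp add: scalar_prod_def sum_nonneg)

lemma scalar_self_eq_0: "v \<bullet> v = 0 \<longleftrightarrow> v = 0\<^sub>v (dim_vec (v :: real vec))"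
proof
  assume "v \<bullet> v = 0"
  then have "\<forall>i<dim_vec v. v $ i = 0"
    by (auto simp: scalar_prod_def sum_nonneg_eq_0_iff)
  then show "v = 0\<^sub>v (dim_vec v)" by auto
next
  assume "v = 0\<^sub>v (dim_vec v)"
  then show "v \<bullet> v = 0" by (metis carrier_vecI index_zero_vec(2) scalar_prod_left_zero)
qed

lemma vnorm_ge_0: "0 \<le> vnorm v"
  by (simp add: vnorm_def scalar_self_ge_0)

lemma vnorm_sq: "(vnorm v)\<^sup>2 = v \<bullet> v"
  by (simp add: vnorm_def scalar_self_ge_0)

section \<open>Positive semidefinite forms\<close>

lemma real_quadratic_nonneg_discriminant:
  fixes a b c :: real
  assumes "\<And>t. 0 \<le> a + 2 * t * b + t\<^sup>2 * c" and "0 \<le> c"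
  shows "b\<^sup>2 \<le> a * c"
proof (cases "c = 0")
  case True
  have "b = 0"
  proof (rule ccontr)
    assume b: "b \<noteq> 0"
    \<comment> \<open>At this point the affine function takes the value -1.\<close>
    have "0 \<le> a + 2 * (- (a + 1) / (2 * b)) * b" using assms(1)[of "- (a + 1) / (2 * b)"] True by simp
    with b show False by (simp add: field_simps)
  qed
  then show ?thesis using True by simp
next
  case False
  have "0 \<le> (a + 2 * (- b / c) * b + (- b / c)\<^sup>2 * c) * c"
    using assms(1)[of "- b / c"] assms(2) by (rule mult_nonneg_nonneg)
  also have "\<dots> = a * c - b\<^sup>2" using False by (simp add: field_simps power2_eq_square)
  finally show ?thesis by simp
qed

definition sym_psd :: "nat \<Rightarrow> real mat \<Rightarrow> bool" where
  "sym_psd k B \<longleftrightarrow> B \<in> carrier_mat k k \<and> transpose_mat B = B \<and> (\<forall>z \<in> carrier_vec k. 0 \<le> z \<bullet> (B *\<^sub>v z))"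

lemma sym_psdD:
  assumes "sym_psd k B"
  shows "B \<in> carrier_mat k k" "transpose_mat B = B" "z \<in> carrier_vec k \<Longrightarrow> 0 \<le> z \<bullet> (B *\<^sub>v z)"
    "dim_row B = k" "dim_col B = k"
  using assms by (auto simp: sym_psd_def)

lemma psd_Cauchy_Schwarz:
  assumes B: "sym_psd k B" and z: "z \<in> carrier_vec k" and w: "w \<in> carrier_vec k"
  shows "(z \<bullet> (B *\<^sub>v w))\<^sup>2 \<le> (z \<bullet> (B *\<^sub>v z)) * (w \<bullet> (B *\<^sub>v w))"
proof (rule real_quadratic_nonneg_discriminant)
  note [simp] = sym_psdD(4,5)[OF B] carrier_vecD[OF z] carrier_vecD[OF w]
  fix t
  have "0 \<le> (z + t \<cdot>\<^sub>v w) \<bullet> (B *\<^sub>v (z + t \<cdot>\<^sub>v w))"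
    using sym_psdD(3)[OF B] z w by simp
  also have "\<dots> = z \<bullet> (B *\<^sub>v z) + 2 * t * (z \<bullet> (B *\<^sub>v w)) + t\<^sup>2 * (w \<bullet> (B *\<^sub>v w))"
    using scalar_symmetric[OF sym_psdD(1,2)[OF B] z w]
    by (simp add: vec_linear algebra_simps power2_eq_square)
  finally show "0 \<le> \<dots>" .
qed (use sym_psdD(3)[OF B w] in simp)

text \<open>
  By Cauchy--Schwarz with \<open>w = B z\<close>, the vector \<open>B z\<close> is orthogonal to itself.
\<close>

lemma psd_kernel:
  assumes B: "sym_psd k B" and z: "z \<in> carrier_vec k" and 0: "z \<bullet> (B *\<^sub>v z) = 0"
  shows "B *\<^sub>v z = 0\<^sub>v k"
proof -
  note [simp] = sym_psdD(4,5)[OF B] carrier_vecD[OF z]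
  have Bz: "B *\<^sub>v z \<in> carrier_vec k" using sym_psdD(1)[OF B] z by simp
  have "((B *\<^sub>v z) \<bullet> (B *\<^sub>v z))\<^sup>2 \<le> 0"
    using psd_Cauchy_Schwarz[OF B Bz z] 0 by simp
  then have "(B *\<^sub>v z) \<bullet> (B *\<^sub>v z) = 0" by simp
  then show ?thesis by (simp add: scalar_self_eq_0)
qed

lemma sym_psd_one: "sym_psd k (1\<^sub>m k)"
  by (auto simp: sym_psd_def scalar_self_ge_0)

section \<open>Euclidean and Frobenius norms\<close>

lemma vec_Cauchy_Schwarz:
  assumes "dim_vec u = dim_vec v"
  shows "\<bar>u \<bullet> v\<bar> \<le> vnorm u * vnorm v"
proof (rule power2_le_imp_le)
  have "u \<in> carrier_vec (dim_vec v)" "v \<in> carrier_vec (dim_vec v)" using assms by (auto intro: carrier_vecI)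
  from psd_Cauchy_Schwarz[OF sym_psd_one this]
  show "\<bar>u \<bullet> v\<bar>\<^sup>2 \<le> (vnorm u * vnorm v)\<^sup>2"
    unfolding one_mult_mat_vec[OF \<open>u \<in> _\<close>] one_mult_mat_vec[OF \<open>v \<in> _\<close>] power_mult_distrib vnorm_sq power2_abs .
qed (simp add: vnorm_ge_0)

lemma vnorm_triangle:
  assumes "dim_vec u = dim_vec v"
  shows "vnorm (u + v) \<le> vnorm u + vnorm v"
proof (rule power2_le_imp_le)
  have "(vnorm (u + v))\<^sup>2 = u \<bullet> u + v \<bullet> v + 2 * (u \<bullet> v)"
    using assms by (simp add: vnorm_sq vec_linear scalar_commute[of v u])
  then show "(vnorm (u + v))\<^sup>2 \<le> (vnorm u + vnorm v)\<^sup>2"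
    using vec_Cauchy_Schwarz[OF assms] by (simp add: power2_sum vnorm_sq)
qed (simp add: vnorm_ge_0)

lemma vnorm_smult: "vnorm (c \<cdot>\<^sub>v v) = \<bar>c\<bar> * vnorm v"
proof -
  have "(c \<cdot>\<^sub>v v) \<bullet> (c \<cdot>\<^sub>v v) = c\<^sup>2 * (v \<bullet> v)" by (simp add: power2_eq_square)
  then show ?thesis by (simp only: vnorm_def real_sqrt_mult real_sqrt_abs)
qed

lemma vnorm_uminus: "vnorm (- v) = vnorm (v :: real vec)"
  unfolding vnorm_def by (subst scalar_prod_uminus_left, simp, subst scalar_prod_uminus_right, simp, simp)

lemma vnorm_diff_triangle:
  assumes "dim_vec u = dim_vec v"
  shows "vnorm (u - v) \<le> vnorm u + vnorm v"
proof -
  have "u - v = u + - v" using assms by auto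
  then show ?thesis using vnorm_triangle[of u "- v"] assms by (simp add: vnorm_uminus)
qed

lemma fnorm_ge_0: "0 \<le> fnorm A"
  by (simp add: fnorm_def sum_nonneg)

lemma fnorm_sq: "(fnorm A)\<^sup>2 = (\<Sum>i<dim_row A. \<Sum>j<dim_col A. (A $$ (i, j))\<^sup>2)"
  by (simp add: fnorm_def sum_nonneg)

lemma fnorm_sq_rows: "(fnorm A)\<^sup>2 = (\<Sum>i<dim_row A. (vnorm (row A i))\<^sup>2)"
  unfolding fnorm_sq vnorm_sq
  by (intro sum.cong refl) (auto simp: scalar_prod_def power2_eq_square lessThan_atLeast0)

lemma fnorm_row_vec: "fnorm A = vnorm (vec (dim_row A) (\<lambda>i. vnorm (row A i)))"
proof -
  have "(\<Sum>i<dim_row A. (vnorm (row A i))\<^sup>2) = vec (dim_row A) (\<lambda>i. vnorm (row A i)) \<bullet> vec (dim_row A) (\<lambda>i. vnorm (row A i))"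
    by (simp add: scalar_prod_def power2_eq_square lessThan_atLeast0)
  then have "(fnorm A)\<^sup>2 = (vnorm (vec (dim_row A) (\<lambda>i. vnorm (row A i))))\<^sup>2"
    unfolding fnorm_sq_rows vnorm_sq .
  then show ?thesis using fnorm_ge_0 vnorm_ge_0 by (simp add: power2_eq_iff_nonneg)
qed

lemma fnorm_triangle:
  assumes "A \<in> carrier_mat r k" "B \<in> carrier_mat r k"
  shows "fnorm (A + B) \<le> fnorm A + fnorm B"
proof -
  note [simp] = carrier_matD[OF assms(1)] carrier_matD[OF assms(2)]
  let ?v = "\<lambda>X. vec r (\<lambda>i. vnorm (row X i))"
  have row: "vnorm (row (A + B) i) \<le> vnorm (row A i) + vnorm (row B i)" if "i < r" for i
    using that vnorm_triangle[of "row A i" "row B i"] by (simp add: row_add)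
  have "vnorm (?v (A + B)) \<le> vnorm (?v A + ?v B)"
  proof (rule power2_le_imp_le)
    show "(vnorm (?v (A + B)))\<^sup>2 \<le> (vnorm (?v A + ?v B))\<^sup>2"
      unfolding vnorm_sq scalar_prod_def using row vnorm_ge_0
      by (auto intro!: sum_mono mult_mono simp: add_nonneg_nonneg)
  qed (rule vnorm_ge_0)
  also have "\<dots> \<le> vnorm (?v A) + vnorm (?v B)" by (rule vnorm_triangle) simp
  finally show ?thesis unfolding fnorm_row_vec by simp
qed

lemma fnorm_transpose: "fnorm (transpose_mat A) = fnorm A"
proof -
  have "(\<Sum>i<dim_col A. \<Sum>j<dim_row A. (transpose_mat A $$ (i, j))\<^sup>2)
      = (\<Sum>i<dim_col A. \<Sum>j<dim_row A. (A $$ (j, i))\<^sup>2)"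
    by (intro sum.cong refl) simp
  also have "\<dots> = (\<Sum>j<dim_row A. \<Sum>i<dim_col A. (A $$ (j, i))\<^sup>2)" by (rule sum.swap)
  finally show ?thesis by (simp add: fnorm_def)
qed

lemma vnorm_mult_le:
  assumes "dim_vec v = dim_col A"
  shows "vnorm (A *\<^sub>v v) \<le> fnorm A * vnorm v"
proof (rule power2_le_imp_le)
  have "(vnorm (A *\<^sub>v v))\<^sup>2 = (\<Sum>i<dim_row A. (row A i \<bullet> v)\<^sup>2)"
    unfolding vnorm_sq scalar_prod_def[of "A *\<^sub>v v"] by (simp add: power2_eq_square lessThan_atLeast0)
  also have "\<dots> \<le> (\<Sum>i<dim_row A. (vnorm (row A i))\<^sup>2 * (vnorm v)\<^sup>2)"
  proof (rule sum_mono)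
    fix i
    have "\<bar>row A i \<bullet> v\<bar>\<^sup>2 \<le> (vnorm (row A i) * vnorm v)\<^sup>2"
      by (rule power_mono[OF vec_Cauchy_Schwarz]) (use assms in auto)
    then show "(row A i \<bullet> v)\<^sup>2 \<le> (vnorm (row A i))\<^sup>2 * (vnorm v)\<^sup>2"
      by (simp add: power_mult_distrib)
  qed
  also have "\<dots> = (fnorm A * vnorm v)\<^sup>2"
    by (simp add: fnorm_sq_rows power_mult_distrib sum_distrib_right)
  finally show "(vnorm (A *\<^sub>v v))\<^sup>2 \<le> (fnorm A * vnorm v)\<^sup>2" .
qed (simp add: vnorm_ge_0 fnorm_ge_0)

lemma quadratic_form_le:
  assumes "A \<in> carrier_mat k k" "z \<in> carrier_vec k"
  shows "\<bar>z \<bullet> (A *\<^sub>v z)\<bar> \<le> fnorm A * (z \<bullet> z)"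
proof -
  have "\<bar>z \<bullet> (A *\<^sub>v z)\<bar> \<le> vnorm z * vnorm (A *\<^sub>v z)" by (rule vec_Cauchy_Schwarz) (use assms in auto)
  also have "\<dots> \<le> vnorm z * (fnorm A * vnorm z)"
    by (intro mult_left_mono vnorm_mult_le) (use assms vnorm_ge_0 in auto)
  also have "\<dots> = fnorm A * (z \<bullet> z)" by (simp add: vnorm_sq[symmetric] power2_eq_square)
  finally show ?thesis .
qed

section \<open>The smallest generalized eigenvalue\<close>

lemma injective_imp_inverse:
  fixes B :: "real mat"
  assumes B: "B \<in> carrier_mat k k"
    and inj: "\<And>z. z \<in> carrier_vec k \<Longrightarrow> B *\<^sub>v z = 0\<^sub>v k \<Longrightarrow> z = 0\<^sub>v k"
  shows "\<exists>C. mat_inverse B = Some C \<and> C \<in> carrier_mat k k \<and> B * C = 1\<^sub>m k \<and> C * B = 1\<^sub>m k"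
proof -
  have "det B \<noteq> 0" using det_0_iff_vec_prod_zero_field[OF B] inj by auto
  then have "B \<in> Units (ring_mat TYPE(real) k ())" by (rule det_non_zero_imp_unit[OF B])
  then obtain C where "mat_inverse B = Some C" using mat_inverse(1)[OF B, of "()"] by (cases "mat_inverse B") auto
  with mat_inverse(2)[OF B this] show ?thesis by auto
qed

text \<open>
  This replaces the compactness of the unit sphere.  Cauchy--Schwarz for \<open>B\<close> applied to \<open>z\<close> and
  \<open>B\<^sup>-\<^sup>1 z\<close> reads \<open>(z \<bullet> z)\<^sup>2 \<le> (z \<bullet> B z) (z \<bullet> B\<^sup>-\<^sup>1 z)\<close>, and the last factor is at most a
  constant times \<open>z \<bullet> z\<close>.
\<close>

lemma psd_injective_coercive:
  assumes B: "sym_psd k B"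
    and inj: "\<And>z. z \<in> carrier_vec k \<Longrightarrow> B *\<^sub>v z = 0\<^sub>v k \<Longrightarrow> z = 0\<^sub>v k"
  shows "\<exists>c>0. \<forall>z \<in> carrier_vec k. c * (z \<bullet> z) \<le> z \<bullet> (B *\<^sub>v z)"
proof -
  obtain C where C: "C \<in> carrier_mat k k" and BC: "B * C = 1\<^sub>m k"
    using injective_imp_inverse[OF sym_psdD(1)[OF B] inj] by blast
  have "inverse (fnorm C + 1) * (z \<bullet> z) \<le> z \<bullet> (B *\<^sub>v z)" if z: "z \<in> carrier_vec k" for z
  proof (cases "z \<bullet> z = 0")
    case True
    then show ?thesis using sym_psdD(3)[OF B z] by simp
  next
    case False
    then have pos: "0 < z \<bullet> z" using scalar_self_ge_0[of z] by simp
    note [simp] = sym_psdD(4,5)[OF B] carrier_vecD[OF z] carrier_matD[OF C]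
    let ?w = "C *\<^sub>v z"
    have w: "?w \<in> carrier_vec k" using C z by simp
    have Bw: "B *\<^sub>v ?w = z" using z by (simp add: mult_mult_vec[symmetric] BC)
    have "(z \<bullet> z)\<^sup>2 \<le> (z \<bullet> (B *\<^sub>v z)) * (?w \<bullet> z)"
      using psd_Cauchy_Schwarz[OF B z w] by (simp add: Bw)
    also have "\<dots> \<le> (z \<bullet> (B *\<^sub>v z)) * ((fnorm C + 1) * (z \<bullet> z))"
      using quadratic_form_le[OF C z] pos scalar_commute[of ?w z]
      by (intro mult_left_mono sym_psdD(3)[OF B z]) (simp add: algebra_simps)
    finally have "z \<bullet> z \<le> (z \<bullet> (B *\<^sub>v z)) * (fnorm C + 1)"
      using pos by (simp add: power2_eq_square mult.assoc[symmetric])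
    then show ?thesis using fnorm_ge_0[of C] by (simp add: field_simps)
  qed
  moreover have "0 < inverse (fnorm C + 1)" using fnorm_ge_0[of C] by simp
  ultimately show ?thesis by blast
qed

lemma sym_psd_diff:
  assumes M: "sym_psd k M" and N: "sym_psd k N"
    and psd: "\<forall>z \<in> carrier_vec k. \<mu> * (z \<bullet> (N *\<^sub>v z)) \<le> z \<bullet> (M *\<^sub>v z)"
  shows "sym_psd k (M - \<mu> \<cdot>\<^sub>m N)"
    and "z \<in> carrier_vec k \<Longrightarrow> z \<bullet> ((M - \<mu> \<cdot>\<^sub>m N) *\<^sub>v z) = z \<bullet> (M *\<^sub>v z) - \<mu> * (z \<bullet> (N *\<^sub>v z))"
proof -
  note [simp] = sym_psdD(4,5)[OF M] sym_psdD(4,5)[OF N]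
  show form: "z \<bullet> ((M - \<mu> \<cdot>\<^sub>m N) *\<^sub>v z) = z \<bullet> (M *\<^sub>v z) - \<mu> * (z \<bullet> (N *\<^sub>v z))"
    if "z \<in> carrier_vec k" for z
    using that by (simp add: vec_linear)
  have "transpose_mat (\<mu> \<cdot>\<^sub>m N) = \<mu> \<cdot>\<^sub>m transpose_mat N" by (intro eq_matI) auto
  then have sym: "transpose_mat (M - \<mu> \<cdot>\<^sub>m N) = M - \<mu> \<cdot>\<^sub>m N"
    using sym_psdD(1,2)[OF M] sym_psdD(1,2)[OF N]
    by (subst transpose_minus[of _ k k]) auto
  show "sym_psd k (M - \<mu> \<cdot>\<^sub>m N)"
    unfolding sym_psd_def
  proof (intro conjI ballI)
    show "M - \<mu> \<cdot>\<^sub>m N \<in> carrier_mat k k"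
      using sym_psdD(1)[OF N] by (intro minus_carrier_mat smult_carrier_mat)
  qed (use sym psd form in auto)
qed

text \<open>
  A zero of the semidefinite form of \<open>M - \<mu> N\<close> lies in the kernel of that matrix.
\<close>

lemma form_minimizer_eigenvector:
  assumes M: "sym_psd k M" and N: "sym_psd k N"
    and psd: "\<forall>z \<in> carrier_vec k. \<mu> * (z \<bullet> (N *\<^sub>v z)) \<le> z \<bullet> (M *\<^sub>v z)"
    and z: "z \<in> carrier_vec k" and eq: "z \<bullet> (M *\<^sub>v z) = \<mu> * (z \<bullet> (N *\<^sub>v z))"
  shows "M *\<^sub>v z = \<mu> \<cdot>\<^sub>v (N *\<^sub>v z)"
proof -
  note [simp] = sym_psdD(4,5)[OF M] sym_psdD(4,5)[OF N] carrier_vecD[OF z]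
  have "(M - \<mu> \<cdot>\<^sub>m N) *\<^sub>v z = 0\<^sub>v k"
    using psd_kernel[OF sym_psd_diff(1)[OF M N psd] z] sym_psd_diff(2)[OF M N psd z] eq by simp
  moreover have "(M - \<mu> \<cdot>\<^sub>m N) *\<^sub>v z = M *\<^sub>v z - \<mu> \<cdot>\<^sub>v (N *\<^sub>v z)" by (simp add: vec_linear)
  ultimately show ?thesis by (auto simp: vec_eq_iff)
qed

text \<open>
  The eigenvalue is the supremum \<open>\<mu>\<close> of all \<open>\<nu>\<close> for which \<open>M - \<nu> N\<close> is positive
  semidefinite.  Semidefiniteness survives in the limit because it is a condition on each \<open>z\<close> separately;
  if the form of \<open>M - \<mu> N\<close> had no nontrivial zero, it would be coercive and \<open>\<mu>\<close> could be increased.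
\<close>

lemma smallest_generalized_eigenvalue:
  assumes M: "sym_psd k M" and N: "sym_psd k N"
    and w: "w \<in> carrier_vec k" "0 < w \<bullet> (N *\<^sub>v w)"
  shows "\<exists>\<mu>\<ge>0. (\<forall>z \<in> carrier_vec k. \<mu> * (z \<bullet> (N *\<^sub>v z)) \<le> z \<bullet> (M *\<^sub>v z)) \<and>
    (\<exists>z \<in> carrier_vec k. z \<noteq> 0\<^sub>v k \<and> z \<bullet> (M *\<^sub>v z) = \<mu> * (z \<bullet> (N *\<^sub>v z)))"
proof -
  note [simp] = sym_psdD(4,5)[OF M] sym_psdD(4,5)[OF N]
  define S where "S = {\<mu>. \<forall>z \<in> carrier_vec k. \<mu> * (z \<bullet> (N *\<^sub>v z)) \<le> z \<bullet> (M *\<^sub>v z)}"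
  have S0: "0 \<in> S" using sym_psdD(3)[OF M] by (simp add: S_def)
  have "bdd_above S"
    using w by (intro bdd_aboveI[of _ "w \<bullet> (M *\<^sub>v w) / (w \<bullet> (N *\<^sub>v w))"]) (simp add: S_def field_simps)
  then have upper: "\<nu> \<le> Sup S" if "\<nu> \<in> S" for \<nu> using that by (rule cSup_upper[rotated])
  define \<mu> where "\<mu> = Sup S"
  have \<mu>0: "0 \<le> \<mu>" using upper[OF S0] by (simp add: \<mu>_def)
  have psd: "\<mu> * (z \<bullet> (N *\<^sub>v z)) \<le> z \<bullet> (M *\<^sub>v z)" if z: "z \<in> carrier_vec k" for z
  proof (cases "z \<bullet> (N *\<^sub>v z) = 0")
    case True
    then show ?thesis using sym_psdD(3)[OF M z] by simp
  next
    case False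
    then have pos: "0 < z \<bullet> (N *\<^sub>v z)" using sym_psdD(3)[OF N z] by simp
    have "\<mu> \<le> z \<bullet> (M *\<^sub>v z) / (z \<bullet> (N *\<^sub>v z))"
      unfolding \<mu>_def
    proof (rule cSup_least)
      show "S \<noteq> {}" using S0 by blast
    qed (use pos z in \<open>auto simp: S_def field_simps\<close>)
    then show ?thesis using pos by (simp add: field_simps)
  qed
  have "\<exists>z \<in> carrier_vec k. z \<noteq> 0\<^sub>v k \<and> z \<bullet> (M *\<^sub>v z) = \<mu> * (z \<bullet> (N *\<^sub>v z))"
  proof (rule ccontr)
    assume none: "\<not> ?thesis"
    define B where "B = M - \<mu> \<cdot>\<^sub>m N"
    have B: "sym_psd k B" unfolding B_def using sym_psd_diff(1)[OF M N] psd by blast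
    have form: "z \<bullet> (B *\<^sub>v z) = z \<bullet> (M *\<^sub>v z) - \<mu> * (z \<bullet> (N *\<^sub>v z))" if "z \<in> carrier_vec k" for z
      unfolding B_def using sym_psd_diff(2)[OF M N] psd that by blast
    have "\<exists>c>0. \<forall>z \<in> carrier_vec k. c * (z \<bullet> z) \<le> z \<bullet> (B *\<^sub>v z)"
      by (rule psd_injective_coercive[OF B]) (use none form in fastforce)
    then obtain c where c: "c > 0" "\<And>z. z \<in> carrier_vec k \<Longrightarrow> c * (z \<bullet> z) \<le> z \<bullet> (B *\<^sub>v z)" by blast
    let ?d = "c / (fnorm N + 1)"
    have d: "?d > 0" using c fnorm_ge_0[of N] by simp
    have "\<mu> + ?d \<in> S" unfolding S_def
    proof (intro CollectI ballI)
      fix z :: "real vec" assume z: "z \<in> carrier_vec k"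
      have "?d * (z \<bullet> (N *\<^sub>v z)) \<le> ?d * ((fnorm N + 1) * (z \<bullet> z))"
        using quadratic_form_le[OF sym_psdD(1)[OF N] z] d scalar_self_ge_0[of z]
        by (intro mult_left_mono) (auto simp: algebra_simps)
      also have "\<dots> = c * (z \<bullet> z)" using fnorm_ge_0[of N] by simp
      also have "\<dots> \<le> z \<bullet> (M *\<^sub>v z) - \<mu> * (z \<bullet> (N *\<^sub>v z))" using c(2)[OF z] form[OF z] by simp
      finally show "(\<mu> + ?d) * (z \<bullet> (N *\<^sub>v z)) \<le> z \<bullet> (M *\<^sub>v z)" by (simp add: algebra_simps)
    qed
    from upper[OF this] d show False by (simp add: \<mu>_def)
  qed
  with \<mu>0 psd show ?thesis by blast
qed

section \<open>Last generalized eigenvalues and last singular values\<close>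

lemma map_poly_complex_of_real_mult:
  "map_poly complex_of_real (p * q) = map_poly complex_of_real p * map_poly complex_of_real q"
proof -
  interpret map_poly_comm_ring_hom complex_of_real ..
  show ?thesis by (rule hom_mult)
qed

text \<open>
  A polynomial whose complex roots are all real splits over the reals, so its sorted list of real roots
  has the length that the indexing of singular values and eigenvalues presupposes.
\<close>

lemma size_proots_real_rooted:
  fixes p :: "real poly"
  assumes "p \<noteq> 0" and "\<And>z. poly (map_poly complex_of_real p) z = 0 \<Longrightarrow> Im z = 0"
  shows "size (proots p) = degree p"
  using assms
proof (induction "degree p" arbitrary: p)
  case 0
  then show ?case using size_proots_le[of p] by simp
next
  case (Suc d)
  have "degree (map_poly complex_of_real p) \<noteq> 0" using Suc.hyps(2) by simp
  then have "\<not> constant (poly (map_poly complex_of_real p))" by (simp add: constant_degree)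
  then obtain z where z: "poly (map_poly complex_of_real p) z = 0"
    using fundamental_theorem_of_algebra by blast
  then have "z = complex_of_real (Re z)" using Suc.prems(2) by (simp add: complex_eq_iff)
  with z have "complex_of_real (poly p (Re z)) = 0" by (metis of_real_hom.poly_map_poly)
  then have "poly p (Re z) = 0" by simp
  then obtain q where pq: "p = [:- Re z, 1:] * q" by (meson dvdE poly_eq_0_iff_dvd)
  with Suc.prems(1) have q0: "q \<noteq> 0" by auto
  have "degree p = Suc (degree q)" unfolding pq using q0 by (subst degree_mult_eq) auto
  moreover have "Im w = 0" if "poly (map_poly complex_of_real q) w = 0" for w
    using that by (intro Suc.prems(2)) (simp add: pq map_poly_complex_of_real_mult del: mult_pCons_left)
  ultimately have "size (proots q) = degree q" using Suc.hyps q0 by simp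
  then show ?case using \<open>degree p = Suc (degree q)\<close> q0 by (simp add: pq proots_mult del: mult_pCons_left)
qed

lemma pencil_poly_complex_eval:
  assumes "M \<in> carrier_mat k k" "N \<in> carrier_mat k k"
  shows "poly (map_poly complex_of_real (pencil_poly M N)) t =
    det (mat k k (\<lambda>(i, j). complex_of_real (M $$ (i, j)) - t * complex_of_real (N $$ (i, j))))"
proof -
  interpret h: comm_ring_hom "\<lambda>p. poly (map_poly complex_of_real p) t"
    by unfold_locales (auto simp: hom_distribs map_poly_complex_of_real_mult)
  show ?thesis unfolding pencil_poly_def
    by (subst h.hom_det[symmetric], rule arg_cong[of _ _ det], rule eq_matI) (use assms in \<open>auto simp: hom_distribs map_poly_complex_of_real_mult\<close>)
qed

lemma pencil_poly_eval:
  assumes M: "M \<in> carrier_mat k k" and N: "N \<in> carrier_mat k k"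
  shows "poly (pencil_poly M N) t = det (M - t \<cdot>\<^sub>m N)"
proof -
  note hom_det = comm_ring_hom.hom_det[OF poly_hom.comm_ring_hom_axioms]
  show ?thesis unfolding pencil_poly_def
    by (subst hom_det[symmetric], rule arg_cong[of _ _ det], rule eq_matI) (use assms in auto)
qed

lemma pencil_root_iff:
  assumes M: "M \<in> carrier_mat k k" and N: "N \<in> carrier_mat k k"
  shows "poly (pencil_poly M N) t = 0 \<longleftrightarrow> (\<exists>z \<in> carrier_vec k. z \<noteq> 0\<^sub>v k \<and> M *\<^sub>v z = t \<cdot>\<^sub>v (N *\<^sub>v z))"
proof -
  have B: "M - t \<cdot>\<^sub>m N \<in> carrier_mat k k" using N by (intro minus_carrier_mat smult_carrier_mat)
  have "(M - t \<cdot>\<^sub>m N) *\<^sub>v z = 0\<^sub>v k \<longleftrightarrow> M *\<^sub>v z = t \<cdot>\<^sub>v (N *\<^sub>v z)" if "z \<in> carrier_vec k" for z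
  proof -
    have "(M - t \<cdot>\<^sub>m N) *\<^sub>v z = M *\<^sub>v z - t \<cdot>\<^sub>v (N *\<^sub>v z)"
      using M N that by (simp add: vec_linear)
    then show ?thesis using M N that by (auto simp: vec_eq_iff)
  qed
  then show ?thesis
    unfolding pencil_poly_eval[OF M N] det_0_iff_vec_prod_zero_field[OF B] by blast
qed

text \<open>
  The last condition says that \<open>M + N\<close> is positive definite.  It makes \<open>det (M - t N)\<close> nonzero at
  \<open>t = -1\<close> while allowing both matrices to be singular, and so covers both the pair \<open>(S\<^sup>T S, I)\<close> of a
  singular value problem and a pair \<open>(M, N)\<close> with \<open>M\<close> positive definite.
\<close>

definition definite_pencil :: "nat \<Rightarrow> real mat \<Rightarrow> real mat \<Rightarrow> bool" where
  "definite_pencil k M N \<longleftrightarrow> sym_psd k M \<and> sym_psd k N \<and>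
     (\<forall>z \<in> carrier_vec k. z \<bullet> (M *\<^sub>v z) = 0 \<longrightarrow> z \<bullet> (N *\<^sub>v z) = 0 \<longrightarrow> z = 0\<^sub>v k)"

text \<open>
  Let \<open>u + i w\<close> be an eigenvector for \<open>t\<close>.  Pairing the real part of the eigenvalue equation with
  \<open>w\<close> and the imaginary part with \<open>u\<close> and subtracting leaves
  \<open>Im t * (w \<bullet> N w + u \<bullet> N u) = 0\<close>.  If \<open>Im t \<noteq> 0\<close>, both summands vanish, so \<open>u\<close> and \<open>w\<close> lie
  in the kernel of \<open>N\<close>, then also in that of \<open>M\<close>, and are zero.
\<close>

lemma definite_pencil_complex_root_real:
  assumes D: "definite_pencil k M N"
    and root: "poly (map_poly complex_of_real (pencil_poly M N)) t = 0"
  shows "Im t = 0"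
proof (rule ccontr)
  assume Im: "Im t \<noteq> 0"
  have M: "sym_psd k M" and N: "sym_psd k N" using D by (auto simp: definite_pencil_def)
  note [simp] = sym_psdD(4,5)[OF M] sym_psdD(4,5)[OF N]
  define B where "B = mat k k (\<lambda>(i, j). complex_of_real (M $$ (i, j)) - t * complex_of_real (N $$ (i, j)))"
  have "B \<in> carrier_mat k k" "det B = 0"
    using root pencil_poly_complex_eval[OF sym_psdD(1)[OF M] sym_psdD(1)[OF N]] by (auto simp: B_def)
  then obtain v where v: "v \<in> carrier_vec k" "v \<noteq> 0\<^sub>v k" "B *\<^sub>v v = 0\<^sub>v k"
    using det_0_iff_vec_prod_zero_field by blast
  define u w where "u = map_vec Re v" and "w = map_vec Im v"
  have u: "u \<in> carrier_vec k" and w: "w \<in> carrier_vec k" using v(1) by (auto simp: u_def w_def)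
  note [simp] = carrier_vecD[OF u] carrier_vecD[OF w] carrier_vecD[OF v(1)]
  have eq: "(\<Sum>j = 0..<k. (complex_of_real (M $$ (i, j)) - t * complex_of_real (N $$ (i, j))) * v $ j) = 0" if "i < k" for i
  proof -
    have "(B *\<^sub>v v) $ i = 0" using v(3) that by simp
    then show ?thesis using that by (simp add: B_def scalar_prod_def)
  qed
  have re: "M *\<^sub>v u - Re t \<cdot>\<^sub>v (N *\<^sub>v u) + Im t \<cdot>\<^sub>v (N *\<^sub>v w) = 0\<^sub>v k"
  proof (rule eq_vecI)
    fix i assume "i < dim_vec (0\<^sub>v k :: real vec)"
    then have i: "i < k" by simp
    have "0 = Re (\<Sum>j = 0..<k. (complex_of_real (M $$ (i, j)) - t * complex_of_real (N $$ (i, j))) * v $ j)"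
      using eq[OF i] by simp
    also have "\<dots> = (M *\<^sub>v u - Re t \<cdot>\<^sub>v (N *\<^sub>v u) + Im t \<cdot>\<^sub>v (N *\<^sub>v w)) $ i"
      using i by (simp add: scalar_prod_def u_def w_def algebra_simps sum.distrib sum_subtractf sum_distrib_left)
    finally show "(M *\<^sub>v u - Re t \<cdot>\<^sub>v (N *\<^sub>v u) + Im t \<cdot>\<^sub>v (N *\<^sub>v w)) $ i = 0\<^sub>v k $ i" using i by simp
  qed simp
  have im: "M *\<^sub>v w - Re t \<cdot>\<^sub>v (N *\<^sub>v w) - Im t \<cdot>\<^sub>v (N *\<^sub>v u) = 0\<^sub>v k"
  proof (rule eq_vecI)
    fix i assume "i < dim_vec (0\<^sub>v k :: real vec)"
    then have i: "i < k" by simp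
    have "0 = Im (\<Sum>j = 0..<k. (complex_of_real (M $$ (i, j)) - t * complex_of_real (N $$ (i, j))) * v $ j)"
      using eq[OF i] by simp
    also have "\<dots> = (M *\<^sub>v w - Re t \<cdot>\<^sub>v (N *\<^sub>v w) - Im t \<cdot>\<^sub>v (N *\<^sub>v u)) $ i"
      using i by (simp add: scalar_prod_def u_def w_def algebra_simps sum.distrib sum_subtractf sum_distrib_left)
    finally show "(M *\<^sub>v w - Re t \<cdot>\<^sub>v (N *\<^sub>v w) - Im t \<cdot>\<^sub>v (N *\<^sub>v u)) $ i = 0\<^sub>v k $ i" using i by simp
  qed simp
  have "w \<bullet> (M *\<^sub>v u - Re t \<cdot>\<^sub>v (N *\<^sub>v u) + Im t \<cdot>\<^sub>v (N *\<^sub>v w)) - u \<bullet> (M *\<^sub>v w - Re t \<cdot>\<^sub>v (N *\<^sub>v w) - Im t \<cdot>\<^sub>v (N *\<^sub>v u)) = 0"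
    unfolding re im using u w by simp
  then have "Im t * (w \<bullet> (N *\<^sub>v w) + u \<bullet> (N *\<^sub>v u)) = 0"
    using scalar_symmetric[OF sym_psdD(1,2)[OF M] u w] scalar_symmetric[OF sym_psdD(1,2)[OF N] u w]
    by (simp add: vec_linear algebra_simps)
  then have "w \<bullet> (N *\<^sub>v w) = 0" "u \<bullet> (N *\<^sub>v u) = 0"
    using Im sym_psdD(3)[OF N u] sym_psdD(3)[OF N w] by auto
  note N0 = this
  have "N *\<^sub>v w = 0\<^sub>v k" "N *\<^sub>v u = 0\<^sub>v k"
    using psd_kernel[OF N w N0(1)] psd_kernel[OF N u N0(2)] .
  with re im have "M *\<^sub>v u = 0\<^sub>v k" "M *\<^sub>v w = 0\<^sub>v k" by (auto simp: vec_eq_iff)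
  then have "u \<bullet> (M *\<^sub>v u) = 0" "w \<bullet> (M *\<^sub>v w) = 0" using u w by auto
  then have "u = 0\<^sub>v k" "w = 0\<^sub>v k"
    using N0 D u w unfolding definite_pencil_def by auto
  then have "v = 0\<^sub>v k" by (auto simp: vec_eq_iff u_def w_def complex_eq_iff)
  with v(2) show False by simp
qed

lemma definite_pencil_poly:
  assumes D: "definite_pencil k M N"
  shows "pencil_poly M N \<noteq> 0" "size (proots (pencil_poly M N)) = degree (pencil_poly M N)"
    "degree (pencil_poly M N) \<le> k"
proof -
  have M: "sym_psd k M" and N: "sym_psd k N" using D by (auto simp: definite_pencil_def)
  note [simp] = sym_psdD(4,5)[OF M] sym_psdD(4,5)[OF N]
  have "poly (pencil_poly M N) (-1) \<noteq> 0"
  proof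
    assume "poly (pencil_poly M N) (-1) = 0"
    then obtain z where z: "z \<in> carrier_vec k" "z \<noteq> 0\<^sub>v k" "M *\<^sub>v z = -1 \<cdot>\<^sub>v (N *\<^sub>v z)"
      using pencil_root_iff[OF sym_psdD(1)[OF M] sym_psdD(1)[OF N]] by blast
    then have "z \<bullet> (M *\<^sub>v z) = - (z \<bullet> (N *\<^sub>v z))" by simp
    with sym_psdD(3)[OF M z(1)] sym_psdD(3)[OF N z(1)] D z(1,2) show False
      unfolding definite_pencil_def by auto
  qed
  then show ne: "pencil_poly M N \<noteq> 0" by auto
  show "size (proots (pencil_poly M N)) = degree (pencil_poly M N)"
    using size_proots_real_rooted[OF ne] definite_pencil_complex_root_real[OF D] by blast
  have "degree (pencil_poly M N) \<le> 1 * k" unfolding pencil_poly_def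
    by (rule degree_det_le) (auto intro!: degree_diff_le simp: degree_pCons_le)
  then show "degree (pencil_poly M N) \<le> k" by simp
qed

text \<open>
  The index \<open>k\<close> addresses the last entry of a list of length \<open>k\<close>: the infinite eigenvalues make up
  exactly for the degree deficiency.  That entry is the smallest root of \<open>det (M - t N)\<close>, and it
  is infinite only if there is no root at all, which means that the form of \<open>N\<close> vanishes.
\<close>

lemma gen_eigval_last:
  assumes D: "definite_pencil k M N" and k: "0 < k"
  shows "(\<exists>x. gen_eigval k M N = ereal x \<and>
      (\<forall>z \<in> carrier_vec k. x * (z \<bullet> (N *\<^sub>v z)) \<le> z \<bullet> (M *\<^sub>v z)) \<and>
      (\<exists>z \<in> carrier_vec k. z \<noteq> 0\<^sub>v k \<and> z \<bullet> (M *\<^sub>v z) = x * (z \<bullet> (N *\<^sub>v z)))) \<or>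
    (gen_eigval k M N = \<infinity> \<and> (\<forall>z \<in> carrier_vec k. z \<bullet> (N *\<^sub>v z) = 0))"
proof -
  have M: "sym_psd k M" and N: "sym_psd k N" using D by (auto simp: definite_pencil_def)
  note [simp] = sym_psdD(4,5)[OF M] sym_psdD(4,5)[OF N]
  define p where "p = pencil_poly M N"
  define L where "L = sorted_list_of_multiset (proots p)"
  have p: "p \<noteq> 0" "size (proots p) = degree p" "degree p \<le> k"
    using definite_pencil_poly[OF D] by (simp_all add: p_def)
  have len: "length L = degree p" using p(2) by (simp add: L_def flip: size_mset)
  have L: "sorted L" "set L = {t. poly p t = 0}" using p(1) by (simp_all add: L_def)
  have list: "gen_eigenvalues M N = replicate (k - degree p) \<infinity> @ map ereal (rev L)"
    by (simp add: gen_eigenvalues_def p_def L_def)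
  have smallest: "\<exists>\<mu>. poly p \<mu> = 0 \<and> (\<forall>z \<in> carrier_vec k. \<mu> * (z \<bullet> (N *\<^sub>v z)) \<le> z \<bullet> (M *\<^sub>v z))"
    if w: "w \<in> carrier_vec k" "w \<bullet> (N *\<^sub>v w) \<noteq> 0" for w
  proof -
    have "0 < w \<bullet> (N *\<^sub>v w)" using w sym_psdD(3)[OF N w(1)] by simp
    from smallest_generalized_eigenvalue[OF M N w(1) this] obtain \<mu> z where
      \<mu>: "\<forall>z \<in> carrier_vec k. \<mu> * (z \<bullet> (N *\<^sub>v z)) \<le> z \<bullet> (M *\<^sub>v z)"
      and z: "z \<in> carrier_vec k" "z \<noteq> 0\<^sub>v k" "z \<bullet> (M *\<^sub>v z) = \<mu> * (z \<bullet> (N *\<^sub>v z))" by blast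
    have "M *\<^sub>v z = \<mu> \<cdot>\<^sub>v (N *\<^sub>v z)" by (rule form_minimizer_eigenvector[OF M N \<mu> z(1,3)])
    then have "poly p \<mu> = 0"
      unfolding p_def using pencil_root_iff[OF sym_psdD(1)[OF M] sym_psdD(1)[OF N]] z by blast
    with \<mu> show ?thesis by blast
  qed
  show ?thesis
  proof (cases "degree p = 0")
    case True
    then have "set L = {}" using len by simp
    then have "\<forall>w \<in> carrier_vec k. w \<bullet> (N *\<^sub>v w) = 0" using smallest L(2) by fastforce
    moreover have "gen_eigval k M N = \<infinity>" using True len k by (simp add: gen_eigval_def list nth_append)
    ultimately show ?thesis by blast
  next
    case False
    then have "L \<noteq> []" using len by auto
    then have in_L: "L ! 0 \<in> set L" by simp
    then have "poly p (L ! 0) = 0" using L(2) by simp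
    then obtain z where z: "z \<in> carrier_vec k" "z \<noteq> 0\<^sub>v k" "M *\<^sub>v z = L ! 0 \<cdot>\<^sub>v (N *\<^sub>v z)"
      using pencil_root_iff[OF sym_psdD(1)[OF M] sym_psdD(1)[OF N]] unfolding p_def by blast
    have eq: "z \<bullet> (M *\<^sub>v z) = L ! 0 * (z \<bullet> (N *\<^sub>v z))" using z(1) by (simp add: z(3))
    then have "z \<bullet> (N *\<^sub>v z) \<noteq> 0" using D z(1,2) unfolding definite_pencil_def by auto
    with smallest z(1) obtain \<mu> where \<mu>: "poly p \<mu> = 0"
      "\<And>z. z \<in> carrier_vec k \<Longrightarrow> \<mu> * (z \<bullet> (N *\<^sub>v z)) \<le> z \<bullet> (M *\<^sub>v z)" by blast
    have "\<mu> \<in> set L" using \<mu>(1) L(2) by simp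
    then have le: "L ! 0 \<le> \<mu>" using L(1) by (metis in_set_conv_nth le0 sorted_nth_mono)
    have "L ! 0 * (y \<bullet> (N *\<^sub>v y)) \<le> y \<bullet> (M *\<^sub>v y)" if "y \<in> carrier_vec k" for y
      using \<mu>(2)[OF that] mult_right_mono[OF le sym_psdD(3)[OF N that]] by simp
    moreover have "gen_eigval k M N = ereal (L ! 0)"
    proof -
      have "\<not> k - 1 < k - degree p" using False p(3) k by linarith
      moreover have "k - 1 - (k - degree p) = degree p - 1" using False p(3) k by linarith
      ultimately show ?thesis using False len by (simp add: gen_eigval_def list nth_append rev_nth)
    qed
    ultimately show ?thesis using eq z by blast
  qed
qed

lemma gram_psd:
  assumes S: "S \<in> carrier_mat r k"
  shows "sym_psd k (transpose_mat S * S)"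
    and "z \<in> carrier_vec k \<Longrightarrow> z \<bullet> ((transpose_mat S * S) *\<^sub>v z) = (S *\<^sub>v z) \<bullet> (S *\<^sub>v z)"
proof -
  note [simp] = carrier_matD[OF S]
  show form: "z \<bullet> ((transpose_mat S * S) *\<^sub>v z) = (S *\<^sub>v z) \<bullet> (S *\<^sub>v z)" if "z \<in> carrier_vec k" for z
    using that by (simp add: vec_linear)
  show "sym_psd k (transpose_mat S * S)"
    using S form by (auto simp: sym_psd_def scalar_self_ge_0 transpose_mult[of _ k r _ k])
qed

lemma pencil_poly_one:
  assumes M: "M \<in> carrier_mat k k"
  shows "pencil_poly M (1\<^sub>m k) = (-1) ^ k * char_poly M"
proof -
  have "map_mat (\<lambda>a. [:a:]) M - [:0, 1:] \<cdot>\<^sub>m map_mat (\<lambda>a. [:a:]) (1\<^sub>m k) = (-1) \<cdot>\<^sub>m char_poly_matrix M"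
    using M by (intro eq_matI) (auto simp: char_poly_matrix_def one_pCons)
  then show ?thesis using M by (simp add: pencil_poly_def char_poly_def char_poly_matrix_def)
qed

text \<open>
  Singular values are the square roots of the generalized eigenvalues of \<open>(S\<^sup>T S, I)\<close>, whose
  determinant polynomial is the characteristic polynomial up to sign.
\<close>

lemma sing_val_last:
  assumes S: "S \<in> carrier_mat r k" and k: "0 < k"
  shows "0 \<le> sing_val k S"
    and "z \<in> carrier_vec k \<Longrightarrow> (sing_val k S)\<^sup>2 * (z \<bullet> z) \<le> (S *\<^sub>v z) \<bullet> (S *\<^sub>v z)"
    and "\<exists>z \<in> carrier_vec k. z \<noteq> 0\<^sub>v k \<and> (S *\<^sub>v z) \<bullet> (S *\<^sub>v z) = (sing_val k S)\<^sup>2 * (z \<bullet> z)"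
proof -
  note G = gram_psd[OF S]
  have Mc: "transpose_mat S * S \<in> carrier_mat k k" using sym_psdD(1)[OF G(1)] .
  have D: "definite_pencil k (transpose_mat S * S) (1\<^sub>m k)"
    using G(1) sym_psd_one scalar_self_eq_0 unfolding definite_pencil_def by auto
  define L where "L = rev (sorted_list_of_multiset (proots (char_poly (transpose_mat S * S))))"
  have "proots ((-1) ^ k * char_poly (transpose_mat S * S)) = proots (char_poly (transpose_mat S * S))"
    "degree ((-1) ^ k * char_poly (transpose_mat S * S)) = degree (char_poly (transpose_mat S * S))"
    by (cases "even k"; simp)+
  then have pr: "proots (pencil_poly (transpose_mat S * S) (1\<^sub>m k)) = proots (char_poly (transpose_mat S * S))"
    and deg: "degree (pencil_poly (transpose_mat S * S) (1\<^sub>m k)) = k"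
    using pencil_poly_one[OF Mc] degree_monic_char_poly[OF Mc] by simp_all
  have "size (proots (char_poly (transpose_mat S * S))) = k"
    using definite_pencil_poly(2)[OF D] pr deg by simp
  then have len: "length L = k" by (simp add: L_def flip: size_mset)
  have "gen_eigval k (transpose_mat S * S) (1\<^sub>m k) = ereal (L ! (k - 1))"
    using len k carrier_matD[OF S] deg by (simp add: gen_eigval_def gen_eigenvalues_def pr flip: L_def)
  with gen_eigval_last[OF D k] obtain z where
    psd: "\<And>z. z \<in> carrier_vec k \<Longrightarrow> L ! (k - 1) * (z \<bullet> z) \<le> (S *\<^sub>v z) \<bullet> (S *\<^sub>v z)"
    and z: "z \<in> carrier_vec k" "z \<noteq> 0\<^sub>v k" "(S *\<^sub>v z) \<bullet> (S *\<^sub>v z) = L ! (k - 1) * (z \<bullet> z)"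
    by (auto simp: G(2))
  have "0 < z \<bullet> z" using z(1,2) scalar_self_eq_0[of z] scalar_self_ge_0[of z] by auto
  then have ge0: "0 \<le> L ! (k - 1)"
    using z(3) scalar_self_ge_0[of "S *\<^sub>v z"] by (simp add: zero_le_mult_iff)
  have sv: "sing_val k S = sqrt (L ! (k - 1))"
    using len k by (simp add: sing_val_def singular_values_def flip: L_def)
  show "0 \<le> sing_val k S" using ge0 sv by simp
  show "z \<in> carrier_vec k \<Longrightarrow> (sing_val k S)\<^sup>2 * (z \<bullet> z) \<le> (S *\<^sub>v z) \<bullet> (S *\<^sub>v z)" for z
    using psd ge0 sv by simp
  show "\<exists>z \<in> carrier_vec k. z \<noteq> 0\<^sub>v k \<and> (S *\<^sub>v z) \<bullet> (S *\<^sub>v z) = (sing_val k S)\<^sup>2 * (z \<bullet> z)"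
    using z ge0 sv by auto
qed

section \<open>Eigenpairs of weighted total least squares problems\<close>

text \<open>
  The two equations are the block rows of
  \<open>[A, b]\<^sup>T [A, b] [x, -1] = \<mu> diag(W, 1) [x, -1]\<close>, the second one combined with the first so that it
  expresses \<open>\<mu>\<close> as the quotient \<open>|A x - b|\<^sup>2 / (1 + x \<bullet> W x)\<close>.
\<close>

definition tls_eigenpair :: "real mat \<Rightarrow> real mat \<Rightarrow> real vec \<Rightarrow> real \<Rightarrow> real vec \<Rightarrow> bool" where
  "tls_eigenpair W A b \<mu> x \<longleftrightarrow> x \<in> carrier_vec (dim_col A) \<and>
     transpose_mat A *\<^sub>v (A *\<^sub>v x - b) = \<mu> \<cdot>\<^sub>v (W *\<^sub>v x) \<and>
     (A *\<^sub>v x - b) \<bullet> (A *\<^sub>v x - b) = \<mu> * (1 + x \<bullet> (W *\<^sub>v x))"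

text \<open>
  The quadratic form of \<open>A\<^sup>T A - \<mu> W\<close>.
\<close>

definition tls_form :: "real mat \<Rightarrow> real mat \<Rightarrow> real \<Rightarrow> real vec \<Rightarrow> real" where
  "tls_form W A \<mu> y = (A *\<^sub>v y) \<bullet> (A *\<^sub>v y) - \<mu> * (y \<bullet> (W *\<^sub>v y))"

lemma residual_shift:
  assumes A: "A \<in> carrier_mat m n" and b: "b \<in> carrier_vec m" and W: "sym_psd n W"
    and x: "x \<in> carrier_vec n" and d: "d \<in> carrier_vec n"
  shows "(A *\<^sub>v (x + d) - b) \<bullet> (A *\<^sub>v (x + d) - b) - \<mu> * (1 + (x + d) \<bullet> (W *\<^sub>v (x + d))) =
    (A *\<^sub>v x - b) \<bullet> (A *\<^sub>v x - b) - \<mu> * (1 + x \<bullet> (W *\<^sub>v x)) +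
    2 * (d \<bullet> (transpose_mat A *\<^sub>v (A *\<^sub>v x - b) - \<mu> \<cdot>\<^sub>v (W *\<^sub>v x))) + tls_form W A \<mu> d"
proof -
  note [simp] = carrier_matD[OF A] carrier_vecD[OF b] carrier_vecD[OF x] carrier_vecD[OF d] sym_psdD(4,5)[OF W]
  have "x \<bullet> (W *\<^sub>v d) = d \<bullet> (W *\<^sub>v x)" by (rule scalar_symmetric[OF sym_psdD(1,2)[OF W] x d])
  then show ?thesis
    by (simp add: vec_linear tls_form_def scalar_commute[of b "A *\<^sub>v x"] scalar_commute[of b "A *\<^sub>v d"] scalar_commute[of "A *\<^sub>v x" "A *\<^sub>v d"])
      (simp add: ring_distribs)
qed

lemma tls_completing_square:
  assumes A: "A \<in> carrier_mat m n" and b: "b \<in> carrier_vec m" and W: "sym_psd n W"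
    and e: "tls_eigenpair W A b \<mu> x" and y: "y \<in> carrier_vec n"
  shows "(A *\<^sub>v y - b) \<bullet> (A *\<^sub>v y - b) - \<mu> * (1 + y \<bullet> (W *\<^sub>v y)) = tls_form W A \<mu> (y - x)"
proof -
  have x: "x \<in> carrier_vec n" using e A by (simp add: tls_eigenpair_def)
  have "y = x + (y - x)" using x y by auto
  moreover have "\<mu> \<cdot>\<^sub>v (W *\<^sub>v x) - \<mu> \<cdot>\<^sub>v (W *\<^sub>v x) = 0\<^sub>v n" using sym_psdD(4)[OF W] x by auto
  ultimately show ?thesis
    using residual_shift[OF A b W x, of "y - x" \<mu>] x y e
    by (simp add: tls_eigenpair_def)
qed

text \<open>
  \<open>\<mu>\<close> is the smallest generalized eigenvalue of \<open>([A, b]\<^sup>T [A, b], diag(W, 1))\<close>, stated on split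
  vectors \<open>[y, \<tau>]\<close>.  Homogeneous vectors are needed here, because the minimizer may have \<open>\<tau> = 0\<close>.
\<close>

definition tls_smallest :: "real mat \<Rightarrow> real mat \<Rightarrow> real vec \<Rightarrow> real \<Rightarrow> bool" where
  "tls_smallest W A b \<mu> \<longleftrightarrow>
     (\<forall>y \<in> carrier_vec (dim_col A). \<forall>\<tau>. \<mu> * (y \<bullet> (W *\<^sub>v y) + \<tau>\<^sup>2) \<le> (A *\<^sub>v y + \<tau> \<cdot>\<^sub>v b) \<bullet> (A *\<^sub>v y + \<tau> \<cdot>\<^sub>v b)) \<and>
     (\<exists>y \<in> carrier_vec (dim_col A). \<exists>\<tau>. (y \<noteq> 0\<^sub>v (dim_col A) \<or> \<tau> \<noteq> 0) \<and>
       (A *\<^sub>v y + \<tau> \<cdot>\<^sub>v b) \<bullet> (A *\<^sub>v y + \<tau> \<cdot>\<^sub>v b) = \<mu> * (y \<bullet> (W *\<^sub>v y) + \<tau>\<^sup>2))"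

text \<open>
  If the minimizer \<open>[y, \<tau>]\<close> had \<open>\<tau> = 0\<close>, the form would vanish at \<open>y\<close>; so it can be scaled to
  \<open>[x, -1]\<close>.  Then \<open>|A y - b|\<^sup>2 - \<mu> (1 + y \<bullet> W y)\<close> is nonnegative and vanishes at \<open>x\<close>, so
  its gradient there, which is \<open>2 g\<close>, must be zero.
\<close>

lemma tls_eigenpair_exists:
  assumes A: "A \<in> carrier_mat m n" and b: "b \<in> carrier_vec m" and W: "sym_psd n W"
    and small: "tls_smallest W A b \<mu>"
    and pd: "\<And>y. y \<in> carrier_vec n \<Longrightarrow> y \<noteq> 0\<^sub>v n \<Longrightarrow> 0 < tls_form W A \<mu> y"
  shows "\<exists>x. tls_eigenpair W A b \<mu> x"
proof -
  note [simp] = carrier_matD[OF A] carrier_vecD[OF b] sym_psdD(4,5)[OF W]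
  have low: "\<mu> * (y \<bullet> (W *\<^sub>v y) + \<tau>\<^sup>2) \<le> (A *\<^sub>v y + \<tau> \<cdot>\<^sub>v b) \<bullet> (A *\<^sub>v y + \<tau> \<cdot>\<^sub>v b)"
    if "y \<in> carrier_vec n" for y \<tau>
    using small that by (simp add: tls_smallest_def)
  obtain y \<tau> where y: "y \<in> carrier_vec n" and nz: "y \<noteq> 0\<^sub>v n \<or> \<tau> \<noteq> 0"
    and eq: "(A *\<^sub>v y + \<tau> \<cdot>\<^sub>v b) \<bullet> (A *\<^sub>v y + \<tau> \<cdot>\<^sub>v b) = \<mu> * (y \<bullet> (W *\<^sub>v y) + \<tau>\<^sup>2)"
    using small by (auto simp: tls_smallest_def)
  note [simp] = carrier_vecD[OF y]
  have \<tau>: "\<tau> \<noteq> 0"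
  proof
    assume "\<tau> = 0"
    moreover have "A *\<^sub>v y + 0 \<cdot>\<^sub>v b = A *\<^sub>v y" by auto
    ultimately show False using nz eq pd[OF y] by (simp add: tls_form_def)
  qed
  define x where "x = (- 1 / \<tau>) \<cdot>\<^sub>v y"
  have x: "x \<in> carrier_vec n" using y by (simp add: x_def)
  note [simp] = carrier_vecD[OF x]
  have "A *\<^sub>v x - b = (- 1 / \<tau>) \<cdot>\<^sub>v (A *\<^sub>v y + \<tau> \<cdot>\<^sub>v b)"
  proof -
    have "A *\<^sub>v x = (- 1 / \<tau>) \<cdot>\<^sub>v (A *\<^sub>v y)" unfolding x_def by (rule mult_vec_smult) simp
    then show ?thesis using \<tau> by (auto simp: vec_eq_iff field_simps simp del: index_mult_mat_vec)
  qed
  then have "(A *\<^sub>v x - b) \<bullet> (A *\<^sub>v x - b) = (1 / \<tau>)\<^sup>2 * (\<mu> * (y \<bullet> (W *\<^sub>v y) + \<tau>\<^sup>2))"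
    using eq by (simp add: power2_eq_square)
  also have "\<dots> = \<mu> * (1 + x \<bullet> (W *\<^sub>v x))"
    using \<tau> unfolding x_def by (simp add: vec_linear field_simps power2_eq_square)
  finally have val: "(A *\<^sub>v x - b) \<bullet> (A *\<^sub>v x - b) = \<mu> * (1 + x \<bullet> (W *\<^sub>v x))" .
  define g where "g = transpose_mat A *\<^sub>v (A *\<^sub>v x - b) - \<mu> \<cdot>\<^sub>v (W *\<^sub>v x)"
  have g: "g \<in> carrier_vec n" by (auto simp: g_def intro: carrier_vecI)
  note [simp] = carrier_vecD[OF g]
  \<comment> \<open>The function has value 0, slope 2 (g \<bullet> g) and curvature the form along g, and it is nonnegative.\<close>
  have "(g \<bullet> g)\<^sup>2 \<le> 0 * tls_form W A \<mu> g"
  proof (rule real_quadratic_nonneg_discriminant)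
    fix t
    have tg: "t \<cdot>\<^sub>v g \<in> carrier_vec n" using g by simp
    have "0 \<le> (A *\<^sub>v (x + t \<cdot>\<^sub>v g) - b) \<bullet> (A *\<^sub>v (x + t \<cdot>\<^sub>v g) - b) -
        \<mu> * (1 + (x + t \<cdot>\<^sub>v g) \<bullet> (W *\<^sub>v (x + t \<cdot>\<^sub>v g)))"
    proof -
      have "A *\<^sub>v (x + t \<cdot>\<^sub>v g) + (- 1) \<cdot>\<^sub>v b = A *\<^sub>v (x + t \<cdot>\<^sub>v g) - b" by auto
      then show ?thesis using low[of "x + t \<cdot>\<^sub>v g" "-1"] x tg by (simp add: add.commute)
    qed
    also have "\<dots> = 2 * ((t \<cdot>\<^sub>v g) \<bullet> g) + tls_form W A \<mu> (t \<cdot>\<^sub>v g)"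
      unfolding residual_shift[OF A b W x tg] val g_def[symmetric] by simp
    also have "\<dots> = 0 + 2 * t * (g \<bullet> g) + t\<^sup>2 * tls_form W A \<mu> g"
      by (simp add: tls_form_def vec_linear ring_distribs power2_eq_square)
    finally show "0 \<le> \<dots>" .
  next
    show "0 \<le> tls_form W A \<mu> g"
    proof -
      have "A *\<^sub>v g + 0 \<cdot>\<^sub>v b = A *\<^sub>v g" by auto
      then show ?thesis using low[OF g, of 0] by (simp add: tls_form_def)
    qed
  qed
  then have "g \<bullet> g = 0" by simp
  then have "g = 0\<^sub>v n" using scalar_self_eq_0[of g] by simp
  then have "transpose_mat A *\<^sub>v (A *\<^sub>v x - b) = \<mu> \<cdot>\<^sub>v (W *\<^sub>v x)"
    unfolding g_def by (auto simp: vec_eq_iff)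
  with x val show ?thesis by (auto simp: tls_eigenpair_def)
qed

lemma append_cols_mult_vec:
  assumes "X \<in> carrier_mat r k" "Y \<in> carrier_mat r l" "u \<in> carrier_vec k" "v \<in> carrier_vec l"
  shows "(X @\<^sub>c Y) *\<^sub>v (u @\<^sub>v v) = X *\<^sub>v u + (Y *\<^sub>v v :: real vec)"
  unfolding append_cols_def
  by (subst four_block_mat_mult_vec[of _ r k _ l _ 0]) (use assms in auto)

lemma mat_of_col_carrier: "v \<in> carrier_vec r \<Longrightarrow> mat_of_col v \<in> carrier_mat r 1"
  unfolding mat_of_col_def by (metis One_nat_def carrier_vecD length_Cons list.size(3) mat_of_cols_carrier(1))

lemma diag_block_mat_pair:
  assumes "Y \<in> carrier_mat k k"
  shows "diag_block_mat [X, Y] =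
    four_block_mat X (0\<^sub>m (dim_row X) k) (0\<^sub>m k (dim_col X)) (Y :: real mat)"
proof -
  have "four_block_mat Y (0\<^sub>m k 0) (0\<^sub>m 0 k) (0\<^sub>m 0 0) = Y" using assms by (intro eq_matI) auto
  then show ?thesis using assms by (simp add: Let_def)
qed

lemma mat_of_col_mult_vec:
  assumes "v \<in> carrier_vec 1"
  shows "mat_of_col b *\<^sub>v v = v $ 0 \<cdot>\<^sub>v (b :: real vec)"
  using assms by (intro eq_vecI) (auto simp: mat_of_col_def mat_of_cols_def scalar_prod_def)

lemma augmented_forms:
  assumes A: "A \<in> carrier_mat m n" and b: "b \<in> carrier_vec m" and W: "sym_psd n W"
    and W': "W' = diag_block_mat [W, 1\<^sub>m 1]"
    and y: "y \<in> carrier_vec n"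
  shows "(A @\<^sub>c mat_of_col b) *\<^sub>v (y @\<^sub>v vec 1 (\<lambda>_. \<tau>)) = A *\<^sub>v y + \<tau> \<cdot>\<^sub>v b"
    and "(y @\<^sub>v vec 1 (\<lambda>_. \<tau>)) \<bullet> (W' *\<^sub>v (y @\<^sub>v vec 1 (\<lambda>_. \<tau>))) = y \<bullet> (W *\<^sub>v y) + \<tau>\<^sup>2"
proof -
  note [simp] = carrier_matD[OF A] carrier_vecD[OF b] carrier_vecD[OF y] sym_psdD(4,5)[OF W]
  have B: "mat_of_col b \<in> carrier_mat m 1" by (rule mat_of_col_carrier[OF b])
  show "(A @\<^sub>c mat_of_col b) *\<^sub>v (y @\<^sub>v vec 1 (\<lambda>_. \<tau>)) = A *\<^sub>v y + \<tau> \<cdot>\<^sub>v b"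
    by (simp add: append_cols_mult_vec[OF A B y] mat_of_col_mult_vec)
  have W'b: "W' = four_block_mat W (0\<^sub>m n 1) (0\<^sub>m 1 n) (1\<^sub>m 1)"
    unfolding W' diag_block_mat_pair[OF one_carrier_mat] sym_psdD(4,5)[OF W] ..
  have "W' *\<^sub>v (y @\<^sub>v vec 1 (\<lambda>_. \<tau>)) = (W *\<^sub>v y + 0\<^sub>m n 1 *\<^sub>v vec 1 (\<lambda>_. \<tau>)) @\<^sub>v (0\<^sub>m 1 n *\<^sub>v y + 1\<^sub>m 1 *\<^sub>v vec 1 (\<lambda>_. \<tau>))"
    unfolding W'b by (rule four_block_mat_mult_vec[of _ n n _ 1 _ 1]) (use y sym_psdD(1)[OF W] in auto)
  also have "W *\<^sub>v y + 0\<^sub>m n 1 *\<^sub>v vec 1 (\<lambda>_. \<tau>) = W *\<^sub>v y" by (auto simp: vec_eq_iff scalar_prod_def)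
  also have "0\<^sub>m 1 n *\<^sub>v y + 1\<^sub>m 1 *\<^sub>v vec 1 (\<lambda>_. \<tau>) = vec 1 (\<lambda>_. \<tau>)" by (auto simp: vec_eq_iff scalar_prod_def)
  finally show "(y @\<^sub>v vec 1 (\<lambda>_. \<tau>)) \<bullet> (W' *\<^sub>v (y @\<^sub>v vec 1 (\<lambda>_. \<tau>))) = y \<bullet> (W *\<^sub>v y) + \<tau>\<^sup>2"
    using scalar_prod_append[of y n "vec 1 (\<lambda>_. \<tau>)" 1 "W *\<^sub>v y" "vec 1 (\<lambda>_. \<tau>)"] y sym_psdD(1)[OF W]
    by (simp add: scalar_prod_def power2_eq_square)
qed

lemma vec_Suc_split:
  assumes "z \<in> carrier_vec (n + 1)"
  obtains y \<tau> where "y \<in> carrier_vec n" "z = y @\<^sub>v vec 1 (\<lambda>_. \<tau> :: real)"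
proof
  show "vec_first z n \<in> carrier_vec n" by simp
  have "vec_last z 1 = vec 1 (\<lambda>_. z $ n)" using assms by (auto simp: vec_last_def vec_eq_iff)
  then show "z = vec_first z n @\<^sub>v vec 1 (\<lambda>_. z $ n)" using vec_first_last_append[OF assms] by simp
qed

lemma tls_smallest_augmented:
  assumes A: "A \<in> carrier_mat m n" and b: "b \<in> carrier_vec m" and W: "sym_psd n W"
    and W': "W' = diag_block_mat [W, 1\<^sub>m 1]" and A': "A' = A @\<^sub>c mat_of_col b"
  shows "tls_smallest W A b \<mu> \<longleftrightarrow>
    (\<forall>z \<in> carrier_vec (n + 1). \<mu> * (z \<bullet> (W' *\<^sub>v z)) \<le> (A' *\<^sub>v z) \<bullet> (A' *\<^sub>v z)) \<and>
    (\<exists>z \<in> carrier_vec (n + 1). z \<noteq> 0\<^sub>v (n + 1) \<and> (A' *\<^sub>v z) \<bullet> (A' *\<^sub>v z) = \<mu> * (z \<bullet> (W' *\<^sub>v z)))"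
proof -
  note [simp] = carrier_matD[OF A]
  note forms = augmented_forms[OF A b W W']
  have nz: "y @\<^sub>v vec 1 (\<lambda>_. \<tau>) = 0\<^sub>v (n + 1) \<longleftrightarrow> y = 0\<^sub>v n \<and> \<tau> = 0" if "y \<in> carrier_vec n" for y \<tau>
  proof -
    have "0\<^sub>v (n + 1) = 0\<^sub>v n @\<^sub>v (0\<^sub>v 1 :: real vec)" by (auto simp: vec_eq_iff)
    then show ?thesis using append_vec_eq[of y n "0\<^sub>v n" "vec 1 (\<lambda>_. \<tau>)" "0\<^sub>v 1"] that by (auto simp: vec_eq_iff)
  qed
  have "(\<forall>z \<in> carrier_vec (n + 1). \<mu> * (z \<bullet> (W' *\<^sub>v z)) \<le> (A' *\<^sub>v z) \<bullet> (A' *\<^sub>v z)) \<longleftrightarrow>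
    (\<forall>y \<in> carrier_vec n. \<forall>\<tau>. \<mu> * (y \<bullet> (W *\<^sub>v y) + \<tau>\<^sup>2) \<le> (A *\<^sub>v y + \<tau> \<cdot>\<^sub>v b) \<bullet> (A *\<^sub>v y + \<tau> \<cdot>\<^sub>v b))"
    (is "?all \<longleftrightarrow> ?all'")
  proof
    assume all: ?all
    show ?all'
    proof (intro ballI allI)
      fix y :: "real vec" and \<tau> :: real assume y: "y \<in> carrier_vec n"
      have "y @\<^sub>v vec 1 (\<lambda>_. \<tau>) \<in> carrier_vec (n + 1)" using y by (rule append_carrier_vec) (rule vec_carrier)
      from bspec[OF all this] show "\<mu> * (y \<bullet> (W *\<^sub>v y) + \<tau>\<^sup>2) \<le> (A *\<^sub>v y + \<tau> \<cdot>\<^sub>v b) \<bullet> (A *\<^sub>v y + \<tau> \<cdot>\<^sub>v b)"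
        unfolding A' forms[OF y] .
    qed
  next
    assume all: ?all'
    show ?all
    proof
      fix z :: "real vec" assume "z \<in> carrier_vec (n + 1)"
      then obtain y \<tau> where y: "y \<in> carrier_vec n" and z: "z = y @\<^sub>v vec 1 (\<lambda>_. \<tau>)" by (rule vec_Suc_split)
      show "\<mu> * (z \<bullet> (W' *\<^sub>v z)) \<le> (A' *\<^sub>v z) \<bullet> (A' *\<^sub>v z)"
        unfolding A' z forms[OF y] using all y by blast
    qed
  qed
  moreover have "(\<exists>z \<in> carrier_vec (n + 1). z \<noteq> 0\<^sub>v (n + 1) \<and> (A' *\<^sub>v z) \<bullet> (A' *\<^sub>v z) = \<mu> * (z \<bullet> (W' *\<^sub>v z))) \<longleftrightarrow>
    (\<exists>y \<in> carrier_vec n. \<exists>\<tau>. (y \<noteq> 0\<^sub>v n \<or> \<tau> \<noteq> 0) \<and>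
      (A *\<^sub>v y + \<tau> \<cdot>\<^sub>v b) \<bullet> (A *\<^sub>v y + \<tau> \<cdot>\<^sub>v b) = \<mu> * (y \<bullet> (W *\<^sub>v y) + \<tau>\<^sup>2))"
    (is "?ex \<longleftrightarrow> ?ex'")
  proof
    assume ?ex
    then obtain z where "z \<in> carrier_vec (n + 1)" and z: "z \<noteq> 0\<^sub>v (n + 1)"
      "(A' *\<^sub>v z) \<bullet> (A' *\<^sub>v z) = \<mu> * (z \<bullet> (W' *\<^sub>v z))" by blast
    then obtain y \<tau> where y: "y \<in> carrier_vec n" and zy: "z = y @\<^sub>v vec 1 (\<lambda>_. \<tau>)" by (rule_tac vec_Suc_split)
    show ?ex' using z y unfolding A' zy forms[OF y] nz[OF y] by blast
  next
    assume ?ex'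
    then obtain y \<tau> where y: "y \<in> carrier_vec n" and nz': "y \<noteq> 0\<^sub>v n \<or> \<tau> \<noteq> 0"
      and eq: "(A *\<^sub>v y + \<tau> \<cdot>\<^sub>v b) \<bullet> (A *\<^sub>v y + \<tau> \<cdot>\<^sub>v b) = \<mu> * (y \<bullet> (W *\<^sub>v y) + \<tau>\<^sup>2)" by blast
    show ?ex
    proof (intro bexI conjI)
      show "y @\<^sub>v vec 1 (\<lambda>_. \<tau>) \<noteq> 0\<^sub>v (n + 1)" using nz' nz[OF y] by blast
      show "(A' *\<^sub>v (y @\<^sub>v vec 1 (\<lambda>_. \<tau>))) \<bullet> (A' *\<^sub>v (y @\<^sub>v vec 1 (\<lambda>_. \<tau>))) =
          \<mu> * ((y @\<^sub>v vec 1 (\<lambda>_. \<tau>)) \<bullet> (W' *\<^sub>v (y @\<^sub>v vec 1 (\<lambda>_. \<tau>))))"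
        unfolding A' forms[OF y] by (rule eq)
      show "y @\<^sub>v vec 1 (\<lambda>_. \<tau>) \<in> carrier_vec (n + 1)" using y by (rule append_carrier_vec) (rule vec_carrier)
    qed
  qed
  ultimately show ?thesis unfolding tls_smallest_def carrier_matD(2)[OF A] by (simp only:)
qed

lemma augmented_weight_psd:
  assumes W: "sym_psd n W" and W': "W' = diag_block_mat [W, 1\<^sub>m 1]"
  shows "sym_psd (n + 1) W'"
  unfolding sym_psd_def
proof (intro conjI ballI)
  have W'b: "W' = four_block_mat W (0\<^sub>m n 1) (0\<^sub>m 1 n) (1\<^sub>m 1)"
    unfolding W' diag_block_mat_pair[OF one_carrier_mat] sym_psdD(4,5)[OF W] ..
  show "W' \<in> carrier_mat (n + 1) (n + 1)"
    unfolding W'b by (rule four_block_carrier_mat[OF sym_psdD(1)[OF W] one_carrier_mat])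
  show "transpose_mat W' = W'" unfolding W'b
    by (subst transpose_four_block_mat[OF sym_psdD(1)[OF W] zero_carrier_mat zero_carrier_mat one_carrier_mat])
      (simp add: sym_psdD(2)[OF W])
  fix z :: "real vec" assume "z \<in> carrier_vec (n + 1)"
  then obtain y \<tau> where y: "y \<in> carrier_vec n" and z: "z = y @\<^sub>v vec 1 (\<lambda>_. \<tau> :: real)" by (rule vec_Suc_split)
  show "0 \<le> z \<bullet> (W' *\<^sub>v z)"
    unfolding z augmented_forms(2)[OF zero_carrier_mat zero_carrier_vec W W' y] using sym_psdD(3)[OF W y] by simp
qed

lemma tls_smallest_exists:
  assumes A: "A \<in> carrier_mat m n" and b: "b \<in> carrier_vec m" and W: "sym_psd n W"
  shows "\<exists>\<mu>\<ge>0. tls_smallest W A b \<mu>"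
proof -
  define W' where "W' = diag_block_mat [W, 1\<^sub>m 1]"
  define A' where "A' = A @\<^sub>c mat_of_col b"
  have A'c: "A' \<in> carrier_mat m (n + 1)" using A b by (auto simp: A'_def append_cols_def mat_of_col_def)
  note G = gram_psd[OF A'c]
  \<comment> \<open>The last unit vector bounds the quotient from above.\<close>
  define w where "w = 0\<^sub>v n @\<^sub>v vec 1 (\<lambda>_. 1 :: real)"
  have w: "w \<in> carrier_vec (n + 1)" unfolding w_def by (rule append_carrier_vec) simp_all
  have "0 < w \<bullet> (W' *\<^sub>v w)"
    unfolding w_def augmented_forms(2)[OF A b W W'_def zero_carrier_vec]
    using sym_psdD(3)[OF W, of "0\<^sub>v n"] by simp
  from smallest_generalized_eigenvalue[OF G(1) augmented_weight_psd[OF W W'_def] w this]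
  obtain \<mu> z where "0 \<le> \<mu>"
    and low: "\<And>z. z \<in> carrier_vec (n + 1) \<Longrightarrow>
      \<mu> * (z \<bullet> (W' *\<^sub>v z)) \<le> z \<bullet> ((transpose_mat A' * A') *\<^sub>v z)"
    and z: "z \<in> carrier_vec (n + 1)" "z \<noteq> 0\<^sub>v (n + 1)"
      "z \<bullet> ((transpose_mat A' * A') *\<^sub>v z) = \<mu> * (z \<bullet> (W' *\<^sub>v z))" by blast
  have "tls_smallest W A b \<mu>"
    unfolding tls_smallest_augmented[OF A b W W'_def A'_def]
    using low G(2) z by metis
  with \<open>0 \<le> \<mu>\<close> show ?thesis by blast
qed

section \<open>Expansion of a perturbed eigenpair\<close>

lemma vnorm_mult_bound:
  assumes "dim_vec v = dim_col M" "fnorm M \<le> s" "vnorm v \<le> t" "0 \<le> s"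
  shows "vnorm (M *\<^sub>v v) \<le> s * t"
proof -
  have "vnorm (M *\<^sub>v v) \<le> fnorm M * vnorm v" using assms(1) by (rule vnorm_mult_le)
  also have "\<dots> \<le> s * t" using assms(2-4) fnorm_ge_0 vnorm_ge_0 by (intro mult_mono) auto
  finally show ?thesis .
qed

lemma scalar_bound:
  assumes "dim_vec u = dim_vec v" "vnorm u \<le> s" "vnorm v \<le> t"
  shows "\<bar>u \<bullet> v\<bar> \<le> s * t"
proof -
  have "\<bar>u \<bullet> v\<bar> \<le> vnorm u * vnorm v" using assms(1) by (rule vec_Cauchy_Schwarz)
  also have "\<dots> \<le> s * t" using assms(2,3) vnorm_ge_0 order_trans[OF vnorm_ge_0 assms(2)] by (intro mult_mono) auto
  finally show ?thesis .
qed

text \<open>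
  The right-hand side \<open>g\<close> of an equation \<open>M v = g\<close> controls \<open>v\<close> when the form of \<open>M\<close> is at least
  \<open>c\<close> times the squared norm, since then \<open>v \<bullet> g = v \<bullet> M v\<close>.
\<close>

lemma coercive_solution_bound:
  assumes "c * (v \<bullet> v) \<le> v \<bullet> g" "dim_vec v = dim_vec g"
  shows "c * vnorm v \<le> vnorm g"
proof (cases "vnorm v = 0")
  case True
  then show ?thesis by (simp add: vnorm_ge_0)
next
  case False
  then have pos: "0 < vnorm v" using vnorm_ge_0[of v] by simp
  have "c * vnorm v * vnorm v \<le> vnorm g * vnorm v"
    using assms(1) vec_Cauchy_Schwarz[OF assms(2)] by (simp add: vnorm_sq[symmetric] power2_eq_square mult_ac)
  with pos show ?thesis by simp
qed

lemma vec_add_diff_commute: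
  "dim_vec u = dim_vec w \<Longrightarrow> dim_vec v = dim_vec w \<Longrightarrow> u + v - w = v + (u - (w :: real vec))"
  by (intro eq_vecI) auto

text \<open>
  The unperturbed problem.  The constants depend on it alone, so that all estimates below are uniform in the
  perturbation.  A name ending in \<open>rate\<close> is the factor of \<open>\<epsilon>\<close> in a first-order estimate, one ending in
  \<open>remainder\<close> the factor of \<open>\<epsilon>\<^sup>2\<close>; \<open>step_bound\<close> is a crude bound on \<open>x' - x\<close>.
\<close>

locale tls_nominal =
  fixes m n :: nat and A W :: "real mat" and b x :: "real vec" and \<mu> c :: real
  assumes A: "A \<in> carrier_mat m n" and b: "b \<in> carrier_vec m" and W: "sym_psd n W"
    and pair: "tls_eigenpair W A b \<mu> x" and \<mu>: "0 \<le> \<mu>" and c: "0 < c"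
    and coercive: "y \<in> carrier_vec n \<Longrightarrow> c * (y \<bullet> y) \<le> tls_form W A \<mu> y"
begin

definition "r = A *\<^sub>v x - b"
definition "D = 1 + x \<bullet> (W *\<^sub>v x)"
definition "\<kappa> = vnorm x + 1"
definition "upper_rate = 2 * vnorm r * \<kappa> + \<kappa>\<^sup>2"
definition "step_bound = 2 / c * ((\<mu> + upper_rate) * (fnorm W * vnorm x) + vnorm r + (fnorm A + 1) * \<kappa>)"
definition "lower_rate = 2 * (vnorm r + fnorm A * step_bound) * (\<kappa> + step_bound)"
definition "eigenvalue_rate = upper_rate + lower_rate"
definition "defect_rate = eigenvalue_rate * (fnorm W * vnorm x) + vnorm r + (fnorm A + 1) * \<kappa>"
definition "step_rate = 2 / c * defect_rate"
definition "eigenvalue_remainder = \<kappa>\<^sup>2 + step_rate * defect_rate"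
definition "solution_remainder = \<kappa> + eigenvalue_remainder * (fnorm W * vnorm x) + fnorm A * step_rate + (fnorm A + 1) * step_rate + eigenvalue_rate * (fnorm W * step_rate)"

lemma x: "x \<in> carrier_vec n" and normal_eq: "transpose_mat A *\<^sub>v r = \<mu> \<cdot>\<^sub>v (W *\<^sub>v x)" and r_sq: "r \<bullet> r = \<mu> * D"
  using pair A by (auto simp: tls_eigenpair_def r_def D_def)

lemma dims [simp]: "dim_row A = m" "dim_col A = n" "dim_vec b = m" "dim_row W = n" "dim_col W = n" "dim_vec x = n" "dim_vec r = m"
  using A b x sym_psdD(4,5)[OF W] by (auto simp: r_def)

lemma D_ge_1: "1 \<le> D"
  using sym_psdD(3)[OF W x] by (simp add: D_def)

lemma const_nonneg: "1 \<le> \<kappa>" "0 \<le> upper_rate" "0 \<le> step_bound" "0 \<le> lower_rate" "0 \<le> eigenvalue_rate" "0 \<le> defect_rate" "0 \<le> step_rate" "0 \<le> eigenvalue_remainder" "0 \<le> solution_remainder"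
proof -
  note [simp] = vnorm_ge_0 fnorm_ge_0
  show k: "1 \<le> \<kappa>" by (simp add: \<kappa>_def)
  then show upper_rate: "0 \<le> upper_rate" by (simp add: upper_rate_def)
  then show step_bound: "0 \<le> step_bound" using k c \<mu> by (simp add: step_bound_def)
  then show lower_rate: "0 \<le> lower_rate" using k by (simp add: lower_rate_def)
  then show eigenvalue_rate: "0 \<le> eigenvalue_rate" using upper_rate by (simp add: eigenvalue_rate_def)
  then show defect_rate: "0 \<le> defect_rate" using k by (simp add: defect_rate_def)
  then show step_rate: "0 \<le> step_rate" using c by (simp add: step_rate_def)
  then show eigenvalue_remainder: "0 \<le> eigenvalue_remainder" using defect_rate by (simp add: eigenvalue_remainder_def)
  then show "0 \<le> solution_remainder" using eigenvalue_rate step_rate k by (simp add: solution_remainder_def)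
qed

end

locale tls_small_perturbation = tls_nominal +
  fixes E :: "real mat" and e :: "real vec" and \<epsilon> :: real
  assumes E: "E \<in> carrier_mat m n" and e: "e \<in> carrier_vec m"
    and E_le: "fnorm E \<le> \<epsilon>" and e_le: "vnorm e \<le> \<epsilon>" and \<epsilon>: "\<epsilon> \<le> 1"
begin

definition "\<Delta> = E *\<^sub>v x - e"

lemma dims' [simp]: "dim_row E = m" "dim_col E = n" "dim_vec e = m" "dim_vec \<Delta> = m"
  using E e by (auto simp: \<Delta>_def)

lemma transpose_sum: "transpose_mat (A + E) = transpose_mat A + transpose_mat E"
  by (rule transpose_add[OF A E])

lemma \<epsilon>_nonneg: "0 \<le> \<epsilon>"
  using E_le fnorm_ge_0[of E] by linarith

lemma AE: "A + E \<in> carrier_mat m n" and be: "b + e \<in> carrier_vec m"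
  using A E b e by auto

lemma residual_perturbed: "(A + E) *\<^sub>v x - (b + e) = r + \<Delta>"
proof -
  have "(A + E) *\<^sub>v x = A *\<^sub>v x + E *\<^sub>v x" by (rule add_mult_vec) simp_all
  then show ?thesis unfolding r_def \<Delta>_def by (simp only:) (rule eq_vecI; simp del: index_mult_mat_vec)
qed

lemma \<Delta>_le: "vnorm \<Delta> \<le> \<kappa> * \<epsilon>"
proof -
  have "vnorm \<Delta> \<le> vnorm (E *\<^sub>v x) + vnorm e" unfolding \<Delta>_def by (rule vnorm_diff_triangle) simp
  also have "vnorm (E *\<^sub>v x) \<le> \<epsilon> * vnorm x" by (rule vnorm_mult_bound) (use E_le \<epsilon>_nonneg in auto)
  finally show ?thesis using e_le by (simp add: \<kappa>_def algebra_simps)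
qed

lemma \<epsilon>_sq_le: "\<epsilon> * \<epsilon> \<le> \<epsilon>"
  using mult_left_mono[OF \<epsilon> \<epsilon>_nonneg] by simp

lemma residual_perturbed_sq: "(r + \<Delta>) \<bullet> (r + \<Delta>) = \<mu> * D + 2 * (r \<bullet> \<Delta>) + \<Delta> \<bullet> \<Delta>"
  by (simp add: vec_linear r_sq[symmetric] scalar_commute[of \<Delta> r])

lemma \<Delta>_sq_le: "\<Delta> \<bullet> \<Delta> \<le> \<kappa>\<^sup>2 * (\<epsilon> * \<epsilon>)"
  using scalar_bound[OF refl \<Delta>_le \<Delta>_le] by (simp add: power2_eq_square mult_ac)

text \<open>
  The old solution \<open>x\<close> is a test vector for the perturbed quotient.
\<close>

lemma eigenvalue_upper:
  assumes "\<nu> * D \<le> (r + \<Delta>) \<bullet> (r + \<Delta>)"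
  shows "\<nu> \<le> \<mu> + upper_rate * \<epsilon>"
proof (cases "\<nu> \<le> \<mu>")
  case True
  then show ?thesis using mult_nonneg_nonneg[OF const_nonneg(2) \<epsilon>_nonneg] by linarith
next
  case False
  have "r \<bullet> \<Delta> \<le> vnorm r * (\<kappa> * \<epsilon>)" using scalar_bound[OF _ order_refl \<Delta>_le, of r] by simp
  moreover have "\<kappa>\<^sup>2 * (\<epsilon> * \<epsilon>) \<le> \<kappa>\<^sup>2 * \<epsilon>" using \<epsilon>_sq_le by (intro mult_left_mono) auto
  ultimately have "\<nu> * D \<le> \<mu> * D + upper_rate * \<epsilon>"
    using assms residual_perturbed_sq \<Delta>_sq_le by (simp add: upper_rate_def algebra_simps)
  moreover have "(\<nu> - \<mu>) * 1 \<le> (\<nu> - \<mu>) * D" using False D_ge_1 by (intro mult_left_mono) auto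
  ultimately show ?thesis by (simp add: algebra_simps)
qed

text \<open>
  Only an upper bound on \<open>\<nu>\<close> matters: lowering \<open>\<nu>\<close> cannot decrease the form.
\<close>

lemma coercive_perturbed:
  assumes \<nu>: "\<nu> \<le> \<mu> + upper_rate * \<epsilon>" and y: "y \<in> carrier_vec n"
  shows "(c - (2 * fnorm A + upper_rate * fnorm W) * \<epsilon>) * (y \<bullet> y) \<le> tls_form W (A + E) \<nu> y"
proof -
  note [simp] = carrier_vecD[OF y]
  have eq: "tls_form W (A + E) \<nu> y = tls_form W A \<mu> y + 2 * ((A *\<^sub>v y) \<bullet> (E *\<^sub>v y)) + (E *\<^sub>v y) \<bullet> (E *\<^sub>v y) - (\<nu> - \<mu>) * (y \<bullet> (W *\<^sub>v y))"
    by (simp add: tls_form_def vec_linear scalar_commute[of "E *\<^sub>v y" "A *\<^sub>v y"] ring_distribs)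
  have "\<bar>(A *\<^sub>v y) \<bullet> (E *\<^sub>v y)\<bar> \<le> (fnorm A * vnorm y) * (\<epsilon> * vnorm y)"
    using E_le \<epsilon>_nonneg fnorm_ge_0 by (intro scalar_bound vnorm_mult_bound) auto
  also have "\<dots> = fnorm A * \<epsilon> * (y \<bullet> y)" by (simp add: vnorm_sq[symmetric] power2_eq_square)
  finally have 1: "- (fnorm A * \<epsilon> * (y \<bullet> y)) \<le> (A *\<^sub>v y) \<bullet> (E *\<^sub>v y)" by linarith
  have "(\<nu> - \<mu>) * (y \<bullet> (W *\<^sub>v y)) \<le> upper_rate * \<epsilon> * (y \<bullet> (W *\<^sub>v y))"
    using \<nu> sym_psdD(3)[OF W y] by (intro mult_right_mono) auto
  also have "\<dots> \<le> upper_rate * \<epsilon> * (fnorm W * (y \<bullet> y))"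
    using quadratic_form_le[OF sym_psdD(1)[OF W] y] const_nonneg(2) \<epsilon>_nonneg by (intro mult_left_mono) auto
  finally have 2: "(\<nu> - \<mu>) * (y \<bullet> (W *\<^sub>v y)) \<le> upper_rate * \<epsilon> * (fnorm W * (y \<bullet> y))" .
  from 1 2 coercive[OF y] scalar_self_ge_0[of "E *\<^sub>v y"] show ?thesis
    unfolding eq by (simp add: algebra_simps)
qed

end

text \<open>
  In this context \<open>d\<close> is the change of the solution and \<open>g\<close> the defect that \<open>x\<close> leaves in the
  perturbed normal equation.
\<close>

locale tls_perturbed_pair = tls_small_perturbation +
  fixes \<nu> :: real and x' :: "real vec"
  assumes pair': "tls_eigenpair W (A + E) (b + e) \<nu> x'" and \<nu>: "0 \<le> \<nu>" and \<nu>_le: "\<nu> \<le> \<mu> + upper_rate * \<epsilon>"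
    and coercive': "y \<in> carrier_vec n \<Longrightarrow> c / 2 * (y \<bullet> y) \<le> tls_form W (A + E) \<nu> y"
begin

definition "d = x' - x"
definition "g = (\<nu> - \<mu>) \<cdot>\<^sub>v (W *\<^sub>v x) - transpose_mat E *\<^sub>v r - transpose_mat (A + E) *\<^sub>v \<Delta>"

lemma x': "x' \<in> carrier_vec n"
  using pair' A E by (simp add: tls_eigenpair_def)

lemma dims'' [simp]: "dim_vec x' = n" "dim_vec d = n" "dim_vec g = n"
  using x' by (auto simp: d_def g_def)

lemma d: "d \<in> carrier_vec n" and g: "g \<in> carrier_vec n"
  by (auto intro: carrier_vecI)

text \<open>
  Oriented towards \<open>x'\<close>: since \<open>d\<close> is defined from \<open>x'\<close>, the reverse rewriting would not end.
\<close>

lemma x_plus_d: "x + d = x'"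
  using x x' by (auto simp: d_def)

lemma correction_equation: "transpose_mat (A + E) *\<^sub>v ((A + E) *\<^sub>v d) - \<nu> \<cdot>\<^sub>v (W *\<^sub>v d) = g"
proof (rule eq_vecI)
  fix i assume "i < dim_vec g"
  then have i: "i < n" by simp
  have "(A + E) *\<^sub>v x' - (b + e) = (A + E) *\<^sub>v d + (r + \<Delta>)"
  proof -
    have "(A + E) *\<^sub>v x' = (A + E) *\<^sub>v x + (A + E) *\<^sub>v d" using mult_vec_add[of x "A + E" d] by (simp add: x_plus_d)
    then show ?thesis unfolding residual_perturbed[symmetric]
      by (simp only:) (rule vec_add_diff_commute; simp)
  qed
  then have "transpose_mat (A + E) *\<^sub>v ((A + E) *\<^sub>v d + (r + \<Delta>)) = \<nu> \<cdot>\<^sub>v (W *\<^sub>v x')"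
    using pair' by (simp add: tls_eigenpair_def)
  moreover have "transpose_mat (A + E) *\<^sub>v ((A + E) *\<^sub>v d + (r + \<Delta>)) =
      transpose_mat (A + E) *\<^sub>v ((A + E) *\<^sub>v d) + (transpose_mat A *\<^sub>v r + transpose_mat E *\<^sub>v r + transpose_mat (A + E) *\<^sub>v \<Delta>)"
    by (subst mult_vec_add, simp, simp, subst mult_vec_add, simp, simp) (simp add: transpose_sum add_mult_vec)
  moreover have "W *\<^sub>v x' = W *\<^sub>v x + W *\<^sub>v d" using mult_vec_add[of x W d] by (simp add: x_plus_d)
  ultimately have "(transpose_mat (A + E) *\<^sub>v ((A + E) *\<^sub>v d) + (\<mu> \<cdot>\<^sub>v (W *\<^sub>v x) + transpose_mat E *\<^sub>v r + transpose_mat (A + E) *\<^sub>v \<Delta>)) $ i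
      = (\<nu> \<cdot>\<^sub>v (W *\<^sub>v x + W *\<^sub>v d)) $ i" by (simp add: normal_eq del: index_mult_mat_vec)
  then show "(transpose_mat (A + E) *\<^sub>v ((A + E) *\<^sub>v d) - \<nu> \<cdot>\<^sub>v (W *\<^sub>v d)) $ i = g $ i"
    using i by (simp add: g_def ring_distribs del: index_mult_mat_vec)
qed simp

lemma form_correction: "tls_form W (A + E) \<nu> d = d \<bullet> g"
  unfolding correction_equation[symmetric]
  by (simp add: tls_form_def scalar_diff_right scalar_transpose scalar_smult_right)

lemma AE_le: "fnorm (transpose_mat (A + E)) \<le> fnorm A + 1"
proof -
  show ?thesis unfolding fnorm_transpose using fnorm_triangle[OF A E] E_le \<epsilon> by simp
qed

lemma Et_le: "fnorm (transpose_mat E) \<le> \<epsilon>"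
  using E_le by (simp add: fnorm_transpose)

lemma g_le:
  assumes s: "\<bar>\<nu> - \<mu>\<bar> \<le> s"
  shows "vnorm g \<le> s * (fnorm W * vnorm x) + (vnorm r + (fnorm A + 1) * \<kappa>) * \<epsilon>"
proof -
  have "vnorm g \<le> vnorm ((\<nu> - \<mu>) \<cdot>\<^sub>v (W *\<^sub>v x)) + vnorm (transpose_mat E *\<^sub>v r) + vnorm (transpose_mat (A + E) *\<^sub>v \<Delta>)"
    unfolding g_def by (intro order_trans[OF vnorm_diff_triangle] add_right_mono vnorm_diff_triangle) simp_all
  also have "vnorm ((\<nu> - \<mu>) \<cdot>\<^sub>v (W *\<^sub>v x)) \<le> s * (fnorm W * vnorm x)"
    unfolding vnorm_smult using s vnorm_mult_le[of x W] vnorm_ge_0 by (intro mult_mono) auto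
  also have "vnorm (transpose_mat E *\<^sub>v r) \<le> \<epsilon> * vnorm r"
    using Et_le \<epsilon>_nonneg by (intro vnorm_mult_bound) auto
  also have "vnorm (transpose_mat (A + E) *\<^sub>v \<Delta>) \<le> (fnorm A + 1) * (\<kappa> * \<epsilon>)"
    using AE_le \<Delta>_le fnorm_ge_0[of A] by (intro vnorm_mult_bound) auto
  finally show ?thesis by (simp add: algebra_simps)
qed

lemma d_le: "c / 2 * vnorm d \<le> vnorm g"
  using coercive'[OF d] by (intro coercive_solution_bound) (auto simp: form_correction)

text \<open>
  A first bound that uses only \<open>0 \<le> \<nu> \<le> \<mu> + O(\<epsilon>)\<close>.  It does not tend to zero, but it is what the lower
  estimate of \<open>\<nu>\<close> needs, after which the same argument gives \<open>d = O(\<epsilon>)\<close>.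
\<close>

lemma d_bounded: "vnorm d \<le> step_bound"
proof -
  have "\<bar>\<nu> - \<mu>\<bar> \<le> \<mu> + upper_rate"
    using \<nu> \<nu>_le \<mu> mult_left_mono[OF \<epsilon> const_nonneg(2)] const_nonneg(2) by simp
  then have "vnorm g \<le> (\<mu> + upper_rate) * (fnorm W * vnorm x) + (vnorm r + (fnorm A + 1) * \<kappa>) * \<epsilon>" by (rule g_le)
  also have "(vnorm r + (fnorm A + 1) * \<kappa>) * \<epsilon> \<le> vnorm r + (fnorm A + 1) * \<kappa>"
    using \<epsilon> \<epsilon>_nonneg vnorm_ge_0[of r] fnorm_ge_0[of A] const_nonneg(1) by (intro mult_right_le_one_le) auto
  finally show ?thesis using d_le c by (simp add: step_bound_def field_simps)
qed

text \<open>
  Now \<open>x'\<close> serves as a test vector for the unperturbed quotient; the comparison is uniform because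
  \<open>x'\<close> is bounded.
\<close>

lemma eigenvalue_lower: "\<mu> - \<nu> \<le> lower_rate * \<epsilon>"
proof (cases "\<mu> \<le> \<nu>")
  case True
  then show ?thesis using mult_nonneg_nonneg[OF const_nonneg(4) \<epsilon>_nonneg] by linarith
next
  case False
  define s where "s = A *\<^sub>v x' - b"
  define \<Delta>' where "\<Delta>' = E *\<^sub>v x' - e"
  define D' where "D' = 1 + x' \<bullet> (W *\<^sub>v x')"
  have [simp]: "dim_vec s = m" "dim_vec \<Delta>' = m" by (auto simp: s_def \<Delta>'_def)
  have D': "1 \<le> D'" using sym_psdD(3)[OF W x'] by (simp add: D'_def)
  have "(A + E) *\<^sub>v x' = A *\<^sub>v x' + E *\<^sub>v x'" by (rule add_mult_vec) auto
  then have "(A + E) *\<^sub>v x' - (b + e) = s + \<Delta>'"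
    unfolding s_def \<Delta>'_def by (simp only:) (rule eq_vecI; simp del: index_mult_mat_vec)
  then have 1: "\<nu> * D' = s \<bullet> s + 2 * (s \<bullet> \<Delta>') + \<Delta>' \<bullet> \<Delta>'"
    using pair' by (simp add: tls_eigenpair_def D'_def vec_linear scalar_commute[of \<Delta>' s])
  have 2: "\<mu> * D' \<le> s \<bullet> s"
  proof -
    have "0 \<le> c * (d \<bullet> d)" using c scalar_self_ge_0[of d] by simp
    then show ?thesis
      using coercive[OF d] tls_completing_square[OF A b W pair x'] by (simp add: s_def D'_def d_def)
  qed
  have "A *\<^sub>v x' = A *\<^sub>v x + A *\<^sub>v d" using mult_vec_add[of x A d] by (simp add: x_plus_d)
  then have "s = r + A *\<^sub>v d" unfolding s_def r_def by (simp only:) (rule eq_vecI; simp del: index_mult_mat_vec)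
  then have "vnorm s \<le> vnorm r + vnorm (A *\<^sub>v d)" using vnorm_triangle[of r "A *\<^sub>v d"] by simp
  also have "vnorm (A *\<^sub>v d) \<le> fnorm A * step_bound"
    using d_bounded fnorm_ge_0 by (intro vnorm_mult_bound) auto
  finally have s: "vnorm s \<le> vnorm r + fnorm A * step_bound" by simp
  have "vnorm \<Delta>' \<le> vnorm (E *\<^sub>v x') + vnorm e" unfolding \<Delta>'_def by (rule vnorm_diff_triangle) simp
  also have "vnorm (E *\<^sub>v x') \<le> \<epsilon> * (vnorm x + step_bound)"
    using vnorm_triangle[of x d] d_bounded E_le \<epsilon>_nonneg by (intro vnorm_mult_bound) (auto simp: x_plus_d)
  finally have \<Delta>': "vnorm \<Delta>' \<le> (\<kappa> + step_bound) * \<epsilon>" using e_le by (simp add: \<kappa>_def algebra_simps)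
  have "\<bar>s \<bullet> \<Delta>'\<bar> \<le> (vnorm r + fnorm A * step_bound) * ((\<kappa> + step_bound) * \<epsilon>)"
    using s \<Delta>' by (intro scalar_bound) auto
  then have "(\<mu> - \<nu>) * D' \<le> lower_rate * \<epsilon>"
    using 1 2 scalar_self_ge_0[of \<Delta>'] by (simp add: lower_rate_def algebra_simps)
  moreover have "(\<mu> - \<nu>) * 1 \<le> (\<mu> - \<nu>) * D'" using False D' by (intro mult_left_mono) auto
  ultimately show ?thesis by simp
qed

lemma eigenvalue_change: "\<bar>\<nu> - \<mu>\<bar> \<le> eigenvalue_rate * \<epsilon>"
proof -
  have "0 \<le> upper_rate * \<epsilon>" "0 \<le> lower_rate * \<epsilon>" using const_nonneg \<epsilon>_nonneg by simp_all
  then show ?thesis using \<nu>_le eigenvalue_lower unfolding eigenvalue_rate_def by (simp add: abs_le_iff ring_distribs)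
qed

lemma g_linear: "vnorm g \<le> defect_rate * \<epsilon>"
  using g_le[OF eigenvalue_change] by (simp add: defect_rate_def algebra_simps)

lemma d_linear: "vnorm d \<le> step_rate * \<epsilon>"
  using g_linear d_le c by (simp add: step_rate_def field_simps)

text \<open>
  The completed square of the perturbed problem at \<open>x\<close> gives the exact identity
  \<open>(\<nu> - \<mu>) D = 2 (r \<bullet> \<Delta>) + \<Delta> \<bullet> \<Delta> - d \<bullet> g\<close>, and the last two terms are quadratic.
\<close>

lemma eigenvalue_expansion: "\<bar>(\<nu> - \<mu>) - 2 * (r \<bullet> \<Delta>) / D\<bar> \<le> eigenvalue_remainder * (\<epsilon> * \<epsilon>)"
proof -
  have "tls_form W (A + E) \<nu> (x - x') = tls_form W (A + E) \<nu> d"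
  proof -
    have "x - x' = (-1) \<cdot>\<^sub>v d" using x x' by (auto simp: d_def)
    then show ?thesis by (simp add: tls_form_def vec_linear)
  qed
  then have "(\<nu> - \<mu>) * D - 2 * (r \<bullet> \<Delta>) = \<Delta> \<bullet> \<Delta> - d \<bullet> g"
    using tls_completing_square[OF AE be W pair' x] residual_perturbed_sq form_correction
    by (simp add: residual_perturbed D_def ring_distribs)
  moreover have "\<bar>d \<bullet> g\<bar> \<le> (step_rate * \<epsilon>) * (defect_rate * \<epsilon>)" using d_linear g_linear by (intro scalar_bound) auto
  ultimately have "\<bar>(\<nu> - \<mu>) * D - 2 * (r \<bullet> \<Delta>)\<bar> \<le> eigenvalue_remainder * (\<epsilon> * \<epsilon>)"
    using \<Delta>_sq_le scalar_self_ge_0[of \<Delta>] by (simp add: eigenvalue_remainder_def algebra_simps abs_le_iff)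
  moreover have "\<bar>(\<nu> - \<mu>) - 2 * (r \<bullet> \<Delta>) / D\<bar> * 1 \<le> \<bar>(\<nu> - \<mu>) - 2 * (r \<bullet> \<Delta>) / D\<bar> * D"
    using D_ge_1 by (intro mult_left_mono) auto
  moreover have "\<bar>(\<nu> - \<mu>) - 2 * (r \<bullet> \<Delta>) / D\<bar> * D = \<bar>((\<nu> - \<mu>) - 2 * (r \<bullet> \<Delta>) / D) * D\<bar>"
    using D_ge_1 by (simp add: abs_mult)
  moreover have "((\<nu> - \<mu>) - 2 * (r \<bullet> \<Delta>) / D) * D = (\<nu> - \<mu>) * D - 2 * (r \<bullet> \<Delta>)"
    using D_ge_1 by (simp add: field_simps)
  ultimately show ?thesis by simp
qed

text \<open>
  The vector \<open>h\<close> solves the equation of \<open>d\<close> with all second-order terms dropped; \<open>q\<close> collects these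
  terms, and coercivity turns the bound on \<open>q\<close> into a bound on \<open>d - h\<close>.
\<close>

lemma solution_expansion:
  assumes h: "h \<in> carrier_vec n"
    and Ph: "transpose_mat A *\<^sub>v (A *\<^sub>v h) - \<mu> \<cdot>\<^sub>v (W *\<^sub>v h) =
      (2 * (r \<bullet> \<Delta>) / D) \<cdot>\<^sub>v (W *\<^sub>v x) - transpose_mat E *\<^sub>v r - transpose_mat A *\<^sub>v \<Delta>"
  shows "vnorm (d - h) \<le> solution_remainder / c * \<epsilon>\<^sup>2"
proof -
  note [simp] = carrier_vecD[OF h]
  define \<beta> where "\<beta> = (\<nu> - \<mu>) - 2 * (r \<bullet> \<Delta>) / D"
  define q where "q = (\<beta> \<cdot>\<^sub>v (W *\<^sub>v x) + (\<nu> - \<mu>) \<cdot>\<^sub>v (W *\<^sub>v d)) - transpose_mat E *\<^sub>v \<Delta> - transpose_mat A *\<^sub>v (E *\<^sub>v d)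
      - transpose_mat E *\<^sub>v ((A + E) *\<^sub>v d)"
  have [simp]: "dim_vec q = n" by (simp add: q_def)
  have Pd: "transpose_mat A *\<^sub>v (A *\<^sub>v (d - h)) - \<mu> \<cdot>\<^sub>v (W *\<^sub>v (d - h)) = q"
  proof (rule eq_vecI)
    fix i assume "i < dim_vec q"
    then have i: "i < n" by simp
    have hat: "(transpose_mat A *\<^sub>v (A *\<^sub>v d) + transpose_mat A *\<^sub>v (E *\<^sub>v d) + transpose_mat E *\<^sub>v ((A + E) *\<^sub>v d) - \<nu> \<cdot>\<^sub>v (W *\<^sub>v d)) $ i
      = ((\<nu> - \<mu>) \<cdot>\<^sub>v (W *\<^sub>v x) - transpose_mat E *\<^sub>v r - (transpose_mat A *\<^sub>v \<Delta> + transpose_mat E *\<^sub>v \<Delta>)) $ i"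
    proof -
      have "transpose_mat (A + E) *\<^sub>v ((A + E) *\<^sub>v d) = transpose_mat A *\<^sub>v ((A + E) *\<^sub>v d) + transpose_mat E *\<^sub>v ((A + E) *\<^sub>v d)"
        unfolding transpose_sum by (rule add_mult_vec) auto
      moreover have "transpose_mat A *\<^sub>v ((A + E) *\<^sub>v d) = transpose_mat A *\<^sub>v (A *\<^sub>v d) + transpose_mat A *\<^sub>v (E *\<^sub>v d)"
        by (simp add: add_mult_vec mult_vec_add)
      moreover have "transpose_mat (A + E) *\<^sub>v \<Delta> = transpose_mat A *\<^sub>v \<Delta> + transpose_mat E *\<^sub>v \<Delta>"
        unfolding transpose_sum by (rule add_mult_vec) auto
      ultimately show ?thesis using correction_equation unfolding g_def by simp
    qed
    have "(transpose_mat A *\<^sub>v (A *\<^sub>v h) - \<mu> \<cdot>\<^sub>v (W *\<^sub>v h)) $ i =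
      ((2 * (r \<bullet> \<Delta>) / D) \<cdot>\<^sub>v (W *\<^sub>v x) - transpose_mat E *\<^sub>v r - transpose_mat A *\<^sub>v \<Delta>) $ i"
      unfolding Ph ..
    with hat show "(transpose_mat A *\<^sub>v (A *\<^sub>v (d - h)) - \<mu> \<cdot>\<^sub>v (W *\<^sub>v (d - h))) $ i = q $ i"
      using i by (simp add: q_def \<beta>_def mult_vec_diff ring_distribs del: index_mult_mat_vec)
  qed simp
  have dh: "d - h \<in> carrier_vec n" using d h by simp
  have "tls_form W A \<mu> (d - h) = (d - h) \<bullet> q"
    unfolding Pd[symmetric]
    by (subst scalar_diff_right, simp, simp, subst scalar_transpose, simp, simp, simp add: tls_form_def)
  then have "c * vnorm (d - h) \<le> vnorm q"
    using coercive[OF dh] by (intro coercive_solution_bound) auto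
  also have "vnorm q \<le> solution_remainder * (\<epsilon> * \<epsilon>)"
  proof -
    have "vnorm q \<le> vnorm (\<beta> \<cdot>\<^sub>v (W *\<^sub>v x)) + vnorm ((\<nu> - \<mu>) \<cdot>\<^sub>v (W *\<^sub>v d)) + vnorm (transpose_mat E *\<^sub>v \<Delta>)
        + vnorm (transpose_mat A *\<^sub>v (E *\<^sub>v d)) + vnorm (transpose_mat E *\<^sub>v ((A + E) *\<^sub>v d))"
      unfolding q_def
      by (intro order_trans[OF vnorm_diff_triangle] add_right_mono vnorm_triangle) simp_all
    also have "vnorm (\<beta> \<cdot>\<^sub>v (W *\<^sub>v x)) \<le> eigenvalue_remainder * (\<epsilon> * \<epsilon>) * (fnorm W * vnorm x)"
      unfolding vnorm_smult using eigenvalue_expansion vnorm_mult_le[of x W] vnorm_ge_0 const_nonneg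
      by (intro mult_mono) (auto simp: \<beta>_def)
    also have "vnorm ((\<nu> - \<mu>) \<cdot>\<^sub>v (W *\<^sub>v d)) \<le> eigenvalue_rate * \<epsilon> * (fnorm W * (step_rate * \<epsilon>))"
      unfolding vnorm_smult using eigenvalue_change vnorm_mult_bound[of d W "fnorm W" "step_rate * \<epsilon>"] d_linear vnorm_ge_0 fnorm_ge_0 const_nonneg \<epsilon>_nonneg
      by (intro mult_mono) auto
    also have "vnorm (transpose_mat E *\<^sub>v \<Delta>) \<le> \<epsilon> * (\<kappa> * \<epsilon>)"
      using Et_le \<Delta>_le \<epsilon>_nonneg by (intro vnorm_mult_bound) auto
    also have "vnorm (transpose_mat A *\<^sub>v (E *\<^sub>v d)) \<le> fnorm A * (\<epsilon> * (step_rate * \<epsilon>))"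
      using E_le d_linear \<epsilon>_nonneg fnorm_ge_0[of A] by (intro vnorm_mult_bound) (auto simp: fnorm_transpose)
    also have "vnorm (transpose_mat E *\<^sub>v ((A + E) *\<^sub>v d)) \<le> \<epsilon> * ((fnorm A + 1) * (step_rate * \<epsilon>))"
      using Et_le AE_le d_linear \<epsilon>_nonneg fnorm_ge_0[of A] by (intro vnorm_mult_bound) (auto simp: fnorm_transpose)
    finally show ?thesis by (simp add: solution_remainder_def algebra_simps)
  qed
  finally show ?thesis using c by (simp add: field_simps power2_eq_square)
qed

end

text \<open>
  The bound on \<open>\<epsilon>\<close> keeps at least half of the coercivity constant \<open>c\<close>.
\<close>

lemma (in tls_nominal) perturbation:
  "\<exists>\<delta>>0. \<exists>C\<ge>0. \<forall>E \<in> carrier_mat m n. \<forall>e \<in> carrier_vec m. \<forall>\<epsilon>. fnorm E \<le> \<epsilon> \<longrightarrow> vnorm e \<le> \<epsilon> \<longrightarrow> \<epsilon> < \<delta> \<longrightarrow>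
     (\<exists>\<nu> x'. tls_eigenpair W (A + E) (b + e) \<nu> x' \<and>
       (\<forall>y \<in> carrier_vec n. y \<noteq> 0\<^sub>v n \<longrightarrow> 0 < tls_form W (A + E) \<nu> y) \<and>
       (\<forall>h \<in> carrier_vec n.
         transpose_mat A *\<^sub>v (A *\<^sub>v h) - \<mu> \<cdot>\<^sub>v (W *\<^sub>v h) =
           (2 * (r \<bullet> (E *\<^sub>v x - e)) / D) \<cdot>\<^sub>v (W *\<^sub>v x) - transpose_mat E *\<^sub>v r - transpose_mat A *\<^sub>v (E *\<^sub>v x - e) \<longrightarrow>
         vnorm (x' - x - h) \<le> C * \<epsilon>\<^sup>2))"
proof -
  define q where "q = 2 * fnorm A + upper_rate * fnorm W"
  have q: "0 \<le> q" using fnorm_ge_0 const_nonneg(2) by (simp add: q_def)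
  define \<delta> where "\<delta> = min 1 (c / (2 * (q + 1)))"
  have "0 < \<delta>" using c q by (simp add: \<delta>_def)
  moreover have "0 \<le> solution_remainder / c" using c const_nonneg(9) by simp
  moreover have "\<exists>\<nu> x'. tls_eigenpair W (A + E) (b + e) \<nu> x' \<and>
       (\<forall>y \<in> carrier_vec n. y \<noteq> 0\<^sub>v n \<longrightarrow> 0 < tls_form W (A + E) \<nu> y) \<and>
       (\<forall>h \<in> carrier_vec n.
         transpose_mat A *\<^sub>v (A *\<^sub>v h) - \<mu> \<cdot>\<^sub>v (W *\<^sub>v h) =
           (2 * (r \<bullet> (E *\<^sub>v x - e)) / D) \<cdot>\<^sub>v (W *\<^sub>v x) - transpose_mat E *\<^sub>v r - transpose_mat A *\<^sub>v (E *\<^sub>v x - e) \<longrightarrow>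
         vnorm (x' - x - h) \<le> solution_remainder / c * \<epsilon>\<^sup>2)"
    if E: "E \<in> carrier_mat m n" and e: "e \<in> carrier_vec m"
      and E_le: "fnorm E \<le> \<epsilon>" and e_le: "vnorm e \<le> \<epsilon>" and small: "\<epsilon> < \<delta>" for E e \<epsilon>
  proof -
    interpret tls_small_perturbation m n A W b x \<mu> c E e \<epsilon>
      using E e E_le e_le small by unfold_locales (auto simp: \<delta>_def)
    obtain \<nu> where \<nu>: "0 \<le> \<nu>" and least: "tls_smallest W (A + E) (b + e) \<nu>"
      using tls_smallest_exists[OF AE be W] by blast
    have "\<nu> * (x \<bullet> (W *\<^sub>v x) + (-1)\<^sup>2) \<le> ((A + E) *\<^sub>v x + (-1) \<cdot>\<^sub>v (b + e)) \<bullet> ((A + E) *\<^sub>v x + (-1) \<cdot>\<^sub>v (b + e))"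
      using least x E unfolding tls_smallest_def by (metis carrier_matD(2) AE)
    moreover have "(A + E) *\<^sub>v x + (-1) \<cdot>\<^sub>v (b + e) = r + \<Delta>"
      unfolding residual_perturbed[symmetric] by (rule eq_vecI) auto
    ultimately have \<nu>_le: "\<nu> \<le> \<mu> + upper_rate * \<epsilon>" by (intro eigenvalue_upper) (simp add: D_def add.commute)
    have coercive': "c / 2 * (y \<bullet> y) \<le> tls_form W (A + E) \<nu> y" if y: "y \<in> carrier_vec n" for y
    proof -
      have "q * \<epsilon> \<le> q * (c / (2 * (q + 1)))" using small q by (intro mult_left_mono) (auto simp: \<delta>_def)
      also have "\<dots> \<le> c / 2" using c q by (simp add: field_simps)
      finally have "c / 2 * (y \<bullet> y) \<le> (c - q * \<epsilon>) * (y \<bullet> y)"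
        using scalar_self_ge_0[of y] by (intro mult_right_mono) auto
      also have "\<dots> \<le> tls_form W (A + E) \<nu> y" unfolding q_def by (rule coercive_perturbed[OF \<nu>_le y])
      finally show ?thesis .
    qed
    have pd: "0 < tls_form W (A + E) \<nu> y" if y: "y \<in> carrier_vec n" "y \<noteq> 0\<^sub>v n" for y
    proof -
      have "0 < y \<bullet> y" using y scalar_self_eq_0[of y] scalar_self_ge_0[of y] by auto
      then have "0 < c / 2 * (y \<bullet> y)" using c by simp
      then show ?thesis using coercive'[OF y(1)] by linarith
    qed
    obtain x' where x': "tls_eigenpair W (A + E) (b + e) \<nu> x'"
      using tls_eigenpair_exists[OF AE be W least pd] by blast
    interpret tls_perturbed_pair m n A W b x \<mu> c E e \<epsilon> \<nu> x'
      by unfold_locales (fact x' \<nu> \<nu>_le coercive')+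
    show ?thesis
      using pair' pd solution_expansion unfolding d_def \<Delta>_def by blast
  qed
  ultimately show ?thesis by blast
qed

section \<open>Solutions of the MTLS problem\<close>

definition mtls_weight :: "nat \<Rightarrow> nat \<Rightarrow> real mat" where
  "mtls_weight n1 n2 = diag_block_mat [0\<^sub>m n1 n1, 1\<^sub>m n2]"

lemma mtls_weight_blocks:
  "mtls_weight n1 n2 = four_block_mat (0\<^sub>m n1 n1) (0\<^sub>m n1 n2) (0\<^sub>m n2 n1) (1\<^sub>m n2)"
  unfolding mtls_weight_def diag_block_mat_pair[OF one_carrier_mat] by simp

lemma mtls_weight_carrier: "mtls_weight n1 n2 \<in> carrier_mat (n1 + n2) (n1 + n2)"
  by (auto simp: mtls_weight_def Let_def)

lemma mtls_weight_form:
  assumes u: "u \<in> carrier_vec n1" and v: "v \<in> carrier_vec n2"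
  shows "mtls_weight n1 n2 *\<^sub>v (u @\<^sub>v v) = 0\<^sub>v n1 @\<^sub>v v"
    and "(u @\<^sub>v v) \<bullet> (mtls_weight n1 n2 *\<^sub>v (u @\<^sub>v v)) = v \<bullet> v"
proof -
  have "mtls_weight n1 n2 *\<^sub>v (u @\<^sub>v v) =
      (0\<^sub>m n1 n1 *\<^sub>v u + 0\<^sub>m n1 n2 *\<^sub>v v) @\<^sub>v (0\<^sub>m n2 n1 *\<^sub>v u + 1\<^sub>m n2 *\<^sub>v v)"
    unfolding mtls_weight_blocks by (rule four_block_mat_mult_vec) (use u v in auto)
  also have "0\<^sub>m n1 n1 *\<^sub>v u + 0\<^sub>m n1 n2 *\<^sub>v v = 0\<^sub>v n1" using u v by (intro eq_vecI) (auto simp: scalar_prod_def)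
  also have "0\<^sub>m n2 n1 *\<^sub>v u + 1\<^sub>m n2 *\<^sub>v v = v" using u v by (intro eq_vecI) (auto simp: scalar_prod_def[of _ u])
  finally show eq: "mtls_weight n1 n2 *\<^sub>v (u @\<^sub>v v) = 0\<^sub>v n1 @\<^sub>v v" .
  show "(u @\<^sub>v v) \<bullet> (mtls_weight n1 n2 *\<^sub>v (u @\<^sub>v v)) = v \<bullet> v"
    unfolding eq by (subst scalar_prod_append[of _ n1 _ n2]) (use u v in auto)
qed

lemma mtls_weight_form_last:
  assumes "y \<in> carrier_vec (n1 + n2)"
  shows "y \<bullet> (mtls_weight n1 n2 *\<^sub>v y) = vec_last y n2 \<bullet> vec_last y n2"
  using mtls_weight_form(2)[of "vec_first y n1" n1 "vec_last y n2" n2] vec_first_last_append[OF assms] by simp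

lemma mtls_weight_psd: "sym_psd (n1 + n2) (mtls_weight n1 n2)"
  unfolding sym_psd_def
proof (intro conjI ballI)
  show "transpose_mat (mtls_weight n1 n2) = mtls_weight n1 n2"
    unfolding mtls_weight_blocks by (subst transpose_four_block_mat[of _ n1 n1 _ n2 _ n2]) simp_all
qed (simp_all add: mtls_weight_carrier mtls_weight_form_last scalar_self_ge_0)

lemma append_cols_carrier: "X \<in> carrier_mat r k \<Longrightarrow> Y \<in> carrier_mat r l \<Longrightarrow> X @\<^sub>c Y \<in> carrier_mat r (k + l)"
  by (auto simp: append_cols_def)

lemma append_cols_index:
  assumes "X \<in> carrier_mat r k" "Y \<in> carrier_mat r l" "i < r" "j < k + l"
  shows "(X @\<^sub>c Y) $$ (i, j) = (if j < k then X $$ (i, j) else Y $$ (i, j - k))"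
  using assms by (auto simp: append_cols_def)

lemma left_right_cols:
  assumes A: "A \<in> carrier_mat r (k + l)"
  shows "left_cols k A \<in> carrier_mat r k" "right_cols k A \<in> carrier_mat r l"
    and "A = left_cols k A @\<^sub>c right_cols k A"
proof -
  note [simp] = carrier_matD[OF A]
  show L: "left_cols k A \<in> carrier_mat r k" and R: "right_cols k A \<in> carrier_mat r l"
    by (auto simp: left_cols_def right_cols_def mat_of_cols_def intro: carrier_matI)
  show "A = left_cols k A @\<^sub>c right_cols k A"
  proof (rule eq_matI)
    fix i j assume "i < dim_row (left_cols k A @\<^sub>c right_cols k A)" "j < dim_col (left_cols k A @\<^sub>c right_cols k A)"
    then have ij: "i < r" "j < k + l" using append_cols_carrier[OF L R] by auto
    then show "A $$ (i, j) = (left_cols k A @\<^sub>c right_cols k A) $$ (i, j)"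
      unfolding append_cols_index[OF L R ij] by (auto simp: left_cols_def right_cols_def mat_of_cols_def)
  qed (use append_cols_carrier[OF L R] in auto)
qed

lemma mult_vec_first_last:
  assumes A: "(A :: real mat) \<in> carrier_mat r (k + l)" and x: "x \<in> carrier_vec (k + l)"
  shows "A *\<^sub>v x = left_cols k A *\<^sub>v vec_first x k + right_cols k A *\<^sub>v vec_last x l"
  using append_cols_mult_vec[OF left_right_cols(1,2)[OF A], of "vec_first x k" "vec_last x l"]
    vec_first_last_append[OF x] left_right_cols(3)[OF A] by simp

lemma fnorm_append_col_sq:
  assumes X: "X \<in> carrier_mat r k" and v: "v \<in> carrier_vec r"
  shows "(fnorm (X @\<^sub>c mat_of_col v))\<^sup>2 = (fnorm X)\<^sup>2 + v \<bullet> v"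
proof -
  note c = append_cols_carrier[OF X mat_of_col_carrier[OF v]]
  have "(fnorm (X @\<^sub>c mat_of_col v))\<^sup>2 = (\<Sum>i<r. \<Sum>j<k + 1. ((X @\<^sub>c mat_of_col v) $$ (i, j))\<^sup>2)"
    using carrier_matD[OF c] by (simp add: fnorm_sq)
  also have "\<dots> = (\<Sum>i<r. (\<Sum>j<k. (X $$ (i, j))\<^sup>2) + (v $ i)\<^sup>2)"
  proof (rule sum.cong[OF refl])
    fix i assume "i \<in> {..<r}"
    then have i: "i < r" by simp
    have "(\<Sum>j<k + 1. ((X @\<^sub>c mat_of_col v) $$ (i, j))\<^sup>2) =
        (\<Sum>j<k. ((X @\<^sub>c mat_of_col v) $$ (i, j))\<^sup>2) + ((X @\<^sub>c mat_of_col v) $$ (i, k))\<^sup>2" by simp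
    also have "(X @\<^sub>c mat_of_col v) $$ (i, k) = v $ i"
      using append_cols_index[OF X mat_of_col_carrier[OF v] i, of k] v i by (simp add: mat_of_col_def mat_of_cols_def)
    also have "(\<Sum>j<k. ((X @\<^sub>c mat_of_col v) $$ (i, j))\<^sup>2) = (\<Sum>j<k. (X $$ (i, j))\<^sup>2)"
      using append_cols_index[OF X mat_of_col_carrier[OF v] i] by (intro sum.cong) auto
    finally show "(\<Sum>j<k + 1. ((X @\<^sub>c mat_of_col v) $$ (i, j))\<^sup>2) = (\<Sum>j<k. (X $$ (i, j))\<^sup>2) + (v $ i)\<^sup>2" .
  qed
  also have "\<dots> = (fnorm X)\<^sup>2 + v \<bullet> v"
    unfolding fnorm_sq using X v by (simp add: sum.distrib scalar_prod_def power2_eq_square lessThan_atLeast0)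
  finally show ?thesis .
qed

lemma fnorm_append_col_parts:
  assumes X: "X \<in> carrier_mat r k" and v: "v \<in> carrier_vec r"
  shows "fnorm X \<le> fnorm (X @\<^sub>c mat_of_col v)" "vnorm v \<le> fnorm (X @\<^sub>c mat_of_col v)"
  by (rule power2_le_imp_le; simp add: fnorm_append_col_sq[OF X v] vnorm_sq scalar_self_ge_0 fnorm_ge_0)+

lemma vec_add_eq_iff_diff_eq:
  assumes "dim_vec v = dim_vec u" "dim_vec w = dim_vec u" "dim_vec z = dim_vec u"
  shows "u + v = w + z \<longleftrightarrow> u - w = z - (v :: real vec)"
proof -
  have "a + b = c + d \<longleftrightarrow> a - c = d - b" for a b c d :: real by linarith
  with assms show ?thesis by (simp add: vec_eq_iff)
qed

lemma mtls_feasible_residual: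
  assumes A: "A \<in> carrier_mat m (n1 + n2)" and b: "b \<in> carrier_vec m"
    and E: "E \<in> carrier_mat m n2" and f: "f \<in> carrier_vec m" and x: "x \<in> carrier_vec (n1 + n2)"
  shows "mtls_feasible n1 n2 A b E f x \<longleftrightarrow> A *\<^sub>v x - b = f - E *\<^sub>v vec_last x n2"
proof -
  note [simp] = carrier_matD[OF A] carrier_vecD[OF b] carrier_matD[OF E] carrier_vecD[OF f] carrier_vecD[OF x]
  note LR = left_right_cols(1,2)[OF A]
  note [simp] = carrier_matD[OF LR(1)] carrier_matD[OF LR(2)]
  have "(right_cols n1 A + E) *\<^sub>v vec_last x n2 = right_cols n1 A *\<^sub>v vec_last x n2 + E *\<^sub>v vec_last x n2"
    by (rule add_mult_vec) simp_all
  then have "left_cols n1 A *\<^sub>v vec_first x n1 + (right_cols n1 A + E) *\<^sub>v vec_last x n2 = A *\<^sub>v x + E *\<^sub>v vec_last x n2"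
    unfolding mult_vec_first_last[OF A x] by (simp only:) (rule eq_vecI; simp del: index_mult_mat_vec)
  moreover have "A *\<^sub>v x + E *\<^sub>v vec_last x n2 = b + f \<longleftrightarrow> A *\<^sub>v x - b = f - E *\<^sub>v vec_last x n2"
    by (rule vec_add_eq_iff_diff_eq) simp_all
  ultimately show ?thesis using E f x by (simp add: mtls_feasible_def)
qed

text \<open>
  The constraint reads \<open>[E, f] z = A x - b\<close> with \<open>z = [-x\<^sub>2, 1]\<close>, where \<open>x\<^sub>2\<close> is the second block of
  \<open>x\<close>, and the Frobenius norm dominates the operator norm.
\<close>

lemma mtls_feasible_lower_bound:
  assumes A: "A \<in> carrier_mat m (n1 + n2)" and b: "b \<in> carrier_vec m"
    and F: "mtls_feasible n1 n2 A b E f x"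
  shows "(A *\<^sub>v x - b) \<bullet> (A *\<^sub>v x - b) \<le> (fnorm (E @\<^sub>c mat_of_col f))\<^sup>2 * (1 + x \<bullet> (mtls_weight n1 n2 *\<^sub>v x))"
proof -
  have E: "E \<in> carrier_mat m n2" and f: "f \<in> carrier_vec m" and x: "x \<in> carrier_vec (n1 + n2)"
    using F A by (auto simp: mtls_feasible_def)
  note [simp] = carrier_matD[OF A] carrier_vecD[OF b] carrier_matD[OF E] carrier_vecD[OF f] carrier_vecD[OF x]
  define z where "z = ((-1) \<cdot>\<^sub>v vec_last x n2) @\<^sub>v vec 1 (\<lambda>_. 1 :: real)"
  have "(E @\<^sub>c mat_of_col f) *\<^sub>v z = E *\<^sub>v ((-1) \<cdot>\<^sub>v vec_last x n2) + mat_of_col f *\<^sub>v vec 1 (\<lambda>_. 1)"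
    unfolding z_def by (rule append_cols_mult_vec[OF E mat_of_col_carrier[OF f]]) simp_all
  also have "\<dots> = f - E *\<^sub>v vec_last x n2"
  proof -
    have "mat_of_col f *\<^sub>v vec 1 (\<lambda>_. 1) = f" by (subst mat_of_col_mult_vec) auto
    moreover have "E *\<^sub>v ((-1) \<cdot>\<^sub>v vec_last x n2) = (-1) \<cdot>\<^sub>v (E *\<^sub>v vec_last x n2)" by (rule mult_vec_smult) simp
    ultimately show ?thesis by (simp only:) (rule eq_vecI; simp del: index_mult_mat_vec)
  qed
  also have "\<dots> = A *\<^sub>v x - b" using F mtls_feasible_residual[OF A b E f x] by simp
  finally have eq: "(E @\<^sub>c mat_of_col f) *\<^sub>v z = A *\<^sub>v x - b" .
  have "z \<bullet> z = ((-1) \<cdot>\<^sub>v vec_last x n2) \<bullet> ((-1) \<cdot>\<^sub>v vec_last x n2) + vec 1 (\<lambda>_. 1) \<bullet> vec 1 (\<lambda>_. 1 :: real)"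
    unfolding z_def by (rule scalar_prod_append[of _ n2 _ 1]) auto
  also have "\<dots> = 1 + x \<bullet> (mtls_weight n1 n2 *\<^sub>v x)"
    by (simp add: mtls_weight_form_last[OF x] scalar_prod_def[of "vec _ _"])
  finally have zz: "z \<bullet> z = 1 + x \<bullet> (mtls_weight n1 n2 *\<^sub>v x)" .
  have "dim_vec z = dim_col (E @\<^sub>c mat_of_col f)"
    using append_cols_carrier[OF E mat_of_col_carrier[OF f]] by (simp add: z_def)
  then have "vnorm (A *\<^sub>v x - b) \<le> fnorm (E @\<^sub>c mat_of_col f) * vnorm z"
    unfolding eq[symmetric] by (rule vnorm_mult_le)
  then have "(vnorm (A *\<^sub>v x - b))\<^sup>2 \<le> (fnorm (E @\<^sub>c mat_of_col f) * vnorm z)\<^sup>2"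
    by (intro power_mono vnorm_ge_0)
  then show ?thesis by (simp add: vnorm_sq power_mult_distrib zz)
qed

text \<open>
  The rank-one correction \<open>r z\<^sup>T / (z \<bullet> z)\<close> with \<open>r = A x - b\<close> and \<open>z = [-x\<^sub>2, 1]\<close> attains the
  bound.
\<close>

lemma mtls_feasible_attained:
  assumes A: "A \<in> carrier_mat m (n1 + n2)" and b: "b \<in> carrier_vec m" and x: "x \<in> carrier_vec (n1 + n2)"
  shows "\<exists>E f. mtls_feasible n1 n2 A b E f x \<and>
    (fnorm (E @\<^sub>c mat_of_col f))\<^sup>2 * (1 + x \<bullet> (mtls_weight n1 n2 *\<^sub>v x)) = (A *\<^sub>v x - b) \<bullet> (A *\<^sub>v x - b)"
proof -
  note [simp] = carrier_matD[OF A] carrier_vecD[OF b] carrier_vecD[OF x]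
  define y where "y = vec_last x n2"
  define s where "s = 1 + y \<bullet> y"
  have s: "1 \<le> s" using scalar_self_ge_0[of y] by (simp add: s_def)
  define r where "r = A *\<^sub>v x - b"
  have r: "r \<in> carrier_vec m" by (auto simp: r_def intro: carrier_vecI)
  have [simp]: "dim_vec y = n2" "dim_vec r = m" by (simp_all add: y_def r_def)
  define E where "E = mat m n2 (\<lambda>(i, j). - (r $ i * y $ j) / s)"
  define f where "f = (1 / s) \<cdot>\<^sub>v r"
  have E: "E \<in> carrier_mat m n2" and f: "f \<in> carrier_vec m" by (auto simp: E_def f_def r)
  have "f - E *\<^sub>v y = r"
  proof (rule eq_vecI)
    fix i assume "i < dim_vec r"
    then have i: "i < m" by simp
    have "(E *\<^sub>v y) $ i = (\<Sum>j = 0..<n2. - (r $ i / s) * (y $ j * y $ j))"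
      using i by (simp add: E_def scalar_prod_def[of _ y] mult.assoc)
    also have "\<dots> = - (r $ i / s) * (y \<bullet> y)" by (simp add: scalar_prod_def sum_distrib_left)
    finally have "(f - E *\<^sub>v y) $ i = r $ i / s * s"
      using i E by (simp add: f_def s_def ring_distribs)
    then show "(f - E *\<^sub>v y) $ i = r $ i" using s by simp
  qed (use E f in auto)
  then have feas: "mtls_feasible n1 n2 A b E f x"
    unfolding mtls_feasible_residual[OF A b E f x] by (simp add: r_def y_def)
  have "(fnorm E)\<^sup>2 = (\<Sum>i<m. \<Sum>j<n2. (1 / s\<^sup>2) * ((r $ i * r $ i) * (y $ j * y $ j)))"
    unfolding fnorm_sq by (simp add: E_def power2_eq_square mult_ac)
  also have "\<dots> = (1 / s\<^sup>2) * ((r \<bullet> r) * (y \<bullet> y))"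
  proof -
    have "(r \<bullet> r) * (y \<bullet> y) = (\<Sum>i<m. \<Sum>j<n2. (r $ i * r $ i) * (y $ j * y $ j))"
      by (simp add: scalar_prod_def sum_product lessThan_atLeast0)
    then show ?thesis by (simp only: sum_distrib_left)
  qed
  finally have "(fnorm (E @\<^sub>c mat_of_col f))\<^sup>2 = (1 / s\<^sup>2) * ((r \<bullet> r) * (y \<bullet> y)) + (1 / s\<^sup>2) * (r \<bullet> r)"
    unfolding fnorm_append_col_sq[OF E f] by (simp add: f_def power2_eq_square)
  also have "\<dots> = (1 / s\<^sup>2) * ((r \<bullet> r) * s)" by (simp add: s_def ring_distribs)
  finally have "(fnorm (E @\<^sub>c mat_of_col f))\<^sup>2 * s = r \<bullet> r" using s by (simp add: power2_eq_square)
  then show ?thesis using feas by (auto simp: mtls_weight_form_last[OF x] s_def y_def r_def)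
qed

text \<open>
  By the completed square, the quotient \<open>|A y - b|\<^sup>2 / (1 + y \<bullet> W y)\<close> exceeds \<open>\<mu>\<close> by a positive multiple
  of the form at \<open>y - x\<close>.
\<close>

lemma mtls_solution_iff_eigenpair:
  assumes A: "A \<in> carrier_mat m (n1 + n2)" and b: "b \<in> carrier_vec m"
    and pair: "tls_eigenpair (mtls_weight n1 n2) A b \<mu> x"
    and pd: "\<And>y. y \<in> carrier_vec (n1 + n2) \<Longrightarrow> y \<noteq> 0\<^sub>v (n1 + n2) \<Longrightarrow> 0 < tls_form (mtls_weight n1 n2) A \<mu> y"
  shows "mtls_solution n1 n2 A b y \<longleftrightarrow> y = x"
proof -
  let ?W = "mtls_weight n1 n2"
  have x: "x \<in> carrier_vec (n1 + n2)" using pair A by (simp add: tls_eigenpair_def)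
  have pos: "0 < 1 + y \<bullet> (?W *\<^sub>v y)" if "y \<in> carrier_vec (n1 + n2)" for y
    using sym_psdD(3)[OF mtls_weight_psd that] by simp
  have square: "(A *\<^sub>v y - b) \<bullet> (A *\<^sub>v y - b) = \<mu> * (1 + y \<bullet> (?W *\<^sub>v y)) + tls_form ?W A \<mu> (y - x)"
    if "y \<in> carrier_vec (n1 + n2)" for y
    using tls_completing_square[OF A b mtls_weight_psd pair that] by linarith
  have lower: "\<mu> \<le> (fnorm (E @\<^sub>c mat_of_col f))\<^sup>2" if F: "mtls_feasible n1 n2 A b E f y" for E f y
  proof -
    have y: "y \<in> carrier_vec (n1 + n2)" using F by (simp add: mtls_feasible_def)
    have "0 \<le> tls_form ?W A \<mu> (y - x)"
    proof (cases "y - x = 0\<^sub>v (n1 + n2)")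
      case True
      have "A *\<^sub>v 0\<^sub>v (n1 + n2) = 0\<^sub>v m" "?W *\<^sub>v 0\<^sub>v (n1 + n2) = 0\<^sub>v (n1 + n2)"
        by (rule eq_vecI; use A mtls_weight_carrier[of n1 n2] in simp)+
      then show ?thesis unfolding True by (simp add: tls_form_def)
    next
      case False
      then show ?thesis by (rule less_imp_le[OF pd[OF minus_carrier_vec[OF y x]]])
    qed
    then have "\<mu> * (1 + y \<bullet> (?W *\<^sub>v y)) \<le> (fnorm (E @\<^sub>c mat_of_col f))\<^sup>2 * (1 + y \<bullet> (?W *\<^sub>v y))"
      using mtls_feasible_lower_bound[OF A b F] square[OF y] by linarith
    then show ?thesis by (rule mult_right_le_imp_le[OF _ pos[OF y]])
  qed
  obtain E f where F: "mtls_feasible n1 n2 A b E f x"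
    and "(fnorm (E @\<^sub>c mat_of_col f))\<^sup>2 * (1 + x \<bullet> (?W *\<^sub>v x)) = (A *\<^sub>v x - b) \<bullet> (A *\<^sub>v x - b)"
    using mtls_feasible_attained[OF A b x] by blast
  moreover have "(A *\<^sub>v x - b) \<bullet> (A *\<^sub>v x - b) = \<mu> * (1 + x \<bullet> (?W *\<^sub>v x))"
    using pair unfolding tls_eigenpair_def by blast
  ultimately have opt: "(fnorm (E @\<^sub>c mat_of_col f))\<^sup>2 = \<mu>"
    using pos[OF x] by (metis less_irrefl mult_right_cancel)
  show ?thesis
  proof
    assume "mtls_solution n1 n2 A b y"
    then obtain E' f' where F': "mtls_feasible n1 n2 A b E' f' y"
      and "\<forall>E f x. mtls_feasible n1 n2 A b E f x \<longrightarrow> fnorm (E' @\<^sub>c mat_of_col f') \<le> fnorm (E @\<^sub>c mat_of_col f)"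
      unfolding mtls_solution_def by blast
    then have "fnorm (E' @\<^sub>c mat_of_col f') \<le> fnorm (E @\<^sub>c mat_of_col f)" using F by blast
    then have le: "(fnorm (E' @\<^sub>c mat_of_col f'))\<^sup>2 \<le> \<mu>"
      unfolding opt[symmetric] by (intro power_mono fnorm_ge_0)
    have y: "y \<in> carrier_vec (n1 + n2)" using F' by (simp add: mtls_feasible_def)
    have "(A *\<^sub>v y - b) \<bullet> (A *\<^sub>v y - b) \<le> (fnorm (E' @\<^sub>c mat_of_col f'))\<^sup>2 * (1 + y \<bullet> (?W *\<^sub>v y))"
      by (rule mtls_feasible_lower_bound[OF A b F'])
    also have "\<dots> \<le> \<mu> * (1 + y \<bullet> (?W *\<^sub>v y))"
      using pos[OF y] by (intro mult_right_mono le) simp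
    finally have "(A *\<^sub>v y - b) \<bullet> (A *\<^sub>v y - b) \<le> \<mu> * (1 + y \<bullet> (?W *\<^sub>v y))" .
    then have "\<not> 0 < tls_form ?W A \<mu> (y - x)" using square[OF y] by linarith
    then have 0: "y - x = 0\<^sub>v (n1 + n2)" using pd minus_carrier_vec[OF y x] by blast
    show "y = x"
    proof (rule eq_vecI)
      fix i assume "i < dim_vec x"
      then show "y $ i = x $ i" using arg_cong[OF 0, of "\<lambda>v. v $ i"] x y by simp
    qed (use x y in simp)
  next
    assume "y = x"
    have le: "fnorm (E @\<^sub>c mat_of_col f) \<le> fnorm (E' @\<^sub>c mat_of_col f')"
      if "mtls_feasible n1 n2 A b E' f' x'" for E' f' x'
    proof (rule power2_le_imp_le)
      show "(fnorm (E @\<^sub>c mat_of_col f))\<^sup>2 \<le> (fnorm (E' @\<^sub>c mat_of_col f'))\<^sup>2"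
        unfolding opt by (rule lower[OF that])
    qed (rule fnorm_ge_0)
    show "mtls_solution n1 n2 A b y"
      unfolding mtls_solution_def \<open>y = x\<close> using F le by (intro exI[of _ E] exI[of _ f] conjI allI impI)
  qed
qed

section \<open>QR factorization and the genericity conditions\<close>

lemma full_column_rank_injective:
  assumes A: "(A :: real mat) \<in> carrier_mat m n" and rank: "vec_space.rank m A = n"
    and v: "v \<in> carrier_vec n" and Av: "A *\<^sub>v v = 0\<^sub>v m"
  shows "v = 0\<^sub>v n"
proof (rule ccontr)
  assume nz: "v \<noteq> 0\<^sub>v n"
  interpret vec_space "TYPE(real)" m .
  have dist: "distinct (cols A)"
  proof (rule ccontr)
    assume nd: "\<not> distinct (cols A)"
    \<comment> \<open>A repeated column would leave fewer than n candidates for an independent set.\<close>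
    obtain S where S: "maximal S (\<lambda>T. T \<subseteq> set (cols A) \<and> lin_indpt T)"
      using maximal_exists[of "\<lambda>T. T \<subseteq> set (cols A) \<and> lin_indpt T" "card (set (cols A))" "{}"]
      by (meson List.finite_set card_mono empty_iff empty_subsetI finite_lin_indpt2 rev_finite_subset)
    have "card S \<le> card (set (cols A))" using S by (simp add: card_mono maximal_def)
    also have "\<dots> < length (cols A)" using nd card_distinct[of "cols A"] card_length[of "cols A"] by linarith
    also have "\<dots> = n" using A by simp
    finally show False using rank_card_indpt[OF A S] rank by simp
  qed
  show False using lin_depI[OF A v nz Av dist] full_rank_lin_indpt[OF A rank dist] by blast
qed

lemma orthonormal_preserves_scalar:
  assumes Q: "Q \<in> carrier_mat m m" "orthonormal_mat Q" and v: "v \<in> carrier_vec m"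
  shows "(transpose_mat Q *\<^sub>v v) \<bullet> (transpose_mat Q *\<^sub>v v) = v \<bullet> v"
proof -
  note [simp] = carrier_matD[OF Q(1)] carrier_vecD[OF v]
  have "Q * transpose_mat Q = 1\<^sub>m m" using Q by (simp add: orthonormal_mat_def inverts_mat_def)
  then have "Q *\<^sub>v (transpose_mat Q *\<^sub>v v) = v" using v by (simp add: mult_mult_vec[symmetric])
  then show ?thesis by (simp add: transpose_scalar)
qed

lemma vec_split_append:
  assumes "y \<in> carrier_vec (n1 + n2)"
  obtains u v where "u \<in> carrier_vec n1" "v \<in> carrier_vec n2" "y = u @\<^sub>v (v :: real vec)"
  using vec_first_last_append[OF assms] by (metis vec_first_carrier vec_last_carrier)

locale mtls_qr =
  fixes m n1 n2 :: nat and A Q R11 R12 R1b R22 R2b :: "real mat" and b :: "real vec"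
  assumes A: "A \<in> carrier_mat m (n1 + n2)" and b: "b \<in> carrier_vec m"
    and injective: "v \<in> carrier_vec (n1 + n2) \<Longrightarrow> A *\<^sub>v v = 0\<^sub>v m \<Longrightarrow> v = 0\<^sub>v (n1 + n2)"
    and Q: "Q \<in> carrier_mat m m" "orthonormal_mat Q"
    and R: "R11 \<in> carrier_mat n1 n1" "R12 \<in> carrier_mat n1 n2" "R1b \<in> carrier_mat n1 1"
      "R22 \<in> carrier_mat (m - n1) n2" "R2b \<in> carrier_mat (m - n1) 1"
    and QR: "transpose_mat Q * (A @\<^sub>c mat_of_col b) =
      four_block_mat R11 (R12 @\<^sub>c R1b) (0\<^sub>m (m - n1) n1) (R22 @\<^sub>c R2b)"
begin

abbreviation "W \<equiv> mtls_weight n1 n2"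

definition "\<sigma> = sing_val (n2 + 1) (R22 @\<^sub>c R2b)"

lemma trailing_carrier: "R12 @\<^sub>c R1b \<in> carrier_mat n1 (n2 + 1)" "R22 @\<^sub>c R2b \<in> carrier_mat (m - n1) (n2 + 1)"
  using append_cols_carrier R by blast+

text \<open>
  Multiplying by the orthogonal \<open>Q\<^sup>T\<close> splits the residual into a part that the exact columns can remove and the
  part governed by \<open>[R22, R2b]\<close>.
\<close>

lemma residual_split:
  assumes u: "u \<in> carrier_vec n1" and v: "v \<in> carrier_vec n2" and z_def: "z = v @\<^sub>v vec 1 (\<lambda>_. \<tau>)"
  shows "(A *\<^sub>v (u @\<^sub>v v) + \<tau> \<cdot>\<^sub>v b) \<bullet> (A *\<^sub>v (u @\<^sub>v v) + \<tau> \<cdot>\<^sub>v b) =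
    (R11 *\<^sub>v u + (R12 @\<^sub>c R1b) *\<^sub>v z) \<bullet> (R11 *\<^sub>v u + (R12 @\<^sub>c R1b) *\<^sub>v z) +
    ((R22 @\<^sub>c R2b) *\<^sub>v z) \<bullet> ((R22 @\<^sub>c R2b) *\<^sub>v z)"
proof -
  define A' where "A' = A @\<^sub>c mat_of_col b"
  have uv: "u @\<^sub>v v \<in> carrier_vec (n1 + n2)" using u v by (rule append_carrier_vec)
  have z: "z \<in> carrier_vec (n2 + 1)" unfolding z_def using v vec_carrier by (rule append_carrier_vec)
  have w: "u @\<^sub>v z \<in> carrier_vec (n1 + (n2 + 1))" using u z by (rule append_carrier_vec)
  have A': "A' \<in> carrier_mat m (n1 + n2 + 1)"
    unfolding A'_def using A mat_of_col_carrier[OF b] by (rule append_cols_carrier)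
  have assoc: "(u @\<^sub>v v) @\<^sub>v vec 1 (\<lambda>_. \<tau>) = u @\<^sub>v z"
    unfolding z_def by (rule eq_vecI) auto
  have eq: "A *\<^sub>v (u @\<^sub>v v) + \<tau> \<cdot>\<^sub>v b = A' *\<^sub>v (u @\<^sub>v z)"
    using augmented_forms(1)[OF A b mtls_weight_psd refl uv, of \<tau>] unfolding assoc A'_def by simp
  have A'w: "A' *\<^sub>v (u @\<^sub>v z) \<in> carrier_vec m" using A' w by (metis add.assoc mult_mat_vec_carrier)
  have "transpose_mat Q *\<^sub>v (A' *\<^sub>v (u @\<^sub>v z)) = (transpose_mat Q * A') *\<^sub>v (u @\<^sub>v z)"
    using carrier_matD[OF Q(1)] carrier_matD[OF A'] carrier_vecD[OF w] by (simp add: mult_mult_vec)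
  also have "\<dots> = (R11 *\<^sub>v u + (R12 @\<^sub>c R1b) *\<^sub>v z) @\<^sub>v (0\<^sub>m (m - n1) n1 *\<^sub>v u + (R22 @\<^sub>c R2b) *\<^sub>v z)"
    unfolding A'_def QR
    by (rule four_block_mat_mult_vec[OF R(1) trailing_carrier(1) zero_carrier_mat trailing_carrier(2) u z])
  also have "0\<^sub>m (m - n1) n1 *\<^sub>v u + (R22 @\<^sub>c R2b) *\<^sub>v z = (R22 @\<^sub>c R2b) *\<^sub>v z"
    using u carrier_matD[OF trailing_carrier(2)] by (intro eq_vecI) auto
  finally have split: "transpose_mat Q *\<^sub>v (A' *\<^sub>v (u @\<^sub>v z)) =
    (R11 *\<^sub>v u + (R12 @\<^sub>c R1b) *\<^sub>v z) @\<^sub>v ((R22 @\<^sub>c R2b) *\<^sub>v z)" .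
  have 1: "R11 *\<^sub>v u + (R12 @\<^sub>c R1b) *\<^sub>v z \<in> carrier_vec n1"
    using mult_mat_vec_carrier[OF R(1) u] mult_mat_vec_carrier[OF trailing_carrier(1) z] by (rule add_carrier_vec)
  note 2 = mult_mat_vec_carrier[OF trailing_carrier(2) z]
  show ?thesis
    unfolding eq orthonormal_preserves_scalar[OF Q A'w, symmetric] split
    by (rule scalar_prod_append[OF 1 2 1 2])
qed

lemma weight_split:
  assumes "u \<in> carrier_vec n1" "v \<in> carrier_vec n2"
  shows "(u @\<^sub>v v) \<bullet> (W *\<^sub>v (u @\<^sub>v v)) + \<tau>\<^sup>2 = (v @\<^sub>v vec 1 (\<lambda>_. \<tau>)) \<bullet> (v @\<^sub>v vec 1 (\<lambda>_. \<tau>))"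
proof -
  have "(v @\<^sub>v vec 1 (\<lambda>_. \<tau>)) \<bullet> (v @\<^sub>v vec 1 (\<lambda>_. \<tau>)) = v \<bullet> v + vec 1 (\<lambda>_. \<tau>) \<bullet> vec 1 (\<lambda>_. \<tau>)"
    by (rule scalar_prod_append[of _ n2 _ 1]) (use assms in auto)
  then show ?thesis
    by (simp add: mtls_weight_form(2)[OF assms] scalar_prod_def[of "vec _ _"] power2_eq_square)
qed

text \<open>
  The orthogonal factor preserves lengths, so \<open>|R11 u|\<close> is the length of \<open>A [u, 0]\<close>.
\<close>

lemma R11_injective:
  assumes u: "u \<in> carrier_vec n1" and 0: "R11 *\<^sub>v u = 0\<^sub>v n1"
  shows "u = 0\<^sub>v n1"
proof -
  have uv: "u @\<^sub>v 0\<^sub>v n2 \<in> carrier_vec (n1 + n2)" using u zero_carrier_vec by (rule append_carrier_vec)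
  have z: "0\<^sub>v n2 @\<^sub>v vec 1 (\<lambda>_. 0) = (0\<^sub>v (n2 + 1) :: real vec)" by (rule eq_vecI) auto
  have zero: "(R12 @\<^sub>c R1b) *\<^sub>v 0\<^sub>v (n2 + 1) = 0\<^sub>v n1" "(R22 @\<^sub>c R2b) *\<^sub>v 0\<^sub>v (n2 + 1) = 0\<^sub>v (m - n1)"
    by (rule eq_vecI; use carrier_matD[OF trailing_carrier(1)] carrier_matD[OF trailing_carrier(2)] in \<open>simp add: scalar_prod_def\<close>)+
  define w where "w = A *\<^sub>v (u @\<^sub>v 0\<^sub>v n2) + 0 \<cdot>\<^sub>v b"
  have wA: "w = A *\<^sub>v (u @\<^sub>v 0\<^sub>v n2)" unfolding w_def using A b by (intro eq_vecI) auto
  have "w \<bullet> w = 0" using residual_split[OF u zero_carrier_vec refl, of 0] unfolding w_def[symmetric] z zero 0 by simp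
  then have "A *\<^sub>v (u @\<^sub>v 0\<^sub>v n2) = 0\<^sub>v m" using scalar_self_eq_0[of w] A by (simp add: wA)
  from injective[OF uv this] have eq: "u @\<^sub>v 0\<^sub>v n2 = 0\<^sub>v (n1 + n2)" .
  show ?thesis
  proof (rule eq_vecI)
    fix i assume "i < dim_vec (0\<^sub>v n1 :: real vec)"
    then show "u $ i = 0\<^sub>v n1 $ i" using arg_cong[OF eq, of "\<lambda>v. v $ i"] u by simp
  qed (use u in simp)
qed

text \<open>
  For the lower bound drop the first part of \<open>residual_split\<close>.  For the minimizer, take a last right
  singular vector of \<open>[R22, R2b]\<close> for the trailing components and choose the leading ones so that the first part
  vanishes, which the invertibility of \<open>R11\<close> permits.
\<close>

lemma smallest: "tls_smallest W A b (\<sigma>\<^sup>2)"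
  unfolding tls_smallest_def carrier_matD(2)[OF A]
proof (intro conjI ballI allI)
  fix y :: "real vec" and \<tau> :: real assume "y \<in> carrier_vec (n1 + n2)"
  then obtain u v where u: "u \<in> carrier_vec n1" and v: "v \<in> carrier_vec n2" and y: "y = u @\<^sub>v v"
    by (rule vec_split_append)
  have z: "v @\<^sub>v vec 1 (\<lambda>_. \<tau>) \<in> carrier_vec (n2 + 1)" using v vec_carrier by (rule append_carrier_vec)
  have pos: "0 < n2 + 1" by simp
  show "\<sigma>\<^sup>2 * (y \<bullet> (W *\<^sub>v y) + \<tau>\<^sup>2) \<le> (A *\<^sub>v y + \<tau> \<cdot>\<^sub>v b) \<bullet> (A *\<^sub>v y + \<tau> \<cdot>\<^sub>v b)"
    unfolding y weight_split[OF u v] residual_split[OF u v refl] \<sigma>_def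
    using sing_val_last(2)[OF trailing_carrier(2) pos z] scalar_self_ge_0[of "R11 *\<^sub>v u + (R12 @\<^sub>c R1b) *\<^sub>v (v @\<^sub>v vec 1 (\<lambda>_. \<tau>))"]
    by linarith
next
  obtain z where z: "z \<in> carrier_vec (n2 + 1)" "z \<noteq> 0\<^sub>v (n2 + 1)"
    and eq: "((R22 @\<^sub>c R2b) *\<^sub>v z) \<bullet> ((R22 @\<^sub>c R2b) *\<^sub>v z) = \<sigma>\<^sup>2 * (z \<bullet> z)"
    using sing_val_last(3)[OF trailing_carrier(2)] unfolding \<sigma>_def by auto
  obtain v \<tau> where v: "v \<in> carrier_vec n2" and zv: "z = v @\<^sub>v vec 1 (\<lambda>_. \<tau>)" using z(1) by (rule vec_Suc_split)
  obtain C where C: "C \<in> carrier_mat n1 n1" "R11 * C = 1\<^sub>m n1"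
    using injective_imp_inverse[OF R(1) R11_injective] by blast
  define s where "s = (R12 @\<^sub>c R1b) *\<^sub>v z"
  have s: "s \<in> carrier_vec n1" unfolding s_def by (rule mult_mat_vec_carrier[OF trailing_carrier(1) z(1)])
  define u where "u = C *\<^sub>v ((-1) \<cdot>\<^sub>v s)"
  have u: "u \<in> carrier_vec n1" unfolding u_def using C s by simp
  have "R11 *\<^sub>v u = (-1) \<cdot>\<^sub>v s"
  proof -
    have "R11 *\<^sub>v u = (R11 * C) *\<^sub>v ((-1) \<cdot>\<^sub>v s)" unfolding u_def
      using carrier_matD[OF R(1)] carrier_matD[OF C(1)] carrier_vecD[OF s] by (simp add: mult_mult_vec)
    then show ?thesis using s C(2) by simp
  qed
  then have "R11 *\<^sub>v u + s = 0\<^sub>v n1" using s by (simp only:) (rule eq_vecI; simp)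
  then have "(A *\<^sub>v (u @\<^sub>v v) + \<tau> \<cdot>\<^sub>v b) \<bullet> (A *\<^sub>v (u @\<^sub>v v) + \<tau> \<cdot>\<^sub>v b) = \<sigma>\<^sup>2 * ((u @\<^sub>v v) \<bullet> (W *\<^sub>v (u @\<^sub>v v)) + \<tau>\<^sup>2)"
    unfolding weight_split[OF u v] residual_split[OF u v zv] zv[symmetric] s_def[symmetric] eq by simp
  moreover have "u @\<^sub>v v \<noteq> 0\<^sub>v (n1 + n2) \<or> \<tau> \<noteq> 0"
  proof (rule ccontr)
    assume "\<not> ?thesis"
    then have 0: "u @\<^sub>v v = 0\<^sub>v (n1 + n2)" "\<tau> = 0" by auto
    have "v $ i = 0" if "i < n2" for i
      using arg_cong[OF 0(1), of "\<lambda>w. w $ (n1 + i)"] that u v by simp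
    then have "z = 0\<^sub>v (n2 + 1)" unfolding zv 0(2) using v by (intro eq_vecI) auto
    then show False using z(2) by simp
  qed
  ultimately show "\<exists>y \<in> carrier_vec (n1 + n2). \<exists>\<tau>. (y \<noteq> 0\<^sub>v (n1 + n2) \<or> \<tau> \<noteq> 0) \<and>
    (A *\<^sub>v y + \<tau> \<cdot>\<^sub>v b) \<bullet> (A *\<^sub>v y + \<tau> \<cdot>\<^sub>v b) = \<sigma>\<^sup>2 * (y \<bullet> (W *\<^sub>v y) + \<tau>\<^sup>2)"
    using append_carrier_vec[OF u v] by blast
qed

lemma A_scalar_pos:
  assumes "y \<in> carrier_vec (n1 + n2)" "y \<noteq> 0\<^sub>v (n1 + n2)"
  shows "0 < (A *\<^sub>v y) \<bullet> (A *\<^sub>v y)"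
proof -
  have "A *\<^sub>v y \<noteq> 0\<^sub>v m" using injective assms by blast
  then show ?thesis using scalar_self_eq_0[of "A *\<^sub>v y"] scalar_self_ge_0[of "A *\<^sub>v y"] A by auto
qed

lemma form_pos_if_weight_dominated:
  assumes y: "y \<in> carrier_vec (n1 + n2)" "y \<noteq> 0\<^sub>v (n1 + n2)"
    and s: "\<sigma>\<^sup>2 < s" and dom: "s * (y \<bullet> (W *\<^sub>v y)) \<le> (A *\<^sub>v y) \<bullet> (A *\<^sub>v y)"
  shows "0 < tls_form W A (\<sigma>\<^sup>2) y"
proof (cases "y \<bullet> (W *\<^sub>v y) = 0")
  case True
  then show ?thesis using A_scalar_pos[OF y] by (simp add: tls_form_def)
next
  case False
  then have "0 < y \<bullet> (W *\<^sub>v y)" using sym_psdD(3)[OF mtls_weight_psd y(1)] by simp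
  then have "\<sigma>\<^sup>2 * (y \<bullet> (W *\<^sub>v y)) < s * (y \<bullet> (W *\<^sub>v y))" using s by simp
  then show ?thesis using dom by (simp add: tls_form_def)
qed

text \<open>
  The leading components only add to \<open>|A y|\<^sup>2\<close>, so \<open>\<sigma>\<^sub>n\<^sub>2(R22)\<^sup>2\<close> can serve as \<open>s\<close> in
  \<open>form_pos_if_weight_dominated\<close>.  For \<open>n2 = 0\<close> the weight is zero and the form is \<open>|A y|\<^sup>2\<close>.
\<close>

lemma form_pos_singular_values:
  assumes gen: "sing_val_ext n2 R22 > ereal \<sigma>" and \<sigma>0: "\<sigma> > 0"
    and y: "y \<in> carrier_vec (n1 + n2)" "y \<noteq> 0\<^sub>v (n1 + n2)"
  shows "0 < tls_form W A (\<sigma>\<^sup>2) y"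
proof (cases "n2 = 0")
  case True
  then have "y \<bullet> (W *\<^sub>v y) = 0" using mtls_weight_form_last[OF y(1)] by (simp add: scalar_prod_def)
  then show ?thesis using A_scalar_pos[OF y] by (simp add: tls_form_def)
next
  case False
  define s where "s = sing_val n2 R22"
  have "\<sigma> < s" using gen False by (simp add: sing_val_ext_def s_def)
  then have less: "\<sigma>\<^sup>2 < s\<^sup>2" using \<sigma>0 by (intro power_strict_mono) auto
  obtain u v where u: "u \<in> carrier_vec n1" and v: "v \<in> carrier_vec n2" and yuv: "y = u @\<^sub>v v"
    using y(1) by (rule vec_split_append)
  have "(R22 @\<^sub>c R2b) *\<^sub>v (v @\<^sub>v vec 1 (\<lambda>_. 0)) = R22 *\<^sub>v v + R2b *\<^sub>v vec 1 (\<lambda>_. 0)"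
    by (rule append_cols_mult_vec[OF R(4,5) v vec_carrier])
  also have "\<dots> = R22 *\<^sub>v v" using R(4,5) by (intro eq_vecI) (auto simp: scalar_prod_def[of _ "vec _ _"])
  finally have R22: "(R22 @\<^sub>c R2b) *\<^sub>v (v @\<^sub>v vec 1 (\<lambda>_. 0)) = R22 *\<^sub>v v" .
  have "A *\<^sub>v y + 0 \<cdot>\<^sub>v b = A *\<^sub>v y" using A b by (intro eq_vecI) auto
  then have "(R22 *\<^sub>v v) \<bullet> (R22 *\<^sub>v v) \<le> (A *\<^sub>v y) \<bullet> (A *\<^sub>v y)"
    using residual_split[OF u v refl, of 0] scalar_self_ge_0 unfolding yuv R22 by simp
  moreover have "s\<^sup>2 * (v \<bullet> v) \<le> (R22 *\<^sub>v v) \<bullet> (R22 *\<^sub>v v)"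
    unfolding s_def using sing_val_last(2)[OF R(4) _ v] False by simp
  ultimately show ?thesis
    by (intro form_pos_if_weight_dominated[OF y less]) (simp add: yuv mtls_weight_form(2)[OF u v])
qed

text \<open>
  The last generalized eigenvalue \<open>t\<close> of the augmented pair is at least \<open>\<sigma>\<^sup>2\<close>, since \<open>\<sigma>\<^sup>2\<close> is a lower bound
  of the same quotient.  So the last generalized eigenvalue of \<open>(A\<^sup>T A, W)\<close> is a number \<open>s > \<sigma>\<^sup>2\<close>, or it is
  infinite and the form of \<open>W\<close> is zero.
\<close>

lemma form_pos_generalized_eigenvalues:
  assumes inconsistent: "\<not> (\<exists>x \<in> carrier_vec (n1 + n2). A *\<^sub>v x = b)"
    and A': "A' = A @\<^sub>c mat_of_col b" and W': "W' = diag_block_mat [W, 1\<^sub>m 1]"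
    and gen: "gen_eigval (n1 + n2) (transpose_mat A * A) W > gen_eigval (n1 + n2 + 1) (transpose_mat A' * A') W'"
    and y: "y \<in> carrier_vec (n1 + n2)" "y \<noteq> 0\<^sub>v (n1 + n2)"
  shows "0 < tls_form W A (\<sigma>\<^sup>2) y"
proof -
  let ?n = "n1 + n2"
  note forms = augmented_forms[OF A b mtls_weight_psd W']
  have A'c: "A' \<in> carrier_mat m (?n + 1)"
    unfolding A' using A mat_of_col_carrier[OF b] by (rule append_cols_carrier)
  have A'_inj: "z = 0\<^sub>v (?n + 1)" if z: "z \<in> carrier_vec (?n + 1)" and 0: "(A' *\<^sub>v z) \<bullet> (A' *\<^sub>v z) = 0" for z
  proof -
    obtain x \<tau> where x: "x \<in> carrier_vec ?n" and zx: "z = x @\<^sub>v vec 1 (\<lambda>_. \<tau>)" using z by (rule vec_Suc_split)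
    have zero: "A *\<^sub>v x + \<tau> \<cdot>\<^sub>v b = 0\<^sub>v m"
      using 0 scalar_self_eq_0[of "A *\<^sub>v x + \<tau> \<cdot>\<^sub>v b"] A b unfolding A' zx forms(1)[OF x] by simp
    have comp: "(A *\<^sub>v x) $ i + \<tau> * b $ i = 0" if "i < m" for i
      using arg_cong[OF zero, of "\<lambda>v. v $ i"] that A b by simp
    \<comment> \<open>Otherwise b would be a combination of the columns of A.\<close>
    have \<tau>: "\<tau> = 0"
    proof (rule ccontr)
      assume \<tau>: "\<tau> \<noteq> 0"
      have "A *\<^sub>v ((- 1 / \<tau>) \<cdot>\<^sub>v x) = (- 1 / \<tau>) \<cdot>\<^sub>v (A *\<^sub>v x)" using A x by (intro mult_vec_smult) simp
      also have "\<dots> = b"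
      proof (rule eq_vecI)
        fix i assume i: "i < dim_vec b"
        then have "(A *\<^sub>v x) $ i = - \<tau> * b $ i" using comp[of i] b by simp
        then show "((- 1 / \<tau>) \<cdot>\<^sub>v (A *\<^sub>v x)) $ i = b $ i" using i \<tau> A b by (simp del: index_mult_mat_vec)
      qed (use A b in simp)
      finally show False using inconsistent x by auto
    qed
    have "A *\<^sub>v x = 0\<^sub>v m" using comp \<tau> A by (intro eq_vecI) auto
    then have "x = 0\<^sub>v ?n" using injective x by blast
    then show ?thesis unfolding zx \<tau> by (intro eq_vecI) auto
  qed
  note G = gram_psd[OF A'c] and G0 = gram_psd[OF A]
  have D': "definite_pencil (?n + 1) (transpose_mat A' * A') W'"
    unfolding definite_pencil_def using G augmented_weight_psd[OF mtls_weight_psd W'] A'_inj by metis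
  have D: "definite_pencil ?n (transpose_mat A * A) W"
    unfolding definite_pencil_def using G0 mtls_weight_psd A_scalar_pos by (metis less_irrefl)
  have "0\<^sub>v ?n @\<^sub>v vec 1 (\<lambda>_. 1) \<in> carrier_vec (?n + 1)" using zero_carrier_vec vec_carrier by (rule append_carrier_vec)
  moreover have "(0\<^sub>v ?n @\<^sub>v vec 1 (\<lambda>_. 1)) \<bullet> (W' *\<^sub>v (0\<^sub>v ?n @\<^sub>v vec 1 (\<lambda>_. 1))) \<noteq> 0"
    unfolding forms(2)[OF zero_carrier_vec] using sym_psdD(3)[OF mtls_weight_psd zero_carrier_vec, of n1 n2] by simp
  ultimately obtain t z where t: "gen_eigval (?n + 1) (transpose_mat A' * A') W' = ereal t"
    and z: "z \<in> carrier_vec (?n + 1)" "z \<noteq> 0\<^sub>v (?n + 1)" "(A' *\<^sub>v z) \<bullet> (A' *\<^sub>v z) = t * (z \<bullet> (W' *\<^sub>v z))"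
    using gen_eigval_last[OF D'] G(2) by (metis add_gr_0 less_one)
  have "\<sigma>\<^sup>2 \<le> t"
  proof -
    have "z \<bullet> (W' *\<^sub>v z) \<noteq> 0" using A'_inj[OF z(1)] z(2,3) by auto
    then have "0 < z \<bullet> (W' *\<^sub>v z)" using sym_psdD(3)[OF augmented_weight_psd[OF mtls_weight_psd W'] z(1)] by simp
    moreover have "\<sigma>\<^sup>2 * (z \<bullet> (W' *\<^sub>v z)) \<le> t * (z \<bullet> (W' *\<^sub>v z))"
      using smallest z(1) unfolding tls_smallest_augmented[OF A b mtls_weight_psd W' A'] z(3)[symmetric] by blast
    ultimately show ?thesis by simp
  qed
  have "0 < ?n"
  proof (rule ccontr)
    assume "\<not> 0 < ?n"
    then have "y = 0\<^sub>v ?n" using y(1) by (intro eq_vecI) auto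
    then show False using y(2) by simp
  qed
  from gen_eigval_last[OF D this] show ?thesis
  proof (elim disjE exE conjE)
    fix s assume "gen_eigval ?n (transpose_mat A * A) W = ereal s"
      and s: "\<forall>z \<in> carrier_vec ?n. s * (z \<bullet> (W *\<^sub>v z)) \<le> z \<bullet> ((transpose_mat A * A) *\<^sub>v z)"
    then have "\<sigma>\<^sup>2 < s" using gen t \<open>\<sigma>\<^sup>2 \<le> t\<close> by simp
    then show ?thesis using form_pos_if_weight_dominated[OF y] s G0(2)[OF y(1)] y(1) by fastforce
  next
    assume "\<forall>z \<in> carrier_vec ?n. z \<bullet> (W *\<^sub>v z) = 0"
    then show ?thesis using A_scalar_pos[OF y] y(1) by (simp add: tls_form_def)
  qed
qed

end

section \<open>Vectorization, Kronecker products and the condition matrix\<close>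

lemma sum_div_mod:
  fixes f :: "nat \<Rightarrow> nat \<Rightarrow> real"
  shows "(\<Sum>k = 0..<q * m. f (k div m) (k mod m)) = (\<Sum>j = 0..<q. \<Sum>l = 0..<m. f j l)"
proof -
  have "(\<Sum>k<q * m. f (k div m) (k mod m)) = (\<Sum>j<q. \<Sum>k = j * m..<j * m + m. f (k div m) (k mod m))"
    by (rule sum.nat_group[symmetric])
  also have "\<dots> = (\<Sum>j<q. \<Sum>l = 0..<m. f j l)"
  proof (rule sum.cong[OF refl])
    fix j
    have "(\<Sum>k = j * m..<j * m + m. f (k div m) (k mod m)) = (\<Sum>l = 0..<m. f ((j * m + l) div m) ((j * m + l) mod m))"
      by (subst sum.atLeastLessThan_shift_0) (simp add: o_def)
    also have "\<dots> = (\<Sum>l = 0..<m. f j l)"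
      by (intro sum.cong) auto
    finally show "(\<Sum>k = j * m..<j * m + m. f (k div m) (k mod m)) = (\<Sum>l = 0..<m. f j l)" .
  qed
  finally show ?thesis by (simp add: lessThan_atLeast0)
qed

lemma kron_mult_mat_vec:
  assumes B: "B \<in> carrier_mat p q" and C: "C \<in> carrier_mat s m" and X: "X \<in> carrier_mat m q"
  shows "kron B C *\<^sub>v mat_vec X = mat_vec (C * X * transpose_mat B :: real mat)"
proof (rule eq_vecI)
  note [simp] = carrier_matD[OF B] carrier_matD[OF C] carrier_matD[OF X]
  show "dim_vec (kron B C *\<^sub>v mat_vec X) = dim_vec (mat_vec (C * X * transpose_mat B))"
    by (simp add: kron_def mat_vec_def)
  fix i assume "i < dim_vec (mat_vec (C * X * transpose_mat B))"
  then have i: "i < s * p" by (simp add: mat_vec_def)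
  then have "s \<noteq> 0" by (cases "s = 0") auto
  then have im: "i mod s < s" by simp
  have id: "i div s < p" using i by (simp add: less_mult_imp_div_less mult.commute)
  have "(kron B C *\<^sub>v mat_vec X) $ i =
      (\<Sum>k = 0..<q * m. B $$ (i div s, k div m) * C $$ (i mod s, k mod m) * X $$ (k mod m, k div m))"
    using i by (simp add: kron_def mat_vec_def scalar_prod_def mult.commute[of p s] mult.commute[of m q])
  also have "\<dots> = (\<Sum>j = 0..<q. \<Sum>l = 0..<m. B $$ (i div s, j) * C $$ (i mod s, l) * X $$ (l, j))"
    by (rule sum_div_mod)
  also have "\<dots> = (\<Sum>j = 0..<q. (\<Sum>l = 0..<m. C $$ (i mod s, l) * X $$ (l, j)) * B $$ (i div s, j))"
    unfolding sum_distrib_right by (intro sum.cong refl) simp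
  also have "\<dots> = (C * X * transpose_mat B) $$ (i mod s, i div s)"
    using im id by (simp add: scalar_prod_def)
  also have "\<dots> = mat_vec (C * X * transpose_mat B) $ i"
    using i by (simp add: mat_vec_def)
  finally show "(kron B C *\<^sub>v mat_vec X) $ i = mat_vec (C * X * transpose_mat B) $ i" .
qed

lemma kron_row_one_mult_mat_vec:
  assumes X: "X \<in> carrier_mat m k" and z: "z \<in> carrier_vec k"
  shows "kron (mat_of_row z) (1\<^sub>m m) *\<^sub>v mat_vec X = X *\<^sub>v (z :: real vec)"
proof -
  have Z: "mat_of_row z \<in> carrier_mat 1 k" using z by (auto simp: mat_of_row_def)
  show ?thesis
    unfolding kron_mult_mat_vec[OF Z one_carrier_mat X]
    using X z by (intro eq_vecI) (auto simp: mat_vec_def mat_of_row_def scalar_prod_def)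
qed

lemma kron_one_row_mult_mat_vec:
  assumes X: "X \<in> carrier_mat m k" and r: "r \<in> carrier_vec m"
  shows "kron (1\<^sub>m k) (mat_of_row r) *\<^sub>v mat_vec X = transpose_mat X *\<^sub>v (r :: real vec)"
proof -
  have Z: "mat_of_row r \<in> carrier_mat 1 m" using r by (auto simp: mat_of_row_def)
  show ?thesis
    unfolding kron_mult_mat_vec[OF one_carrier_mat Z X]
    using X r Z by (intro eq_vecI) (auto simp: mat_vec_def mat_of_row_def scalar_prod_def mult.commute)
qed

lemma mat_vec_append_col:
  assumes X: "X \<in> carrier_mat m k" and v: "v \<in> carrier_vec m"
  shows "mat_vec (X @\<^sub>c mat_of_col v) = mat_vec X @\<^sub>v (v :: real vec)"
proof (rule eq_vecI)
  note c = append_cols_carrier[OF X mat_of_col_carrier[OF v]]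
  note [simp] = carrier_matD[OF c] carrier_matD[OF X] carrier_vecD[OF v]
  show "dim_vec (mat_vec (X @\<^sub>c mat_of_col v)) = dim_vec (mat_vec X @\<^sub>v v)" by (simp add: mat_vec_def)
  fix i assume "i < dim_vec (mat_vec X @\<^sub>v v)"
  then have i: "i < m * (k + 1)" by (simp add: mat_vec_def)
  then have "m \<noteq> 0" by (cases "m = 0") auto
  then have im: "i mod m < m" by simp
  have id: "i div m < k + 1" using i by (simp add: less_mult_imp_div_less mult.commute)
  have eq: "mat_vec (X @\<^sub>c mat_of_col v) $ i = (if i div m < k then X $$ (i mod m, i div m) else v $ (i mod m))"
  proof -
    have "mat_vec (X @\<^sub>c mat_of_col v) $ i = (X @\<^sub>c mat_of_col v) $$ (i mod m, i div m)" using i by (simp add: mat_vec_def)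
    then show ?thesis
      unfolding append_cols_index[OF X mat_of_col_carrier[OF v] im id]
      using id im by (auto simp: mat_of_col_def mat_of_cols_def less_Suc_eq)
  qed
  show "mat_vec (X @\<^sub>c mat_of_col v) $ i = (mat_vec X @\<^sub>v v) $ i"
  proof (cases "i < m * k")
    case True
    then have "i div m < k" by (simp add: less_mult_imp_div_less mult.commute)
    then show ?thesis using True unfolding eq by (simp add: mat_vec_def)
  next
    case False
    then obtain l where l: "i = m * k + l" by (metis le_add_diff_inverse not_less)
    then have "l < m" using i by simp
    then have "i div m = k" "i mod m = l" using l by auto
    then show ?thesis using l \<open>l < m\<close> unfolding eq by (simp add: mat_vec_def)
  qed
qed

lemma left_cols_append_col:
  assumes X: "X \<in> carrier_mat m k" and v: "v \<in> carrier_vec m"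
  shows "left_cols k (X @\<^sub>c mat_of_col v) = X" and "col (X @\<^sub>c mat_of_col v) k = (v :: real vec)"
proof -
  note V = mat_of_col_carrier[OF v]
  note c = append_cols_carrier[OF X V]
  note idx = append_cols_index[OF X V]
  show "left_cols k (X @\<^sub>c mat_of_col v) = X"
  proof (rule eq_matI)
    fix i j assume "i < dim_row X" "j < dim_col X"
    then have ij: "i < m" "j < k" using X by auto
    then show "left_cols k (X @\<^sub>c mat_of_col v) $$ (i, j) = X $$ (i, j)"
      using carrier_matD[OF c] idx[OF ij(1), of j] by (simp add: left_cols_def mat_of_cols_def)
  qed (use left_right_cols(1)[OF c] X in auto)
  show "col (X @\<^sub>c mat_of_col v) k = v"
  proof (rule eq_vecI)
    fix i assume "i < dim_vec v"
    then have i: "i < m" using v by simp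
    show "col (X @\<^sub>c mat_of_col v) k $ i = v $ i"
      using carrier_matD[OF c] idx[OF i, of k] i v by (simp add: mat_of_col_def mat_of_cols_def)
  qed (use carrier_matD[OF c] v in simp)
qed

lemma append_col_decomposition:
  assumes D: "D \<in> carrier_mat m (k + 1)"
  obtains X v where "X \<in> carrier_mat m k" "v \<in> carrier_vec m" "D = X @\<^sub>c mat_of_col (v :: real vec)"
proof
  note LR = left_right_cols[OF D]
  have v: "col D k \<in> carrier_vec m" using D by (auto simp: col_def)
  show "left_cols k D \<in> carrier_mat m k" by (rule LR(1))
  show "col D k \<in> carrier_vec m" by (rule v)
  have "right_cols k D = mat_of_col (col D k)"
  proof (rule eq_matI)
    fix i j assume "i < dim_row (mat_of_col (col D k))" "j < dim_col (mat_of_col (col D k))"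
    then have "i < m" "j = 0" using carrier_matD[OF mat_of_col_carrier[OF v]] by auto
    then show "right_cols k D $$ (i, j) = mat_of_col (col D k) $$ (i, j)"
      using D by (simp add: right_cols_def mat_of_col_def mat_of_cols_def)
  qed (use carrier_matD[OF mat_of_col_carrier[OF v]] carrier_matD[OF LR(2)] in auto)
  then show "D = left_cols k D @\<^sub>c mat_of_col (col D k)" using LR(3) by simp
qed

lemma append_col_add:
  assumes "X \<in> carrier_mat m k" "v \<in> carrier_vec m" "Y \<in> carrier_mat m k" "w \<in> carrier_vec m"
  shows "(X @\<^sub>c mat_of_col v) + (Y @\<^sub>c mat_of_col w) = (X + Y) @\<^sub>c mat_of_col (v + (w :: real vec))"
proof -
  note V = mat_of_col_carrier[OF assms(2)] and W = mat_of_col_carrier[OF assms(4)]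
  have XY: "X + Y \<in> carrier_mat m k" using assms by auto
  have vw: "v + w \<in> carrier_vec m" using assms by auto
  note VW = mat_of_col_carrier[OF vw]
  note c = append_cols_carrier[OF assms(1) V] append_cols_carrier[OF assms(3) W] append_cols_carrier[OF XY VW]
  note [simp] = carrier_matD[OF c(1)] carrier_matD[OF c(2)] carrier_matD[OF c(3)]
  show ?thesis
  proof (rule eq_matI)
    fix i j
    assume "i < dim_row ((X + Y) @\<^sub>c mat_of_col (v + w))" "j < dim_col ((X + Y) @\<^sub>c mat_of_col (v + w))"
    then have ij: "i < m" "j < k + 1" by auto
    then have j: "\<not> j < k \<Longrightarrow> j - k = 0" by simp
    from ij show "((X @\<^sub>c mat_of_col v) + (Y @\<^sub>c mat_of_col w)) $$ (i, j) = ((X + Y) @\<^sub>c mat_of_col (v + w)) $$ (i, j)"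
      using assms j
      by (simp add: append_cols_index[OF assms(1) V ij] append_cols_index[OF assms(3) W ij] append_cols_index[OF XY VW ij])
        (auto simp: mat_of_col_def mat_of_cols_def)
  qed simp_all
qed

lemma rank_one_mult_vec:
  assumes r: "r \<in> carrier_vec m" and v: "v \<in> carrier_vec m"
  shows "(mat_of_col r * mat_of_row r) *\<^sub>v v = (r \<bullet> v) \<cdot>\<^sub>v (r :: real vec)"
proof -
  have R: "mat_of_row r \<in> carrier_mat 1 m" using r by (auto simp: mat_of_row_def)
  have "(mat_of_col r * mat_of_row r) *\<^sub>v v = mat_of_col r *\<^sub>v (mat_of_row r *\<^sub>v v)"
    by (rule assoc_mult_mat_vec[OF mat_of_col_carrier[OF r] R v])
  also have "\<dots> = (mat_of_row r *\<^sub>v v) $ 0 \<cdot>\<^sub>v r"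
    using R v by (intro mat_of_col_mult_vec) simp
  also have "(mat_of_row r *\<^sub>v v) $ 0 = r \<bullet> v" proof -
    have "row (mat_of_row r) 0 = r" using r by (intro eq_vecI) (auto simp: mat_of_row_def)
    then show ?thesis using R by simp
  qed
  finally show ?thesis .
qed

text \<open>
  Applying \<open>K\<close> to the vectorized perturbation produces the first-order solution \<open>h\<close> of \<open>solution_expansion\<close>.
  The reflection \<open>H0\<close> encodes the eigenvalue term: \<open>A\<^sup>T r = \<mu> W x\<close> and \<open>|r|\<^sup>2 = \<mu> D\<close> turn
  \<open>2 (r \<bullet> \<Delta>) / |r|\<^sup>2\<close> times \<open>A\<^sup>T r\<close> into \<open>2 (r \<bullet> \<Delta>) / D\<close> times \<open>W x\<close>.
\<close>

lemma (in tls_nominal) condition_matrix_solves: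
  assumes \<mu>0: "\<mu> \<noteq> 0"
    and P: "P = transpose_mat A * A - \<mu> \<cdot>\<^sub>m W"
    and Pinv: "Pinv \<in> carrier_mat n n" "P * Pinv = 1\<^sub>m n"
    and G_def: "G = kron (mat_of_row (x @\<^sub>v vec_of_list [-1])) (1\<^sub>m m)"
    and H0_def: "H0 = 1\<^sub>m m - (2 / (vnorm r)\<^sup>2) \<cdot>\<^sub>m (mat_of_col r * mat_of_row r)"
    and K_def: "K = - Pinv * (transpose_mat A * H0 * G + (kron (1\<^sub>m n) (mat_of_row r) @\<^sub>c 0\<^sub>m n m))"
    and E: "E \<in> carrier_mat m n" and e: "e \<in> carrier_vec m"
    and h: "h = K *\<^sub>v mat_vec (E @\<^sub>c mat_of_col e)"
  shows "K \<in> carrier_mat n (m * (n + 1))" and "h \<in> carrier_vec n"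
    and "transpose_mat A *\<^sub>v (A *\<^sub>v h) - \<mu> \<cdot>\<^sub>v (W *\<^sub>v h) =
      (2 * (r \<bullet> (E *\<^sub>v x - e)) / D) \<cdot>\<^sub>v (W *\<^sub>v x) - transpose_mat E *\<^sub>v r - transpose_mat A *\<^sub>v (E *\<^sub>v x - e)"
proof -
  note [simp] = carrier_matD[OF E] carrier_vecD[OF e] carrier_matD[OF Pinv(1)]
  define \<Delta> where "\<Delta> = E *\<^sub>v x - e"
  have \<Delta>: "\<Delta> \<in> carrier_vec m" by (auto simp: \<Delta>_def intro: carrier_vecI)
  have [simp]: "dim_vec \<Delta> = m" using \<Delta> by simp
  have r: "r \<in> carrier_vec m" by (rule carrier_vecI) simp
  have H0: "H0 \<in> carrier_mat m m" by (auto simp: H0_def mat_of_row_def mat_of_col_def mat_of_cols_def)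
  have G: "G \<in> carrier_mat m ((n + 1) * m)" by (auto simp: G_def kron_def mat_of_row_def)
  have k: "kron (1\<^sub>m n) (mat_of_row r) \<in> carrier_mat n (n * m)" by (auto simp: kron_def mat_of_row_def)
  have kz: "kron (1\<^sub>m n) (mat_of_row r) @\<^sub>c 0\<^sub>m n m \<in> carrier_mat n ((n + 1) * m)"
    using append_cols_carrier[OF k zero_carrier_mat[of n m]] by (simp add: add.commute)
  note [simp] = carrier_matD[OF H0] carrier_matD[OF G] carrier_matD[OF kz]
  have At: "transpose_mat A * H0 * G \<in> carrier_mat n ((n + 1) * m)" by (auto intro: carrier_matI)
  show Kc: "K \<in> carrier_mat n (m * (n + 1))" unfolding K_def by (rule carrier_matI) (simp_all add: mult.commute)
  define w where "w = mat_vec (E @\<^sub>c mat_of_col e)"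
  have wE: "w = mat_vec E @\<^sub>v e" unfolding w_def by (rule mat_vec_append_col[OF E e])
  have mE: "mat_vec E \<in> carrier_vec (n * m)" by (auto simp: mat_vec_def mult.commute)
  have w: "w \<in> carrier_vec ((n + 1) * m)"
    unfolding wE using append_carrier_vec[OF mE e] by (simp add: add.commute)
  have [simp]: "dim_vec w = (n + 1) * m" using w by simp
  have Gw: "G *\<^sub>v w = \<Delta>"
  proof -
    have l: "vec_of_list [-1] = vec 1 (\<lambda>_. -1 :: real)" by (rule eq_vecI) auto
    have z: "x @\<^sub>v vec 1 (\<lambda>_. -1) \<in> carrier_vec (n + 1)" using x vec_carrier by (rule append_carrier_vec)
    have "G *\<^sub>v w = (E @\<^sub>c mat_of_col e) *\<^sub>v (x @\<^sub>v vec 1 (\<lambda>_. -1))"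
      unfolding G_def w_def l by (rule kron_row_one_mult_mat_vec[OF append_cols_carrier[OF E mat_of_col_carrier[OF e]] z])
    also have "\<dots> = E *\<^sub>v x + mat_of_col e *\<^sub>v vec 1 (\<lambda>_. -1)"
      by (rule append_cols_mult_vec[OF E mat_of_col_carrier[OF e] x vec_carrier])
    also have "mat_of_col e *\<^sub>v vec 1 (\<lambda>_. -1) = (-1) \<cdot>\<^sub>v e" by (simp add: mat_of_col_mult_vec)
    also have "E *\<^sub>v x + (-1) \<cdot>\<^sub>v e = \<Delta>" unfolding \<Delta>_def by (rule eq_vecI) auto
    finally show ?thesis .
  qed
  have kw: "(kron (1\<^sub>m n) (mat_of_row r) @\<^sub>c 0\<^sub>m n m) *\<^sub>v w = transpose_mat E *\<^sub>v r"
  proof -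
    have "(kron (1\<^sub>m n) (mat_of_row r) @\<^sub>c 0\<^sub>m n m) *\<^sub>v w = kron (1\<^sub>m n) (mat_of_row r) *\<^sub>v mat_vec E + 0\<^sub>m n m *\<^sub>v e"
      unfolding wE by (rule append_cols_mult_vec[OF k zero_carrier_mat mE e])
    also have "kron (1\<^sub>m n) (mat_of_row r) *\<^sub>v mat_vec E = transpose_mat E *\<^sub>v r"
      by (rule kron_one_row_mult_mat_vec[OF E r])
    also have "0\<^sub>m n m *\<^sub>v e = 0\<^sub>v n" using e by (intro eq_vecI) auto
    finally show ?thesis by (simp add: right_zero_vec[of _ n] carrier_vecI)
  qed
  define t where "t = (transpose_mat A * H0 * G + (kron (1\<^sub>m n) (mat_of_row r) @\<^sub>c 0\<^sub>m n m)) *\<^sub>v w"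
  have t: "t \<in> carrier_vec n" unfolding t_def by (rule carrier_vecI) simp
  have h_t: "h = (-1) \<cdot>\<^sub>v (Pinv *\<^sub>v t)"
  proof -
    have "h = (- Pinv) *\<^sub>v t" unfolding h w_def[symmetric] K_def t_def by (rule mult_mult_vec) simp_all
    also have "\<dots> = (-1) \<cdot>\<^sub>v (Pinv *\<^sub>v t)" using t by (intro eq_vecI) auto
    finally show ?thesis .
  qed
  show hc: "h \<in> carrier_vec n" unfolding h_t by (rule carrier_vecI) simp
  note [simp] = carrier_vecD[OF hc] carrier_vecD[OF t]
  have PA: "P *\<^sub>v h = transpose_mat A *\<^sub>v (A *\<^sub>v h) - \<mu> \<cdot>\<^sub>v (W *\<^sub>v h)"
    unfolding P by (simp add: diff_mult_vec smult_mult_vec mult_mult_vec)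
  have [simp]: "dim_row P = n" "dim_col P = n" unfolding P by simp_all
  have "P *\<^sub>v h = (-1) \<cdot>\<^sub>v (P *\<^sub>v (Pinv *\<^sub>v t))" unfolding h_t by (rule mult_vec_smult) simp
  also have "P *\<^sub>v (Pinv *\<^sub>v t) = (P * Pinv) *\<^sub>v t" by (rule mult_mult_vec[symmetric]) simp_all
  also have "\<dots> = t" unfolding Pinv(2) using t by simp
  also have "t = transpose_mat A *\<^sub>v (H0 *\<^sub>v \<Delta>) + transpose_mat E *\<^sub>v r"
  proof -
    have "t = (transpose_mat A * H0 * G) *\<^sub>v w + (kron (1\<^sub>m n) (mat_of_row r) @\<^sub>c 0\<^sub>m n m) *\<^sub>v w"
      unfolding t_def by (rule add_mult_vec) simp_all
    also have "(transpose_mat A * H0 * G) *\<^sub>v w = (transpose_mat A * H0) *\<^sub>v (G *\<^sub>v w)" by (rule mult_mult_vec) simp_all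
    also have "\<dots> = transpose_mat A *\<^sub>v (H0 *\<^sub>v \<Delta>)" unfolding Gw by (rule mult_mult_vec) simp_all
    finally show ?thesis unfolding kw .
  qed
  also have "H0 *\<^sub>v \<Delta> = \<Delta> - (2 / (vnorm r)\<^sup>2) \<cdot>\<^sub>v ((r \<bullet> \<Delta>) \<cdot>\<^sub>v r)"
  proof -
    have "dim_col (mat_of_col r * mat_of_row r) = m" "dim_row (mat_of_col r * mat_of_row r) = m"
      by (simp_all add: mat_of_row_def mat_of_col_def mat_of_cols_def)
    then show ?thesis unfolding H0_def rank_one_mult_vec[OF r \<Delta>, symmetric]
      by (subst diff_mult_vec) (use \<Delta> in \<open>simp_all add: smult_mult_vec\<close>)
  qed
  also have "transpose_mat A *\<^sub>v (\<Delta> - (2 / (vnorm r)\<^sup>2) \<cdot>\<^sub>v ((r \<bullet> \<Delta>) \<cdot>\<^sub>v r)) =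
      transpose_mat A *\<^sub>v \<Delta> - (2 / (vnorm r)\<^sup>2) \<cdot>\<^sub>v ((r \<bullet> \<Delta>) \<cdot>\<^sub>v (\<mu> \<cdot>\<^sub>v (W *\<^sub>v x)))"
    by (simp add: mult_vec_diff mult_vec_smult normal_eq)
  also have "\<dots> = transpose_mat A *\<^sub>v \<Delta> - (2 * (r \<bullet> \<Delta>) / D) \<cdot>\<^sub>v (W *\<^sub>v x)"
    using \<mu>0 D_ge_1 by (simp add: vnorm_sq r_sq smult_smult_assoc)
  finally have "P *\<^sub>v h = (-1) \<cdot>\<^sub>v (transpose_mat A *\<^sub>v \<Delta> - (2 * (r \<bullet> \<Delta>) / D) \<cdot>\<^sub>v (W *\<^sub>v x) + transpose_mat E *\<^sub>v r)" .
  also have "\<dots> = (2 * (r \<bullet> \<Delta>) / D) \<cdot>\<^sub>v (W *\<^sub>v x) - transpose_mat E *\<^sub>v r - transpose_mat A *\<^sub>v \<Delta>"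
    by (rule eq_vecI) (simp_all del: index_mult_mat_vec)
  finally show "transpose_mat A *\<^sub>v (A *\<^sub>v h) - \<mu> \<cdot>\<^sub>v (W *\<^sub>v h) =
      (2 * (r \<bullet> (E *\<^sub>v x - e)) / D) \<cdot>\<^sub>v (W *\<^sub>v x) - transpose_mat E *\<^sub>v r - transpose_mat A *\<^sub>v (E *\<^sub>v x - e)"
    unfolding PA \<Delta>_def .
qed

section \<open>The perturbation theorem\<close>

theorem theorem1:
  fixes m n1 n2 n :: nat
    and A Q R11 R12 R1b R22 R2b W W' A' P H0 G K :: "real mat"
    and b xs r :: "real vec"
    and \<sigma> :: real
  assumes n: "n = n1 + n2" and mn: "n \<le> m"
    and A: "A \<in> carrier_mat m n" and b: "b \<in> carrier_vec m"
    and full_column_rank: "vec_space.rank m A = n"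
    and inconsistent: "\<not> (\<exists>x \<in> carrier_vec n. A *\<^sub>v x = b)"
    and A'_def: "A' = A @\<^sub>c mat_of_col b"
    and Q: "Q \<in> carrier_mat m m" "orthonormal_mat Q"
    and R: "R11 \<in> carrier_mat n1 n1" "R12 \<in> carrier_mat n1 n2" "R1b \<in> carrier_mat n1 1"
      "R22 \<in> carrier_mat (m - n1) n2" "R2b \<in> carrier_mat (m - n1) 1"
    and QR: "transpose_mat Q * A' =
      four_block_mat R11 (R12 @\<^sub>c R1b) (0\<^sub>m (m - n1) n1) (R22 @\<^sub>c R2b)"
      "upper_triangular_rect (transpose_mat Q * A')"
    and W_def: "W = diag_block_mat [0\<^sub>m n1 n1, 1\<^sub>m n2]"
    and W'_def: "W' = diag_block_mat [W, 1\<^sub>m 1]"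
    and \<sigma>_def: "\<sigma> = sing_val (n2 + 1) (R22 @\<^sub>c R2b)"
    and genericity:
      "(sing_val_ext n2 R22 > ereal \<sigma> \<and> \<sigma> > 0) \<or>
       gen_eigval n (transpose_mat A * A) W > gen_eigval (n + 1) (transpose_mat A' * A') W'"
    and xs_def: "xs = mtls_map n1 n2 A'"
    and r_def: "r = A *\<^sub>v xs - b"
    and G_def: "G = kron (mat_of_row (xs @\<^sub>v vec_of_list [-1])) (1\<^sub>m m)"
    and P_def: "P = transpose_mat A * A - \<sigma>\<^sup>2 \<cdot>\<^sub>m W"
    and H0_def: "H0 = 1\<^sub>m m - (2 / (vnorm r)\<^sup>2) \<cdot>\<^sub>m (mat_of_col r * mat_of_row r)"
    and K_def: "K = - (the (mat_inverse P)) *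
      (transpose_mat A * H0 * G + (kron (1\<^sub>m n) (mat_of_row r) @\<^sub>c 0\<^sub>m n m))"
  shows "(\<exists>!x. mtls_solution n1 n2 A b x) \<and> mtls_solution n1 n2 A b xs \<and> invertible_mat P \<and>
    (\<exists>\<delta>>0. \<exists>c. \<forall>\<Delta>A \<in> carrier_mat m n. \<forall>\<Delta>b \<in> carrier_vec m.
       fnorm (\<Delta>A @\<^sub>c mat_of_col \<Delta>b) < \<delta> \<longrightarrow>
         (\<exists>!x. mtls_solution n1 n2 (A + \<Delta>A) (b + \<Delta>b) x) \<and>
         (\<forall>x. mtls_solution n1 n2 (A + \<Delta>A) (b + \<Delta>b) x \<longrightarrow>
            vnorm (x - (xs + K *\<^sub>v mat_vec (\<Delta>A @\<^sub>c mat_of_col \<Delta>b)))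
              \<le> c * (fnorm (\<Delta>A @\<^sub>c mat_of_col \<Delta>b))\<^sup>2)) \<and>
    has_frechet_derivative_mat (mtls_map n1 n2) K A'"
proof -
  have An: "A \<in> carrier_mat m (n1 + n2)" using A n by simp
  have Wn: "W = mtls_weight n1 n2" by (simp only: W_def mtls_weight_def)
  have Wpsd: "sym_psd n W" using mtls_weight_psd[of n1 n2] n Wn by simp
  interpret qr: mtls_qr m n1 n2 A Q R11 R12 R1b R22 R2b b
    using An b full_column_rank_injective[OF A full_column_rank] n Q R QR(1) unfolding A'_def
    by unfold_locales auto
  have \<sigma>: "\<sigma> = qr.\<sigma>" by (simp only: \<sigma>_def qr.\<sigma>_def)
  have pd: "0 < tls_form W A (\<sigma>\<^sup>2) y" if y: "y \<in> carrier_vec n" "y \<noteq> 0\<^sub>v n" for y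
    using genericity
  proof
    assume "sing_val_ext n2 R22 > ereal \<sigma> \<and> \<sigma> > 0"
    then show ?thesis
      using qr.form_pos_singular_values[of y] y unfolding \<sigma> Wn n by blast
  next
    assume "gen_eigval n (transpose_mat A * A) W > gen_eigval (n + 1) (transpose_mat A' * A') W'"
    then show ?thesis
      using qr.form_pos_generalized_eigenvalues[OF _ A'_def W'_def[unfolded Wn], of y] inconsistent y
      unfolding \<sigma> Wn n by blast
  qed
  have small: "tls_smallest W A b (\<sigma>\<^sup>2)" using qr.smallest unfolding \<sigma> Wn .
  obtain x where pair: "tls_eigenpair W A b (\<sigma>\<^sup>2) x"
    using tls_eigenpair_exists[OF A b Wpsd small pd] by blast
  have solution: "mtls_solution n1 n2 A b y \<longleftrightarrow> y = x" for y
    using mtls_solution_iff_eigenpair[OF An b, of "\<sigma>\<^sup>2" x y] pair pd unfolding Wn n by blast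
  have map_value: "mtls_map n1 n2 (B @\<^sub>c mat_of_col v) = (THE x. mtls_solution n1 n2 B v x)"
    if "B \<in> carrier_mat m n" "v \<in> carrier_vec m" for B v
    using left_cols_append_col[OF that] by (simp add: mtls_map_def n)
  have xs: "xs = x"
    unfolding xs_def A'_def map_value[OF A b] solution by simp
  have xc: "x \<in> carrier_vec n" using pair A by (simp add: tls_eigenpair_def)
  note W_simps = sym_psdD(4,5)[OF Wpsd]
  have gram: "sym_psd n (transpose_mat A * A)" by (rule gram_psd(1)[OF A])
  have form: "y \<bullet> (P *\<^sub>v y) = tls_form W A (\<sigma>\<^sup>2) y" if y: "y \<in> carrier_vec n" for y
    unfolding P_def tls_form_def
    using carrier_matD[OF A] carrier_vecD[OF y] W_simps by (simp add: vec_linear)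
  have dominated: "\<forall>y \<in> carrier_vec n. \<sigma>\<^sup>2 * (y \<bullet> (W *\<^sub>v y)) \<le> y \<bullet> ((transpose_mat A * A) *\<^sub>v y)"
  proof
    fix y :: "real vec" assume y: "y \<in> carrier_vec n"
    have "A *\<^sub>v y + 0 \<cdot>\<^sub>v b = A *\<^sub>v y" using A b by (intro eq_vecI) auto
    moreover have "\<sigma>\<^sup>2 * (y \<bullet> (W *\<^sub>v y) + 0\<^sup>2) \<le> (A *\<^sub>v y + 0 \<cdot>\<^sub>v b) \<bullet> (A *\<^sub>v y + 0 \<cdot>\<^sub>v b)"
      using small y carrier_matD(2)[OF A] unfolding tls_smallest_def by blast
    ultimately show "\<sigma>\<^sup>2 * (y \<bullet> (W *\<^sub>v y)) \<le> y \<bullet> ((transpose_mat A * A) *\<^sub>v y)"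
      unfolding gram_psd(2)[OF A y] by simp
  qed
  have P_psd: "sym_psd n P" unfolding P_def by (rule sym_psd_diff(1)[OF gram Wpsd dominated])
  have P_inj: "y = 0\<^sub>v n" if y: "y \<in> carrier_vec n" and "P *\<^sub>v y = 0\<^sub>v n" for y
  proof (rule ccontr)
    assume "y \<noteq> 0\<^sub>v n"
    from pd[OF y this] show False using form[OF y] that(2) y by simp
  qed
  obtain c where c: "0 < c" "\<And>y. y \<in> carrier_vec n \<Longrightarrow> c * (y \<bullet> y) \<le> y \<bullet> (P *\<^sub>v y)"
    using psd_injective_coercive[OF P_psd P_inj] by blast
  interpret nom: tls_nominal m n A W b x "\<sigma>\<^sup>2" c
    using A b Wpsd pair c form by unfold_locales auto
  obtain Pinv where Pinv: "mat_inverse P = Some Pinv" "Pinv \<in> carrier_mat n n" "P * Pinv = 1\<^sub>m n" "Pinv * P = 1\<^sub>m n"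
    using injective_imp_inverse[OF sym_psdD(1)[OF P_psd] P_inj] by blast
  have invertible: "invertible_mat P"
    unfolding invertible_mat_def inverts_mat_def
    using Pinv sym_psdD(4,5)[OF P_psd] carrier_matD[OF Pinv(2)] by (intro conjI exI[of _ Pinv]) auto
  \<comment> \<open>The residual satisfies |r|^2 = \<sigma>^2 (1 + x \<bullet> W x), so \<sigma> = 0 would make the system consistent.\<close>
  have \<sigma>2: "\<sigma>\<^sup>2 \<noteq> 0"
  proof
    assume "\<sigma>\<^sup>2 = 0"
    then have "nom.r \<bullet> nom.r = 0" using nom.r_sq by simp
    then have "nom.r = 0\<^sub>v m" using scalar_self_eq_0[of nom.r] by simp
    then have "(A *\<^sub>v x - b) $ i = 0" if "i < m" for i using that by (simp add: nom.r_def)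
    then have "A *\<^sub>v x = b" using A b by (intro eq_vecI) auto
    then show False using inconsistent xc by blast
  qed
  have r: "r = nom.r" by (simp only: r_def xs nom.r_def)
  have K_eq: "K = - Pinv * (transpose_mat A * H0 * G + (kron (1\<^sub>m n) (mat_of_row nom.r) @\<^sub>c 0\<^sub>m n m))"
    unfolding K_def Pinv(1) r by simp
  note solves = nom.condition_matrix_solves[OF \<sigma>2 P_def Pinv(2,3) G_def[unfolded xs] H0_def[unfolded r] K_eq]
  obtain \<delta> C where \<delta>: "0 < \<delta>" and C: "0 \<le> C"
    and pert: "\<forall>E \<in> carrier_mat m n. \<forall>e \<in> carrier_vec m. \<forall>\<epsilon>. fnorm E \<le> \<epsilon> \<longrightarrow> vnorm e \<le> \<epsilon> \<longrightarrow> \<epsilon> < \<delta> \<longrightarrow>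
     (\<exists>\<nu> x'. tls_eigenpair W (A + E) (b + e) \<nu> x' \<and>
       (\<forall>y \<in> carrier_vec n. y \<noteq> 0\<^sub>v n \<longrightarrow> 0 < tls_form W (A + E) \<nu> y) \<and>
       (\<forall>h \<in> carrier_vec n.
         transpose_mat A *\<^sub>v (A *\<^sub>v h) - \<sigma>\<^sup>2 \<cdot>\<^sub>v (W *\<^sub>v h) =
           (2 * (nom.r \<bullet> (E *\<^sub>v x - e)) / nom.D) \<cdot>\<^sub>v (W *\<^sub>v x) - transpose_mat E *\<^sub>v nom.r - transpose_mat A *\<^sub>v (E *\<^sub>v x - e) \<longrightarrow>
         vnorm (x' - x - h) \<le> C * \<epsilon>\<^sup>2))"
    using nom.perturbation by blast
  have perturbed: "\<exists>x'. x' \<in> carrier_vec n \<and> (\<forall>y. mtls_solution n1 n2 (A + E) (b + e) y \<longleftrightarrow> y = x') \<and>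
      vnorm (x' - (x + K *\<^sub>v mat_vec (E @\<^sub>c mat_of_col e))) \<le> C * (fnorm (E @\<^sub>c mat_of_col e))\<^sup>2"
    if E: "E \<in> carrier_mat m n" and e: "e \<in> carrier_vec m" and small: "fnorm (E @\<^sub>c mat_of_col e) < \<delta>" for E e
  proof -
    define h where "h = K *\<^sub>v mat_vec (E @\<^sub>c mat_of_col e)"
    note h = solves(2,3)[OF E e h_def]
    obtain \<nu> x' where pair': "tls_eigenpair W (A + E) (b + e) \<nu> x'"
      and pd': "\<forall>y \<in> carrier_vec n. y \<noteq> 0\<^sub>v n \<longrightarrow> 0 < tls_form W (A + E) \<nu> y"
      and close: "vnorm (x' - x - h) \<le> C * (fnorm (E @\<^sub>c mat_of_col e))\<^sup>2"
      using pert[rule_format, OF E e fnorm_append_col_parts[OF E e] small] h by blast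
    have AE: "A + E \<in> carrier_mat m (n1 + n2)" and be: "b + e \<in> carrier_vec m"
      using An E b e n by auto
    have x': "x' \<in> carrier_vec n" using pair' unfolding tls_eigenpair_def carrier_matD(2)[OF AE] n by blast
    have "mtls_solution n1 n2 (A + E) (b + e) y \<longleftrightarrow> y = x'" for y
      using mtls_solution_iff_eigenpair[OF AE be, of \<nu> x' y] pair' pd' unfolding Wn n by blast
    moreover have "x' - (x + h) = x' - x - h" using x' xc h(1) by (intro eq_vecI) auto
    ultimately show ?thesis using close x' unfolding h_def by auto
  qed
  have expansion: "\<forall>\<Delta>A \<in> carrier_mat m n. \<forall>\<Delta>b \<in> carrier_vec m.
       fnorm (\<Delta>A @\<^sub>c mat_of_col \<Delta>b) < \<delta> \<longrightarrow>
         (\<exists>!x. mtls_solution n1 n2 (A + \<Delta>A) (b + \<Delta>b) x) \<and>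
         (\<forall>x. mtls_solution n1 n2 (A + \<Delta>A) (b + \<Delta>b) x \<longrightarrow>
            vnorm (x - (xs + K *\<^sub>v mat_vec (\<Delta>A @\<^sub>c mat_of_col \<Delta>b)))
              \<le> C * (fnorm (\<Delta>A @\<^sub>c mat_of_col \<Delta>b))\<^sup>2)"
  proof (intro ballI impI)
    fix E e assume "E \<in> carrier_mat m n" "e \<in> carrier_vec m" "fnorm (E @\<^sub>c mat_of_col e) < \<delta>"
    from perturbed[OF this] obtain x' where sol: "\<And>y. mtls_solution n1 n2 (A + E) (b + e) y \<longleftrightarrow> y = x'"
      and close: "vnorm (x' - (x + K *\<^sub>v mat_vec (E @\<^sub>c mat_of_col e))) \<le> C * (fnorm (E @\<^sub>c mat_of_col e))\<^sup>2"
      by blast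
    show "(\<exists>!x. mtls_solution n1 n2 (A + E) (b + e) x) \<and>
         (\<forall>x. mtls_solution n1 n2 (A + E) (b + e) x \<longrightarrow>
            vnorm (x - (xs + K *\<^sub>v mat_vec (E @\<^sub>c mat_of_col e))) \<le> C * (fnorm (E @\<^sub>c mat_of_col e))\<^sup>2)"
      unfolding sol xs using close by simp
  qed
  have Kc: "K \<in> carrier_mat n (m * (n + 1))"
    by (rule solves(1)[OF zero_carrier_mat zero_carrier_vec refl])
  have A'c: "A' \<in> carrier_mat m (n + 1)"
    unfolding A'_def by (rule append_cols_carrier[OF A mat_of_col_carrier[OF b]])
  have base: "mtls_map n1 n2 A' = x" using xs xs_def by simp
  have frechet: "has_frechet_derivative_mat (mtls_map n1 n2) K A'"
    unfolding has_frechet_derivative_mat_def base carrier_matD[OF A'c] carrier_vecD[OF xc]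
  proof (intro conjI allI impI)
    show "K \<in> carrier_mat n (m * (n + 1))" by (rule Kc)
    fix \<epsilon> :: real assume \<epsilon>: "0 < \<epsilon>"
    show "\<exists>\<delta>>0. \<forall>F \<in> carrier_mat m (n + 1). fnorm F < \<delta> \<longrightarrow>
        mtls_map n1 n2 (A' + F) \<in> carrier_vec n \<and>
        vnorm (mtls_map n1 n2 (A' + F) - x - K *\<^sub>v mat_vec F) \<le> \<epsilon> * fnorm F"
    \<comment> \<open>The remainder C |F|^2 is at most \<epsilon> |F| once (C + 1) |F| \<le> \<epsilon>; C itself may be 0.\<close>
    proof (intro exI[of _ "min \<delta> (\<epsilon> / (C + 1))"] conjI ballI impI)
      show "0 < min \<delta> (\<epsilon> / (C + 1))" using \<delta> C \<epsilon> by simp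
      fix F :: "real mat" assume "F \<in> carrier_mat m (n + 1)" and small: "fnorm F < min \<delta> (\<epsilon> / (C + 1))"
      then obtain E e where E: "E \<in> carrier_mat m n" and e: "e \<in> carrier_vec m" and F: "F = E @\<^sub>c mat_of_col e"
        by (elim append_col_decomposition)
      have "fnorm (E @\<^sub>c mat_of_col e) < \<delta>" using small F by simp
      from perturbed[OF E e this] obtain x' where x': "x' \<in> carrier_vec n"
        and sol: "\<And>y. mtls_solution n1 n2 (A + E) (b + e) y \<longleftrightarrow> y = x'"
        and close: "vnorm (x' - (x + K *\<^sub>v mat_vec F)) \<le> C * (fnorm F)\<^sup>2"
        unfolding F by blast
      have "mtls_map n1 n2 (A' + F) = (THE y. mtls_solution n1 n2 (A + E) (b + e) y)"
        unfolding A'_def F append_col_add[OF A b E e]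
        by (rule map_value) (use A E b e in auto)
      then have map: "mtls_map n1 n2 (A' + F) = x'" unfolding sol by simp
      show "mtls_map n1 n2 (A' + F) \<in> carrier_vec n" unfolding map by (rule x')
      have h: "K *\<^sub>v mat_vec F \<in> carrier_vec n" unfolding F by (rule solves(2)[OF E e refl])
      have "x' - x - K *\<^sub>v mat_vec F = x' - (x + K *\<^sub>v mat_vec F)"
        using x' xc carrier_matD(1)[OF Kc] by (intro eq_vecI) auto
      then have "vnorm (mtls_map n1 n2 (A' + F) - x - K *\<^sub>v mat_vec F) \<le> C * fnorm F * fnorm F"
        using close unfolding map by (simp add: power2_eq_square mult.assoc)
      also have "\<dots> \<le> \<epsilon> * fnorm F"
      proof (rule mult_right_mono[OF _ fnorm_ge_0])
        have "C * fnorm F \<le> (C + 1) * fnorm F" using fnorm_ge_0[of F] by (intro mult_right_mono) auto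
        also have "\<dots> \<le> (C + 1) * (\<epsilon> / (C + 1))" using small C by (intro mult_left_mono) auto
        also have "\<dots> = \<epsilon>" using C by simp
        finally show "C * fnorm F \<le> \<epsilon>" .
      qed
      finally show "vnorm (mtls_map n1 n2 (A' + F) - x - K *\<^sub>v mat_vec F) \<le> \<epsilon> * fnorm F" .
    qed
  qed
  have "\<exists>!x. mtls_solution n1 n2 A b x" "mtls_solution n1 n2 A b xs" unfolding solution xs by simp_all
  with invertible \<delta> expansion frechet show ?thesis
    by (intro conjI exI[of _ \<delta>] exI[of _ C])
qed

end
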